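(* Let $\Gamma(\tau)$ and $\mu(\mathbf{x},\tau)$ be four times differentiable. Let $\mathbf{x}=\mathbf{x}_0+c\sqrt{\Delta t}\,\mathbf{n}$ with $c\in\mathbb{R}$, where $\mathbf{x}_0\in\Gamma(\Delta t)$ is a point on the boundary at time $\Delta t$, $\mathbf{n}$ is the unit inward normal vector to $\Gamma(\Delta t)$ at $\mathbf{x}_0$, $\kappa$ is the curvature and $v$ is the normal velocity of the boundary at $\mathbf{x}_0$ at time $\Delta t$. Then the double layer heat potential $$D[\mu](\mathbf{x},\Delta t)=\int_0^{\Delta t}\int_{\Gamma(\tau)}\frac{\partial}{\partial\nu_{\mathbf{y}}}G(\mathbf{x}-\mathbf{y},\Delta t-\tau)\,\mu(\mathbf{y},\tau)\,ds_{\mathbf{y}}\,d\tau$$ satisfies, as $\Delta t\to0^+$ with $c$ fixed, $$D[\mu](\mathbf{x},\Delta t)=-\sqrt{\frac{\Delta t}{\pi}}\,E_{3/2}\!\left(\frac{c^2}{4}\right)\frac{\kappa+v}{4}\,\mu(\mathbf{x}_0,\Delta t)-\frac{\operatorname{sgn}(c)}{2}\operatorname{erfc}\!\left(\frac{|c|}{2}\right)\left(1+c\sqrt{\Delta t}\,\frac{\kappa-v}{2}\right)\mu(\mathbf{x}_0,\Delta t)+O(\Delta t).$$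
   Context: The spatial dimension is 2 and $G(\mathbf{x},t)=\frac{1}{4\pi t}e^{-\|\mathbf{x}\|^2/(4t)}$ is the heat kernel. For each time $\tau$, $\Omega(\tau)\subset\mathbb{R}^2$ is a bounded domain with smooth boundary $\Gamma(\tau)$, $\partial/\partial\nu_{\mathbf{y}}$ is the derivative with respect to $\mathbf{y}$ in the outward normal direction at $\mathbf{y}\in\Gamma(\tau)$, and $\mu(\mathbf{y},\tau)$ is a density defined for $\mathbf{y}\in\Gamma(\tau)$. Also $E_{3/2}(x)=\int_1^\infty t^{-3/2}e^{-xt}\,dt$, $\operatorname{erfc}(x)=\frac{2}{\sqrt\pi}\int_x^\infty e^{-t^2}\,dt$, and $\operatorname{sgn}$ is the sign function. Target points are written $\mathbf{x}=\mathbf{x}_0+r\,\mathbf{n}$, where $\mathbf{x}_0$ is the point of $\Gamma(\Delta t)$ closest to $\mathbf{x}$ and $r=c\sqrt{\Delta t}$ is the signed distance to the boundary (positive if $\mathbf{x}$ is in the interior $\Omega(\Delta t)$, negative if exterior). Local coordinates: after a Euclidean motion, $\mathbf{x}_0$ is the origin and $\mathbf{n}$ points in the direction of the positive $y$-axis. In these coordinates, for times $\tau\le\Delta t$, the boundary near the origin is the graph $\{(s,y(s,\tau))\}$ of a function with $y(0,\Delta t)=y_s(0,\Delta t)=0$. The curvature and normal velocity are $\kappa=y_{ss}(0,\Delta t)$ and $v=y_\tau(0,\Delta t)$ (so $v$ is the velocity in the direction of $\mathbf{n}$). The density in these coordinates is written $\mu(s,\tau)$. "Four times differentiable" refers to $y(s,\tau)$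 and $\mu(s,\tau)$ as functions of $(s,\tau)$. Standing convention: the boundary is such a graph for $|s|<L$, with $L>0$ independent of $\Delta t$, and the remaining part of the boundary stays away from $\mathbf{x}_0$, so that its contribution is exponentially small; equivalently, up to this error, the boundary may be regarded as a graph over the whole line. The constant in the $O(\cdot)$ may depend on $c$, on the geometry, and on bounds for the derivatives up to order four of $y$ and $\mu$, but not on $\Delta t$. *)

theory Defs
  imports "HOL-Analysis.Analysis" "HOL-Library.Landau_Symbols"
begin

section \<open>Special functions\<close>

definition heat_kernel :: "real ^ 2 \<Rightarrow> real \<Rightarrow> real" where
  "heat_kernel x t = 1 / (4 * pi * t) * exp (- (norm x)\<^sup>2 / (4 * t))"

definition E32 :: "real \<Rightarrow> real" where
  "E32 x = integral {1..} (\<lambda>t. t powr (- 3 / 2) * exp (- x * t))"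

definition erfc :: "real \<Rightarrow> real" where
  "erfc x = 2 / sqrt pi * integral {x..} (\<lambda>t. exp (- t\<^sup>2))"

section \<open>Repeated differentiability in two real variables\<close>

text \<open>
  \<open>f\<close> is \<open>k\<close> times differentiable on \<open>S\<close> (jointly in the two variables, one-sided at points of
  \<open>S\<close> on the boundary of \<open>S\<close>), and all its partial derivatives of order at most \<open>k\<close> are bounded
  by \<open>M\<close>. For the sets used here (an open interval or the line, times \<open>{0..b}\<close> with \<open>b > 0\<close>)
  the functions \<open>f1\<close>, \<open>f2\<close> are uniquely determined on \<open>S\<close>: they are the two partial derivatives.
\<close>
primrec differentiable_bounded ::
  "nat \<Rightarrow> real \<Rightarrow> (real \<times> real) set \<Rightarrow> (real \<times> real \<Rightarrow> 'a::real_normed_vector) \<Rightarrow> bool" where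
  "differentiable_bounded 0 M S f \<longleftrightarrow> (\<forall>z\<in>S. norm (f z) \<le> M)"
| "differentiable_bounded (Suc k) M S f \<longleftrightarrow>
     (\<forall>z\<in>S. norm (f z) \<le> M) \<and>
     (\<exists>f1 f2.
        (\<forall>z\<in>S. (f has_derivative (\<lambda>h. fst h *\<^sub>R f1 z + snd h *\<^sub>R f2 z)) (at z within S)) \<and>
        differentiable_bounded k M S f1 \<and> differentiable_bounded k M S f2)"

section \<open>Moving domains and the double layer heat potential\<close>

text \<open>
  The boundary of \<open>\<Omega> \<tau>\<close> consists of \<open>m\<close> closed curves \<open>\<gamma> j _ \<tau>\<close> (\<open>j < m\<close>), which are
  1-periodic in the parameter; \<open>m > 1\<close> allows domains with holes.
\<close>

definition curve_velocity :: "(nat \<Rightarrow> real \<Rightarrow> real \<Rightarrow> real ^ 2) \<Rightarrow> nat \<Rightarrow> real \<Rightarrow> real \<Rightarrow> real ^ 2" where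
  "curve_velocity \<gamma> j \<theta> \<tau> = vector_derivative (\<lambda>\<theta>'. \<gamma> j \<theta>' \<tau>) (at \<theta>)"

text \<open>Here \<open>w\<close> is a nonzero tangent vector of the boundary of \<open>W\<close> at \<open>p\<close>.\<close>
definition outward_unit_normal ::
  "(real ^ 2) set \<Rightarrow> real ^ 2 \<Rightarrow> real ^ 2 \<Rightarrow> real ^ 2 \<Rightarrow> bool" where
  "outward_unit_normal W p w u \<longleftrightarrow>
     norm u = 1 \<and> u \<bullet> w = 0 \<and>
     (\<exists>\<epsilon>>0. \<forall>h. 0 < h \<and> h < \<epsilon> \<longrightarrow> p - h *\<^sub>R u \<in> W \<and> p + h *\<^sub>R u \<notin> closure W)"

text \<open>
  A family of bounded domains over the times \<open>0 \<le> \<tau> \<le> T\<close> whose boundary is a disjoint union of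
  simple closed regular curves, four times differentiable in parameter and time, with outward
  unit normal \<open>\<nu> \<tau> p\<close> at \<open>p \<in> frontier (\<Omega> \<tau>)\<close>. Continuity of the normal is asked for so that
  the outward side does not jump between the two sides of a curve as time varies.
\<close>
definition moving_domain ::
  "real \<Rightarrow> real \<Rightarrow> (real \<Rightarrow> (real ^ 2) set) \<Rightarrow> nat \<Rightarrow> (nat \<Rightarrow> real \<Rightarrow> real \<Rightarrow> real ^ 2)
     \<Rightarrow> (real \<Rightarrow> real ^ 2 \<Rightarrow> real ^ 2) \<Rightarrow> bool" where
  "moving_domain T M \<Omega> m \<gamma> \<nu> \<longleftrightarrow>
     (\<forall>\<tau>\<in>{0..T}.
        open (\<Omega> \<tau>) \<and> connected (\<Omega> \<tau>) \<and> bounded (\<Omega> \<tau>) \<and> \<Omega> \<tau> \<noteq> {} \<and>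
        frontier (\<Omega> \<tau>) = (\<Union>j<m. range (\<lambda>\<theta>. \<gamma> j \<theta> \<tau>)) \<and>
        (\<forall>j<m. \<forall>\<theta>. \<gamma> j (\<theta> + 1) \<tau> = \<gamma> j \<theta> \<tau>) \<and>
        (\<forall>j<m. \<forall>k<m. \<forall>\<theta>\<in>{0..<1}. \<forall>\<phi>\<in>{0..<1}.
           \<gamma> j \<theta> \<tau> = \<gamma> k \<phi> \<tau> \<longrightarrow> j = k \<and> \<theta> = \<phi>) \<and>
        (\<forall>j<m. \<forall>\<theta>. curve_velocity \<gamma> j \<theta> \<tau> \<noteq> 0 \<and>
           outward_unit_normal (\<Omega> \<tau>) (\<gamma> j \<theta> \<tau>) (curve_velocity \<gamma> j \<theta> \<tau>) (\<nu> \<tau> (\<gamma> j \<theta> \<tau>)))) \<and>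
     (\<forall>j<m. differentiable_bounded 4 M (UNIV \<times> {0..T}) (\<lambda>(\<theta>, \<tau>). \<gamma> j \<theta> \<tau>) \<and>
        continuous_on (UNIV \<times> {0..T}) (\<lambda>(\<theta>, \<tau>). \<nu> \<tau> (\<gamma> j \<theta> \<tau>)))"

text \<open>Integral with respect to arc length over the boundary at time \<open>\<tau>\<close>.\<close>
definition boundary_integral ::
  "nat \<Rightarrow> (nat \<Rightarrow> real \<Rightarrow> real \<Rightarrow> real ^ 2) \<Rightarrow> real \<Rightarrow> (real ^ 2 \<Rightarrow> real) \<Rightarrow> real" where
  "boundary_integral m \<gamma> \<tau> f =
     (\<Sum>j<m. integral {0..1} (\<lambda>\<theta>. f (\<gamma> j \<theta> \<tau>) * norm (curve_velocity \<gamma> j \<theta> \<tau>)))"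

definition directional_deriv :: "(real ^ 2 \<Rightarrow> real) \<Rightarrow> real ^ 2 \<Rightarrow> real ^ 2 \<Rightarrow> real" where
  "directional_deriv f p u = deriv (\<lambda>h. f (p + h *\<^sub>R u)) 0"

definition double_layer ::
  "nat \<Rightarrow> (nat \<Rightarrow> real \<Rightarrow> real \<Rightarrow> real ^ 2) \<Rightarrow> (real \<Rightarrow> real ^ 2 \<Rightarrow> real ^ 2)
     \<Rightarrow> (real ^ 2 \<Rightarrow> real \<Rightarrow> real) \<Rightarrow> real ^ 2 \<Rightarrow> real \<Rightarrow> real" where
  "double_layer m \<gamma> \<nu> \<mu> x t =
     integral {0..t} (\<lambda>\<tau>. boundary_integral m \<gamma> \<tau>
       (\<lambda>p. directional_deriv (\<lambda>q. heat_kernel (x - q) (t - \<tau>)) p (\<nu> \<tau> p) * \<mu> p \<tau>))"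

section \<open>Local coordinates\<close>

text \<open>The point with coordinates \<open>(s, w)\<close> in the frame with origin \<open>x0\<close> and axes \<open>e\<close>, \<open>n\<close>.\<close>
definition local_point :: "real ^ 2 \<Rightarrow> real ^ 2 \<Rightarrow> real ^ 2 \<Rightarrow> real \<Rightarrow> real \<Rightarrow> real ^ 2" where
  "local_point x0 e n s w = x0 + s *\<^sub>R e + w *\<^sub>R n"

text \<open>
  For all times \<open>\<tau> \<in> {0..t}\<close> the boundary near \<open>x0\<close> is, in orthonormal coordinates with axes
  \<open>e\<close>, \<open>n\<close>, the graph of \<open>\<lambda>s. y s \<tau>\<close> for \<open>\<bar>s\<bar> < L\<close>; the rest of the boundary stays at distance
  at least \<open>\<rho>\<close> from \<open>x0\<close>. Near \<open>x0\<close> the domain lies above the graph, as \<open>n\<close> is the inward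
  direction.
\<close>
definition local_graph ::
  "real \<Rightarrow> real \<Rightarrow> real \<Rightarrow> (real \<Rightarrow> (real ^ 2) set) \<Rightarrow> real ^ 2 \<Rightarrow> real ^ 2 \<Rightarrow> real ^ 2
     \<Rightarrow> (real \<Rightarrow> real \<Rightarrow> real) \<Rightarrow> real \<Rightarrow> bool" where
  "local_graph L \<rho> M \<Omega> x0 e n y t \<longleftrightarrow>
     norm e = 1 \<and> norm n = 1 \<and> e \<bullet> n = 0 \<and>
     differentiable_bounded 4 M ({-L<..<L} \<times> {0..t}) (\<lambda>(s, \<tau>). y s \<tau>) \<and>
     y 0 t = 0 \<and> deriv (\<lambda>s. y s t) 0 = 0 \<and>
     (\<forall>\<tau>\<in>{0..t}.
        (\<forall>s. \<bar>s\<bar> < L \<longrightarrow> local_point x0 e n s (y s \<tau>) \<in> frontier (\<Omega> \<tau>)) \<and>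
        (\<forall>p\<in>frontier (\<Omega> \<tau>).
           (\<exists>s. \<bar>s\<bar> < L \<and> p = local_point x0 e n s (y s \<tau>)) \<or> \<rho> \<le> dist x0 p) \<and>
        (\<forall>s w. \<bar>s\<bar> < L \<and> s\<^sup>2 + w\<^sup>2 < \<rho>\<^sup>2 \<longrightarrow>
           (local_point x0 e n s w \<in> \<Omega> \<tau> \<longleftrightarrow> y s \<tau> < w)))"

definition graph_curvature :: "(real \<Rightarrow> real \<Rightarrow> real) \<Rightarrow> real \<Rightarrow> real" where
  "graph_curvature y t = deriv (deriv (\<lambda>s. y s t)) 0"

text \<open>The time derivative is taken from the left, as \<open>y\<close> is only given for times up to \<open>t\<close>.\<close>
definition graph_velocity :: "(real \<Rightarrow> real \<Rightarrow> real) \<Rightarrow> real \<Rightarrow> real" where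
  "graph_velocity y t = vector_derivative (\<lambda>\<tau>. y 0 \<tau>) (at t within {0..t})"

end

theory Submission
  imports Defs "HOL-Probability.Distributions" "HOL-Library.Periodic_Fun"
begin

text \<open>
  Write \<open>u = \<Delta>t - \<tau>\<close> for the elapsed time and \<open>r = c \<surd>\<Delta>t\<close>. Near the target the boundary is the graph of
  \<open>y\<close>; there the arc length element cancels the normalisation of the normal, and the density of
  the potential in the graph coordinate \<open>s\<close> is
  \<open>(y - s y\<^sub>s - r) / (8 \<pi> u\<^sup>2) exp (- (s\<^sup>2 + (r - y)\<^sup>2) / (4 u)) \<mu>\<close>. The natural scaling gives weight 1
  to \<open>s\<close> and \<open>r\<close> and weight 2 to \<open>u\<close>. With \<open>y = \<kappa> s\<^sup>2 / 2 - v u + \<dots>\<close> and \<open>\<mu> = \<mu>\<^sub>0 + \<mu>\<^sub>1 s + \<dots>\<close>, where the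
  dots have weight at least 3 and 2, the flux factor \<open>y - s y\<^sub>s - r\<close> is \<open>- r\<close>, plus the weight 2 term
  \<open>- (\<kappa> s\<^sup>2 / 2 + v u)\<close>, plus terms of weight 3, and the Gaussian is \<open>exp (- (s\<^sup>2 + r\<^sup>2) / (4 u))\<close>
  times \<open>1 + r y / (2 u) + \<dots>\<close>.
  
  A term of weight \<open>d\<close> in the numerator contributes \<open>u\<close> to the power \<open>(d - 3) / 2\<close> after integration
  over \<open>s\<close>, times a bounded function of \<open>r\<^sup>2 / u\<close>, since powers of \<open>r\<^sup>2 / u\<close> are absorbed by
  \<open>exp (- r\<^sup>2 / (4 u))\<close>. Hence everything of weight 3 or more gives a quantity that is bounded
  uniformly in \<open>u\<close>, and its integral over \<open>0 < u < \<Delta>t\<close> is \<open>O(\<Delta>t)\<close>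
  (\<open>layer_integrand_expansion\<close>, \<open>layer_integral_estimate\<close>). The remaining terms are integrated
  exactly: over \<open>s\<close> by Gaussian moments, where the term with \<open>\<mu>\<^sub>1\<close> is odd and drops out
  (\<open>has_integral_leading_integrand\<close>), and over time by substitutions that turn
  the integrals of \<open>u powr (- 1 / 2)\<close> and \<open>u powr (- 3 / 2)\<close>, times \<open>exp (- r\<^sup>2 / (4 u))\<close>, into \<open>E32\<close> and \<open>erfc\<close>
  (\<open>has_integral_leading_integral\<close>).
  
  It remains to pass from the parametrised closed curves to the graph. The coordinate
  \<open>\<theta> \<mapsto> (\<gamma> j \<theta> \<tau> - x0) \<bullet> e\<close>, restricted to the parameters of points close to \<open>x0\<close>, is injective, and
  the ranges for the different curves partition the interval \<open>\<bar>s\<bar> < \<delta>\<close>; the change of variables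
  formula for measurable sets then gives the graph integral (\<open>boundary_integral_near_far\<close>). On the
  rest of the boundary the distance to the target is at least \<open>\<delta> / 2\<close>, so the kernel is bounded
  uniformly in \<open>u\<close> (\<open>far_kernel_bound\<close>). This also is \<open>O(\<Delta>t)\<close> after integration in time. Altogether
  the boundary integral at every single time differs from the leading term by at most a constant
  (\<open>boundary_integral_estimate\<close>).
\<close>

section \<open>Second order expansion of the integrand\<close>

lemma power_le_fact_mult_exp:
  fixes x :: real
  assumes "0 \<le> x"
  shows "x ^ n \<le> fact n * exp x"
proof -
  have "(\<Sum>k\<in>{n}. x ^ k /\<^sub>R fact k) \<le> (\<Sum>k. x ^ k /\<^sub>R fact k)"
    by (rule sum_le_suminf) (use assms summable_exp_generic[of x] in auto)
  then have "x ^ n / fact n \<le> exp x"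
    by (simp add: exp_def divide_inverse mult.commute)
  then show ?thesis
    by (simp add: field_simps)
qed

text \<open>
  Polynomial factors in the scaled variables are paid for with a small part of the Gaussian
  exponent; the exponent \<open>1/16\<close> leaves room for two such losses between \<open>1/4\<close> and \<open>1/8\<close>.
\<close>
lemma polynomial_le_gaussian:
  fixes x :: real
  shows "(1 + \<bar>x\<bar>) ^ n \<le> fact n * exp 5 * exp (x\<^sup>2 / 16)"
proof -
  have "0 \<le> (\<bar>x\<bar> / 4 - 2)\<^sup>2" by simp
  then have "1 + \<bar>x\<bar> \<le> 5 + x\<^sup>2 / 16"
    by (simp add: power2_eq_square algebra_simps)
  then have "fact n * exp (1 + \<bar>x\<bar>) \<le> fact n * exp (5 + x\<^sup>2 / 16)"
    by simp
  moreover have "(1 + \<bar>x\<bar>) ^ n \<le> fact n * exp (1 + \<bar>x\<bar>)"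
    by (intro power_le_fact_mult_exp) auto
  ultimately have "(1 + \<bar>x\<bar>) ^ n \<le> fact n * exp (5 + x\<^sup>2 / 16)"
    by linarith
  then show ?thesis
    by (simp only: exp_add mult.assoc)
qed

text \<open>
  In \<open>exp (- (s\<^sup>2 + (r - Y)\<^sup>2) / (4 u))\<close> the correction to the exponent is \<open>r Y / (2 u) - Y\<^sup>2 / (4 u)\<close>. Only
  the first summand is small compared with the Gaussian exponent. The second may be large, but it
  has a good sign; this is why the bound contains \<open>exp \<bar>a\<bar>\<close> and no exponential of \<open>b\<close>.
\<close>
lemma exp_diff_first_order:
  fixes a b :: real
  assumes "0 \<le> b"
  shows "\<bar>exp (a - b) - 1 - a\<bar> \<le> exp \<bar>a\<bar> * (b + a\<^sup>2)"
proof -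
  have "exp a - 1 \<le> a * exp a"
    using exp_ge_add_one_self[of "-a"] mult_left_mono[of "1 - a" "exp (-a)" "exp a"]
    by (simp add: algebra_simps exp_minus_inverse)
  moreover have lower: "1 + a \<le> exp a" by simp
  ultimately have "exp a - 1 - a \<le> a\<^sup>2 * exp \<bar>a\<bar>"
  proof (cases "a \<ge> 0")
    case True
    then have "a * (exp a - 1) \<le> a * (a * exp a)"
      using \<open>exp a - 1 \<le> a * exp a\<close> by (intro mult_left_mono)
    with \<open>exp a - 1 \<le> a * exp a\<close> True show ?thesis
      by (simp add: power2_eq_square algebra_simps)
  next
    case False
    then have "(- a) * (1 - exp a) \<le> (- a) * (- a)"
      using lower False by (intro mult_left_mono; linarith)
    also have "\<dots> \<le> a\<^sup>2 * exp \<bar>a\<bar>"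
      using mult_left_mono[of 1 "exp \<bar>a\<bar>" "a\<^sup>2"] by (simp add: power2_eq_square)
    finally show ?thesis
      using \<open>exp a - 1 \<le> a * exp a\<close> by (simp add: algebra_simps)
  qed
  with lower have 1: "\<bar>exp a - 1 - a\<bar> \<le> a\<^sup>2 * exp \<bar>a\<bar>" by linarith
  have "1 - exp (- b) \<le> b" "0 \<le> 1 - exp (- b)"
    using exp_ge_add_one_self[of "- b"] assms by auto
  then have "exp a * (1 - exp (- b)) \<le> exp \<bar>a\<bar> * b" "0 \<le> exp a * (1 - exp (- b))"
    by (auto intro!: mult_mono)
  moreover have "exp (a - b) = exp a * exp (- b)"
    by (simp add: exp_add[symmetric])
  ultimately have "\<bar>exp (a - b) - 1 - a\<bar> \<le> \<bar>exp a - 1 - a\<bar> + exp \<bar>a\<bar> * b"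
    unfolding right_diff_distrib by linarith
  then show ?thesis
    using 1 by (simp add: algebra_simps)
qed

text \<open>
  The six products of coefficients that are left after first order are each bounded by \<open>P * Q\<close>, as
  \<open>w \<le> 1\<close>. Since \<open>r\<close> is the second order coefficient of the product, a third factor can be treated by
  a second application.
\<close>
lemma second_order_product:
  fixes w p0 p1 p2 q0 q1 q2 P Q :: real
  assumes w: "0 \<le> w" "w \<le> 1"
    and P: "\<bar>p0\<bar> \<le> P" "\<bar>p1\<bar> \<le> P" "\<bar>p2\<bar> \<le> P"
    and Q: "\<bar>q0\<bar> \<le> Q" "\<bar>q1\<bar> \<le> Q" "\<bar>q2\<bar> \<le> Q"
  obtains r where
    "(p0 + w * p1 + w\<^sup>2 * p2) * (q0 + w * q1 + w\<^sup>2 * q2)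
       = p0 * q0 + w * (p0 * q1 + p1 * q0) + w\<^sup>2 * r"
    "\<bar>r\<bar> \<le> 6 * (P * Q)"
proof
  let ?r = "p0 * q2 + p1 * q1 + p2 * q0 + w * (p1 * q2) + w * (p2 * q1) + w\<^sup>2 * (p2 * q2)"
  show "(p0 + w * p1 + w\<^sup>2 * p2) * (q0 + w * q1 + w\<^sup>2 * q2)
       = p0 * q0 + w * (p0 * q1 + p1 * q0) + w\<^sup>2 * ?r"
    by (simp add: algebra_simps power2_eq_square)
  have prod: "\<bar>a * b\<bar> \<le> P * Q" if "\<bar>a\<bar> \<le> P" "\<bar>b\<bar> \<le> Q" for a b
    using that by (simp add: abs_mult mult_mono)
  have wprod: "\<bar>x * (a * b)\<bar> \<le> P * Q" if "0 \<le> x" "x \<le> 1" "\<bar>a\<bar> \<le> P" "\<bar>b\<bar> \<le> Q" for x a b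
    using prod[OF that(3,4)] mult_mono[of x 1 "\<bar>a * b\<bar>" "P * Q"] that(1,2)
    by (simp add: abs_mult)
  have w2: "0 \<le> w\<^sup>2" "w\<^sup>2 \<le> 1"
    using w by (auto simp: power_le_one)
  show "\<bar>?r\<bar> \<le> 6 * (P * Q)"
    using prod[OF P(1) Q(3)] prod[OF P(2) Q(2)] prod[OF P(3) Q(1)]
      wprod[OF w P(2) Q(3)] wprod[OF w P(3) Q(2)] wprod[OF w2 P(3) Q(3)]
    by linarith
qed

text \<open>
  The constant of \<open>scaled_expansion\<close>: the factor 36 comes from two applications of
  \<open>second_order_product\<close>, \<open>K ^ 4\<close> from the bounds of the three factors, the factorials from
  \<open>polynomial_le_gaussian\<close> for the ninth power of \<open>1 + \<bar>\<sigma>\<bar>\<close> and the third power of \<open>1 + \<bar>R\<bar>\<close>, and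
  \<open>exp 1\<close> dominates the constant factor \<open>exp (1 / 16)\<close> in \<open>X\<close>.
\<close>
definition expansion_const :: "real \<Rightarrow> real" where
  "expansion_const K = 36 * K ^ 4 * (fact 9 * exp 5) * (fact 3 * exp 5) * exp 1"

text \<open>
  The heart of the estimate, in the variables \<open>w = \<surd>u\<close>, \<open>\<sigma> = s / w\<close>, \<open>R = r / w\<close>, \<open>\<eta> = y / u\<close>,
  \<open>\<zeta> = (y - s y\<^sub>s) / u\<close>, in which the weight of a term is its power of \<open>w\<close>. The flux factor, the
  exponential and the density are truncated series in \<open>w\<close> with coefficients that are polynomially
  bounded in \<open>\<sigma>\<close> and \<open>R\<close>, up to the factor \<open>X = exp ((1 + \<sigma>\<^sup>2) / 16)\<close> for the exponential. The
  smallness of \<open>\<bar>R\<bar> w K = \<bar>r\<bar> K\<close> is what keeps this growth below the decay of \<open>exp (- \<sigma>\<^sup>2 / 4)\<close>.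
\<close>
lemma scaled_expansion:
  fixes w \<sigma> R \<eta> \<zeta> q \<kappa> v \<mu>0 \<mu>1 K :: real
  assumes w: "0 < w" "w \<le> 1" and K: "1 \<le> K"
    and bounds: "\<bar>\<kappa>\<bar> \<le> K" "\<bar>v\<bar> \<le> K" "\<bar>\<mu>0\<bar> \<le> K" "\<bar>\<mu>1\<bar> \<le> K"
    and \<eta>: "\<bar>\<eta> - (\<kappa> * \<sigma>\<^sup>2 / 2 - v)\<bar> \<le> K * w * (1 + \<bar>\<sigma>\<bar>) ^ 3" "\<bar>\<eta>\<bar> \<le> K * (1 + \<bar>\<sigma>\<bar>)\<^sup>2"
    and \<zeta>: "\<bar>\<zeta> + (\<kappa> * \<sigma>\<^sup>2 / 2 + v)\<bar> \<le> K * w * (1 + \<bar>\<sigma>\<bar>) ^ 3"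
    and q: "\<bar>q - \<mu>0 - w * (\<mu>1 * \<sigma>)\<bar> \<le> K * w\<^sup>2 * (1 + \<bar>\<sigma>\<bar>)\<^sup>2"
    and small: "\<bar>R\<bar> * w * K \<le> 1 / 16"
  shows "exp (- \<sigma>\<^sup>2 / 4) * exp (- R\<^sup>2 / 4) *
      \<bar>(w * \<zeta> - R) * exp (R * w * \<eta> / 2 - w\<^sup>2 * \<eta>\<^sup>2 / 4) * q
        - (- R * \<mu>0 + w * (- (\<kappa> * \<sigma>\<^sup>2 / 2 + v) * \<mu>0 - R\<^sup>2 * (\<kappa> * \<sigma>\<^sup>2 / 2 - v) * \<mu>0 / 2
                            - R * \<mu>1 * \<sigma>))\<bar>
      \<le> expansion_const K * w\<^sup>2 * exp (- \<sigma>\<^sup>2 / 8)"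
proof -
  define P where "P = 1 + \<bar>\<sigma>\<bar>"
  define Q where "Q = 1 + \<bar>R\<bar>"
  define X where "X = exp ((1 + \<sigma>\<^sup>2) / 16)"
  have P1: "1 \<le> P" and Q1: "1 \<le> Q" and X1: "1 \<le> X"
    by (auto simp: P_def Q_def X_def)
  have PP: "1 \<le> P ^ k" and QQ: "1 \<le> Q ^ k" and KK: "1 \<le> K ^ k" for k
    using P1 Q1 K by (auto intro: one_le_power)
  have \<sigma>P: "\<bar>\<sigma>\<bar> \<le> P" "\<sigma>\<^sup>2 / 2 + 1 \<le> P\<^sup>2" "P\<^sup>2 \<le> 2 * (1 + \<sigma>\<^sup>2)"
  proof -
    show "\<bar>\<sigma>\<bar> \<le> P" by (simp add: P_def)
    show "\<sigma>\<^sup>2 / 2 + 1 \<le> P\<^sup>2" by (simp add: P_def power2_eq_square algebra_simps)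
    have "0 \<le> (1 - \<bar>\<sigma>\<bar>)\<^sup>2" by simp
    then show "P\<^sup>2 \<le> 2 * (1 + \<sigma>\<^sup>2)" by (simp add: P_def power2_eq_square algebra_simps)
  qed
  have RQ: "\<bar>R\<bar> \<le> Q" by (simp add: Q_def)
  define \<alpha> where "\<alpha> = - (\<kappa> * \<sigma>\<^sup>2 / 2 + v)"
  define \<beta> where "\<beta> = \<kappa> * \<sigma>\<^sup>2 / 2 - v"
  have "\<bar>\<kappa> * \<sigma>\<^sup>2 / 2\<bar> \<le> K * (\<sigma>\<^sup>2 / 2)"
    using bounds(1) by (simp add: abs_mult mult_right_mono)
  then have \<alpha>\<beta>': "\<bar>\<alpha>\<bar> \<le> K * (\<sigma>\<^sup>2 / 2 + 1)" "\<bar>\<beta>\<bar> \<le> K * (\<sigma>\<^sup>2 / 2 + 1)"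
    using bounds(2) unfolding \<alpha>_def \<beta>_def by (auto simp: algebra_simps)
  have "K * (\<sigma>\<^sup>2 / 2 + 1) \<le> K * P\<^sup>2"
    using \<sigma>P K by (intro mult_left_mono) auto
  with \<alpha>\<beta>' have \<alpha>\<beta>: "\<bar>\<alpha>\<bar> \<le> K * P\<^sup>2" "\<bar>\<beta>\<bar> \<le> K * P\<^sup>2" by auto
  (* Flux factor, exponential and density, each as a series in w up to second order. *)
  define a2 where "a2 = (\<zeta> - \<alpha>) / w"
  have a: "w * \<zeta> - R = - R + w * \<alpha> + w\<^sup>2 * a2"
    using w by (simp add: a2_def field_simps power2_eq_square)
  have a2: "\<bar>a2\<bar> \<le> K * P ^ 3"
    using \<zeta> w by (simp add: a2_def \<alpha>_def abs_divide P_def field_simps)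
  define b2 where "b2 = (exp (R * w * \<eta> / 2 - w\<^sup>2 * \<eta>\<^sup>2 / 4) - 1 - w * (R * \<beta> / 2)) / w\<^sup>2"
  have b: "exp (R * w * \<eta> / 2 - w\<^sup>2 * \<eta>\<^sup>2 / 4) = 1 + w * (R * \<beta> / 2) + w\<^sup>2 * b2"
    using w by (simp add: b2_def)
  have b2: "\<bar>b2\<bar> \<le> K\<^sup>2 * P ^ 4 * Q\<^sup>2 * X"
  proof -
    have "\<bar>R * w * \<eta> / 2\<bar> = \<bar>R\<bar> * w * \<bar>\<eta>\<bar> / 2"
      using w by (simp add: abs_mult)
    also have "\<dots> \<le> \<bar>R\<bar> * w * (K * P\<^sup>2) / 2"
      using \<eta>(2) w by (intro divide_right_mono mult_left_mono) (auto simp: P_def)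
    also have "\<dots> = \<bar>R\<bar> * w * K * (P\<^sup>2 / 2)" by simp
    also have "\<dots> \<le> 1 / 16 * (1 + \<sigma>\<^sup>2)"
      using small \<sigma>P(3) by (intro mult_mono) auto
    finally have X: "exp \<bar>R * w * \<eta> / 2\<bar> \<le> X" by (simp add: X_def)
    have sq: "\<eta>\<^sup>2 \<le> K\<^sup>2 * P ^ 4"
    proof -
      have "\<bar>\<eta>\<bar>\<^sup>2 \<le> (K * P\<^sup>2)\<^sup>2"
        using \<eta>(2) by (intro power_mono) (auto simp: P_def)
      then show ?thesis by (simp add: power_mult_distrib flip: power_mult)
    qed
    have R2: "R\<^sup>2 \<le> Q\<^sup>2" "1 \<le> Q\<^sup>2"
      using power_mono[OF RQ, of 2] QQ[of 2] by auto
    have "w\<^sup>2 * \<eta>\<^sup>2 / 4 + (R * w * \<eta> / 2)\<^sup>2 = w\<^sup>2 * (\<eta>\<^sup>2 * ((1 + R\<^sup>2) / 4))"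
      by (simp add: power_mult_distrib power_divide algebra_simps add_divide_distrib)
    also have "\<dots> \<le> w\<^sup>2 * (K\<^sup>2 * P ^ 4 * (Q\<^sup>2 / 2))"
      using sq R2 by (intro mult_left_mono mult_mono) auto
    finally have 1: "w\<^sup>2 * \<eta>\<^sup>2 / 4 + (R * w * \<eta> / 2)\<^sup>2 \<le> w\<^sup>2 * (K\<^sup>2 * P ^ 4 * (Q\<^sup>2 / 2))" .
    have "\<bar>exp (R * w * \<eta> / 2 - w\<^sup>2 * \<eta>\<^sup>2 / 4) - 1 - R * w * \<eta> / 2\<bar>
        \<le> exp \<bar>R * w * \<eta> / 2\<bar> * (w\<^sup>2 * \<eta>\<^sup>2 / 4 + (R * w * \<eta> / 2)\<^sup>2)"
      by (rule exp_diff_first_order) auto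
    also have "\<dots> \<le> X * (w\<^sup>2 * (K\<^sup>2 * P ^ 4 * (Q\<^sup>2 / 2)))"
      using X 1 by (intro mult_mono) (auto simp: X_def)
    finally have e1: "\<bar>exp (R * w * \<eta> / 2 - w\<^sup>2 * \<eta>\<^sup>2 / 4) - 1 - R * w * \<eta> / 2\<bar>
        \<le> w\<^sup>2 * (K\<^sup>2 * P ^ 4 * Q\<^sup>2 * X / 2)" by (simp add: algebra_simps)
    have "\<bar>R * w * \<eta> / 2 - w * (R * \<beta> / 2)\<bar> = \<bar>R\<bar> * w / 2 * \<bar>\<eta> - \<beta>\<bar>"
      using w by (simp add: abs_mult right_diff_distrib[symmetric] diff_divide_distrib[symmetric]
          mult.assoc mult.left_commute)
    also have "\<dots> \<le> Q * w / 2 * (K * w * P ^ 3)"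
      using \<eta>(1) w RQ Q1 by (intro mult_mono divide_right_mono) (auto simp: P_def \<beta>_def)
    also have "\<dots> = w\<^sup>2 / 2 * (Q * K * P ^ 3)" by (simp add: power2_eq_square)
    also have "\<dots> \<le> w\<^sup>2 / 2 * (Q\<^sup>2 * K\<^sup>2 * P ^ 4 * X)"
    proof (intro mult_left_mono)
      have "Q ^ 1 * K ^ 1 * P ^ 3 \<le> Q\<^sup>2 * K\<^sup>2 * P ^ 4"
        using P1 Q1 K by (intro mult_mono power_increasing) auto
      then have "Q * K * P ^ 3 \<le> Q\<^sup>2 * K\<^sup>2 * P ^ 4 * 1" by simp
      also have "\<dots> \<le> Q\<^sup>2 * K\<^sup>2 * P ^ 4 * X"
        using X1 P1 by (intro mult_left_mono) auto
      finally show "Q * K * P ^ 3 \<le> Q\<^sup>2 * K\<^sup>2 * P ^ 4 * X" .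
    qed auto
    finally have e2: "\<bar>R * w * \<eta> / 2 - w * (R * \<beta> / 2)\<bar> \<le> w\<^sup>2 * (K\<^sup>2 * P ^ 4 * Q\<^sup>2 * X / 2)"
      by (simp add: algebra_simps)
    have "\<bar>exp (R * w * \<eta> / 2 - w\<^sup>2 * \<eta>\<^sup>2 / 4) - 1 - w * (R * \<beta> / 2)\<bar>
        \<le> w\<^sup>2 * (K\<^sup>2 * P ^ 4 * Q\<^sup>2 * X)"
      using e1 e2 by (simp only: abs_le_iff) (simp add: field_simps)
    then show ?thesis
      using w by (simp add: b2_def abs_divide field_simps)
  qed
  define c2 where "c2 = (q - \<mu>0 - w * (\<mu>1 * \<sigma>)) / w\<^sup>2"
  have c: "q = \<mu>0 + w * (\<mu>1 * \<sigma>) + w\<^sup>2 * c2"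
    using w by (simp add: c2_def)
  have c2: "\<bar>c2\<bar> \<le> K * P\<^sup>2"
    using q w by (simp add: c2_def abs_divide P_def field_simps)
  have A: "\<bar>- R\<bar> \<le> K * P ^ 3 * Q" "\<bar>\<alpha>\<bar> \<le> K * P ^ 3 * Q" "\<bar>a2\<bar> \<le> K * P ^ 3 * Q"
  proof -
    have "1 * 1 * \<bar>R\<bar> \<le> K * P ^ 3 * Q"
      using K PP[of 3] RQ P1 by (intro mult_mono) auto
    then show "\<bar>- R\<bar> \<le> K * P ^ 3 * Q" by simp
    have "K * P ^ 2 * 1 \<le> K * P ^ 3 * Q"
      using K P1 Q1 by (intro mult_mono power_increasing) auto
    then show "\<bar>\<alpha>\<bar> \<le> K * P ^ 3 * Q" using \<alpha>\<beta> by simp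
    have "K * P ^ 3 * 1 \<le> K * P ^ 3 * Q"
      using K P1 Q1 by (intro mult_mono) auto
    then show "\<bar>a2\<bar> \<le> K * P ^ 3 * Q" using a2 by simp
  qed
  have B: "\<bar>1\<bar> \<le> K\<^sup>2 * P ^ 4 * Q\<^sup>2 * X" "\<bar>R * \<beta> / 2\<bar> \<le> K\<^sup>2 * P ^ 4 * Q\<^sup>2 * X"
  proof -
    have "1 * 1 * 1 * 1 \<le> K\<^sup>2 * P ^ 4 * Q\<^sup>2 * X"
      using KK[of 2] PP[of 4] QQ[of 2] X1 by (intro mult_mono) auto
    then show "\<bar>1\<bar> \<le> K\<^sup>2 * P ^ 4 * Q\<^sup>2 * X" by simp
    have "\<bar>R * \<beta> / 2\<bar> \<le> \<bar>R\<bar> * \<bar>\<beta>\<bar>" by (simp add: abs_mult)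
    also have "\<dots> \<le> Q ^ 1 * (K ^ 1 * P\<^sup>2)"
      using RQ \<alpha>\<beta>(2) Q1 by (intro mult_mono) auto
    also have "\<dots> = K ^ 1 * P\<^sup>2 * Q ^ 1 * 1" by simp
    also have "\<dots> \<le> K\<^sup>2 * P ^ 4 * Q\<^sup>2 * X"
      using K P1 Q1 X1 by (intro mult_mono power_increasing) auto
    finally show "\<bar>R * \<beta> / 2\<bar> \<le> K\<^sup>2 * P ^ 4 * Q\<^sup>2 * X" .
  qed
  have C: "\<bar>\<mu>0\<bar> \<le> K * P\<^sup>2" "\<bar>\<mu>1 * \<sigma>\<bar> \<le> K * P\<^sup>2"
  proof -
    have "K * 1 \<le> K * P\<^sup>2" using K PP[of 2] by (intro mult_left_mono) auto
    then show "\<bar>\<mu>0\<bar> \<le> K * P\<^sup>2" using bounds by simp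
    have "\<bar>\<mu>1 * \<sigma>\<bar> \<le> K * P ^ 1"
      using bounds \<sigma>P(1) K by (simp add: abs_mult mult_mono)
    also have "\<dots> \<le> K * P\<^sup>2"
      using K P1 by (intro mult_left_mono power_increasing) auto
    finally show "\<bar>\<mu>1 * \<sigma>\<bar> \<le> K * P\<^sup>2" .
  qed
  define G where "G = K * P ^ 3 * Q * (K\<^sup>2 * P ^ 4 * Q\<^sup>2 * X)"
  obtain r where r: "(- R + w * \<alpha> + w\<^sup>2 * a2) * (1 + w * (R * \<beta> / 2) + w\<^sup>2 * b2)
       = - R * 1 + w * (- R * (R * \<beta> / 2) + \<alpha> * 1) + w\<^sup>2 * r"
    "\<bar>r\<bar> \<le> 6 * G"
    unfolding G_def using second_order_product[OF _ w(2) A B b2] w by auto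
  have D: "\<bar>- R * 1\<bar> \<le> 6 * G" "\<bar>- R * (R * \<beta> / 2) + \<alpha> * 1\<bar> \<le> 6 * G"
  proof -
    have prod: "\<bar>x * z\<bar> \<le> G" if "\<bar>x\<bar> \<le> K * P ^ 3 * Q" "\<bar>z\<bar> \<le> K\<^sup>2 * P ^ 4 * Q\<^sup>2 * X" for x z
      using that by (simp add: abs_mult G_def mult_mono)
    show "\<bar>- R * 1\<bar> \<le> 6 * G" using prod[OF A(1) B(1)] by linarith
    show "\<bar>- R * (R * \<beta> / 2) + \<alpha> * 1\<bar> \<le> 6 * G"
      using prod[OF A(1) B(2)] prod[OF A(2) B(1)] by linarith
  qed
  obtain r' where r': "(- R * 1 + w * (- R * (R * \<beta> / 2) + \<alpha> * 1) + w\<^sup>2 * r) *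
         (\<mu>0 + w * (\<mu>1 * \<sigma>) + w\<^sup>2 * c2)
       = - R * 1 * \<mu>0 + w * (- R * 1 * (\<mu>1 * \<sigma>) + (- R * (R * \<beta> / 2) + \<alpha> * 1) * \<mu>0) + w\<^sup>2 * r'"
    "\<bar>r'\<bar> \<le> 6 * (6 * G * (K * P\<^sup>2))"
    using second_order_product[OF _ w(2) D r(2) C c2] w by auto
  have "(w * \<zeta> - R) * exp (R * w * \<eta> / 2 - w\<^sup>2 * \<eta>\<^sup>2 / 4) * q
        - (- R * \<mu>0 + w * (- (\<kappa> * \<sigma>\<^sup>2 / 2 + v) * \<mu>0 - R\<^sup>2 * (\<kappa> * \<sigma>\<^sup>2 / 2 - v) * \<mu>0 / 2
                            - R * \<mu>1 * \<sigma>)) = w\<^sup>2 * r'"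
    unfolding a b c r(1) r'(1) by (simp add: \<alpha>_def \<beta>_def power2_eq_square field_simps)
  then have "\<bar>(w * \<zeta> - R) * exp (R * w * \<eta> / 2 - w\<^sup>2 * \<eta>\<^sup>2 / 4) * q
        - (- R * \<mu>0 + w * (- (\<kappa> * \<sigma>\<^sup>2 / 2 + v) * \<mu>0 - R\<^sup>2 * (\<kappa> * \<sigma>\<^sup>2 / 2 - v) * \<mu>0 / 2
                            - R * \<mu>1 * \<sigma>))\<bar> = w\<^sup>2 * \<bar>r'\<bar>"
    (is "?lhs = _") by (simp add: abs_mult)
  also have "\<dots> \<le> w\<^sup>2 * (36 * K ^ 4 * P ^ 9 * Q ^ 3 * X)"
    using r'(2) by (intro mult_left_mono) (auto simp: G_def power_numeral_reduce algebra_simps)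
  finally have "exp (- \<sigma>\<^sup>2 / 4) * exp (- R\<^sup>2 / 4) * ?lhs
      \<le> exp (- \<sigma>\<^sup>2 / 4) * exp (- R\<^sup>2 / 4) * (w\<^sup>2 * (36 * K ^ 4 * P ^ 9 * Q ^ 3 * X))"
    by (intro mult_left_mono) auto
  also have "\<dots> = w\<^sup>2 * (36 * K ^ 4) * (P ^ 9 * (exp (- \<sigma>\<^sup>2 / 4) * X)) * (Q ^ 3 * exp (- R\<^sup>2 / 4))"
    by (simp add: algebra_simps)
  also have "\<dots> \<le> w\<^sup>2 * (36 * K ^ 4) * (fact 9 * exp 5 * exp (1 - \<sigma>\<^sup>2 / 8)) * (fact 3 * exp 5)"
  proof -
    have "P ^ 9 * (exp (- \<sigma>\<^sup>2 / 4) * X) \<le> fact 9 * exp 5 * exp (\<sigma>\<^sup>2 / 16) * (exp (- \<sigma>\<^sup>2 / 4) * X)"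
      unfolding P_def by (intro mult_right_mono polynomial_le_gaussian) (auto simp: X_def)
    also have "\<dots> = fact 9 * exp 5 * exp (\<sigma>\<^sup>2 / 16 + (- \<sigma>\<^sup>2 / 4 + (1 + \<sigma>\<^sup>2) / 16))"
      by (simp only: X_def exp_add mult.assoc)
    also have "\<dots> \<le> fact 9 * exp 5 * exp (1 - \<sigma>\<^sup>2 / 8)"
      by (intro mult_left_mono) (auto simp: field_simps)
    finally have 1: "P ^ 9 * (exp (- \<sigma>\<^sup>2 / 4) * X) \<le> fact 9 * exp 5 * exp (1 - \<sigma>\<^sup>2 / 8)" .
    have "Q ^ 3 * exp (- R\<^sup>2 / 4) \<le> fact 3 * exp 5 * exp (R\<^sup>2 / 16) * exp (- R\<^sup>2 / 4)"
      unfolding Q_def by (intro mult_right_mono polynomial_le_gaussian) auto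
    also have "\<dots> = fact 3 * exp 5 * exp (R\<^sup>2 / 16 + - R\<^sup>2 / 4)"
      by (simp only: exp_add mult.assoc)
    also have "\<dots> \<le> fact 3 * exp 5 * 1"
      by (intro mult_left_mono) auto
    finally have 2: "Q ^ 3 * exp (- R\<^sup>2 / 4) \<le> fact 3 * exp 5" by simp
    show ?thesis
      using K P1 Q1 by (intro mult_mono[OF mult_left_mono[OF 1] 2]) (auto simp: X_def)
  qed
  also have "\<dots> = expansion_const K * w\<^sup>2 * exp (- \<sigma>\<^sup>2 / 8)"
    using exp_add[of 1 "- \<sigma>\<^sup>2 / 8"] by (simp add: expansion_const_def)
  finally show ?thesis .
qed


text \<open>
  The double layer density on the graph, against \<open>ds\<close>: \<open>Y\<close> stands for \<open>y\<close>, \<open>A\<close> for \<open>y - s y\<^sub>s\<close> and \<open>q\<close>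
  for the value of \<open>\<mu>\<close>.
\<close>
definition layer_integrand :: "real \<Rightarrow> real \<Rightarrow> real \<Rightarrow> real \<Rightarrow> real \<Rightarrow> real \<Rightarrow> real" where
  "layer_integrand r Y A q u s =
     1 / (8 * pi * u\<^sup>2) * (A - r) * exp (- (s\<^sup>2 + (r - Y)\<^sup>2) / (4 * u)) * q"

text \<open>
  The part of \<open>layer_integrand\<close> whose numerator has weight 1 or 2. The third summand is the product
  of the flux \<open>- r\<close> with the first order term \<open>r Y / (2 u)\<close> of the exponential.
\<close>
definition leading_integrand ::
  "real \<Rightarrow> real \<Rightarrow> real \<Rightarrow> real \<Rightarrow> real \<Rightarrow> real \<Rightarrow> real \<Rightarrow> real" where
  "leading_integrand r \<kappa> v \<mu>0 \<mu>1 u s =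
     1 / (8 * pi * u\<^sup>2) * exp (- (s\<^sup>2 + r\<^sup>2) / (4 * u)) *
       (- r * \<mu>0 - (\<kappa> * s\<^sup>2 / 2 + v * u) * \<mu>0 - r\<^sup>2 * (\<kappa> * s\<^sup>2 / 2 - v * u) * \<mu>0 / (2 * u)
        - r * \<mu>1 * s)"

lemma layer_integrand_expansion:
  fixes u s r Y A q \<kappa> v \<mu>0 \<mu>1 K :: real
  assumes u: "0 < u" "u \<le> 1" and K: "1 \<le> K"
    and bounds: "\<bar>\<kappa>\<bar> \<le> K" "\<bar>v\<bar> \<le> K" "\<bar>\<mu>0\<bar> \<le> K" "\<bar>\<mu>1\<bar> \<le> K"
    and Y: "\<bar>Y - (\<kappa> * s\<^sup>2 / 2 - v * u)\<bar> \<le> K * (sqrt u + \<bar>s\<bar>) ^ 3" "\<bar>Y\<bar> \<le> K * (sqrt u + \<bar>s\<bar>)\<^sup>2"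
    and A: "\<bar>A + (\<kappa> * s\<^sup>2 / 2 + v * u)\<bar> \<le> K * (sqrt u + \<bar>s\<bar>) ^ 3"
    and q: "\<bar>q - \<mu>0 - \<mu>1 * s\<bar> \<le> K * (sqrt u + \<bar>s\<bar>)\<^sup>2"
    and small: "\<bar>r\<bar> * K \<le> 1 / 16"
  shows "\<bar>layer_integrand r Y A q u s - leading_integrand r \<kappa> v \<mu>0 \<mu>1 u s\<bar>
      \<le> expansion_const K / sqrt u * exp (- s\<^sup>2 / (8 * u))"
proof -
  define w where "w = sqrt u"
  have w: "0 < w" "w \<le> 1" and u_w: "u = w\<^sup>2"
    using u by (auto simp: w_def)
  define \<sigma> where "\<sigma> = s / w"
  define R where "R = r / w"
  define \<eta> where "\<eta> = Y / w\<^sup>2"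
  define \<zeta> where "\<zeta> = A / w\<^sup>2"
  have sub: "s = w * \<sigma>" "r = w * R" "Y = w\<^sup>2 * \<eta>" "A = w\<^sup>2 * \<zeta>"
    using w by (auto simp: \<sigma>_def R_def \<eta>_def \<zeta>_def)
  have scale: "sqrt u + \<bar>s\<bar> = w * (1 + \<bar>\<sigma>\<bar>)"
    using w by (simp add: w_def[symmetric] sub abs_mult algebra_simps)
  have factor: "w\<^sup>2 * \<bar>x\<bar> = \<bar>w\<^sup>2 * x\<bar>" for x
    by (simp add: abs_mult)
  have cancel: "x \<le> z" if "w\<^sup>2 * x \<le> w\<^sup>2 * z" for x z
    using that w by simp
  have "w\<^sup>2 * \<bar>\<eta> - (\<kappa> * \<sigma>\<^sup>2 / 2 - v)\<bar> = \<bar>Y - (\<kappa> * s\<^sup>2 / 2 - v * u)\<bar>"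
    unfolding factor by (simp add: sub u_w algebra_simps power_mult_distrib)
  also have "\<dots> \<le> w\<^sup>2 * (K * w * (1 + \<bar>\<sigma>\<bar>) ^ 3)"
    using Y(1) unfolding scale by (simp add: power_mult_distrib eval_nat_numeral algebra_simps)
  finally have 1: "\<bar>\<eta> - (\<kappa> * \<sigma>\<^sup>2 / 2 - v)\<bar> \<le> K * w * (1 + \<bar>\<sigma>\<bar>) ^ 3"
    by (rule cancel)
  have "w\<^sup>2 * \<bar>\<zeta> + (\<kappa> * \<sigma>\<^sup>2 / 2 + v)\<bar> = \<bar>A + (\<kappa> * s\<^sup>2 / 2 + v * u)\<bar>"
    unfolding factor by (simp add: sub u_w algebra_simps power_mult_distrib)
  also have "\<dots> \<le> w\<^sup>2 * (K * w * (1 + \<bar>\<sigma>\<bar>) ^ 3)"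
    using A unfolding scale by (simp add: power_mult_distrib eval_nat_numeral algebra_simps)
  finally have 2: "\<bar>\<zeta> + (\<kappa> * \<sigma>\<^sup>2 / 2 + v)\<bar> \<le> K * w * (1 + \<bar>\<sigma>\<bar>) ^ 3"
    by (rule cancel)
  have "w\<^sup>2 * \<bar>\<eta>\<bar> \<le> w\<^sup>2 * (K * (1 + \<bar>\<sigma>\<bar>)\<^sup>2)"
    using Y(2) unfolding scale by (simp add: sub abs_mult power_mult_distrib mult_ac)
  then have 3: "\<bar>\<eta>\<bar> \<le> K * (1 + \<bar>\<sigma>\<bar>)\<^sup>2"
    by (rule cancel)
  have 4: "\<bar>q - \<mu>0 - w * (\<mu>1 * \<sigma>)\<bar> \<le> K * w\<^sup>2 * (1 + \<bar>\<sigma>\<bar>)\<^sup>2"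
    using q unfolding scale by (simp add: sub power_mult_distrib mult_ac)
  have 5: "\<bar>R\<bar> * w * K \<le> 1 / 16"
    using small w by (simp add: sub abs_mult mult_ac)
  define X where "X = (w * \<zeta> - R) * exp (R * w * \<eta> / 2 - w\<^sup>2 * \<eta>\<^sup>2 / 4) * q
        - (- R * \<mu>0 + w * (- (\<kappa> * \<sigma>\<^sup>2 / 2 + v) * \<mu>0 - R\<^sup>2 * (\<kappa> * \<sigma>\<^sup>2 / 2 - v) * \<mu>0 / 2
                            - R * \<mu>1 * \<sigma>))"
  note main = scaled_expansion[OF w K bounds 1 3 2 4 5, folded X_def]
  have e1: "exp (- (s\<^sup>2 + (r - Y)\<^sup>2) / (4 * u))
      = exp (- \<sigma>\<^sup>2 / 4) * exp (- R\<^sup>2 / 4) * exp (R * w * \<eta> / 2 - w\<^sup>2 * \<eta>\<^sup>2 / 4)"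
    using w by (simp add: sub u_w flip: exp_add) (simp add: field_simps power2_eq_square)
  have e2: "exp (- (s\<^sup>2 + r\<^sup>2) / (4 * u)) = exp (- \<sigma>\<^sup>2 / 4) * exp (- R\<^sup>2 / 4)"
    using w by (simp add: sub u_w flip: exp_add) (simp add: field_simps power2_eq_square)
  have "layer_integrand r Y A q u s - leading_integrand r \<kappa> v \<mu>0 \<mu>1 u s
      = 1 / (8 * pi * w ^ 3) * (exp (- \<sigma>\<^sup>2 / 4) * exp (- R\<^sup>2 / 4) * X)"
    unfolding layer_integrand_def leading_integrand_def e1 e2 X_def
    using w by (simp add: sub u_w field_simps eval_nat_numeral)
  then have "\<bar>layer_integrand r Y A q u s - leading_integrand r \<kappa> v \<mu>0 \<mu>1 u s\<bar>
      = 1 / (8 * pi * w ^ 3) * (exp (- \<sigma>\<^sup>2 / 4) * exp (- R\<^sup>2 / 4) * \<bar>X\<bar>)"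
    using w by (simp add: abs_mult)
  also have "\<dots> \<le> 1 / (8 * pi * w ^ 3) * (expansion_const K * w\<^sup>2 * exp (- \<sigma>\<^sup>2 / 8))"
    using main w by (intro mult_left_mono) auto
  also have "\<dots> = 1 / (8 * pi) * (expansion_const K / w * exp (- \<sigma>\<^sup>2 / 8))"
    using w by (simp add: field_simps eval_nat_numeral)
  also have "\<dots> \<le> 1 * (expansion_const K / w * exp (- \<sigma>\<^sup>2 / 8))"
  proof (rule mult_right_mono)
    show "1 / (8 * pi) \<le> 1" using pi_gt3 by simp
    show "0 \<le> expansion_const K / w * exp (- \<sigma>\<^sup>2 / 8)"
      using K w by (simp add: expansion_const_def)
  qed
  also have "\<dots> = expansion_const K / sqrt u * exp (- s\<^sup>2 / (8 * u))"
    using w by (simp add: w_def[symmetric] u_w sub power_mult_distrib)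
  finally show ?thesis .
qed

section \<open>Exact integrals of the leading terms\<close>

lemma gaussian_moments:
  fixes a :: real
  assumes a: "0 < a"
  shows "((\<lambda>s. exp (- s\<^sup>2 / (4 * a))) has_integral sqrt (4 * pi * a)) UNIV"
    and "((\<lambda>s. s * exp (- s\<^sup>2 / (4 * a))) has_integral 0) UNIV"
    and "((\<lambda>s. s\<^sup>2 * exp (- s\<^sup>2 / (4 * a))) has_integral 2 * a * sqrt (4 * pi * a)) UNIV"
proof -
  define S where "S = sqrt (4 * pi * a)"
  have S: "0 < S" using a by (simp add: S_def)
  have \<sigma>: "0 < sqrt (2 * a)" "(sqrt (2 * a))\<^sup>2 = 2 * a" using a by auto
  have nd: "normal_density 0 (sqrt (2 * a)) s = exp (- s\<^sup>2 / (4 * a)) / S" for s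
    using a by (simp add: normal_density_def S_def mult_ac)
  have lint: "(f has_integral I) UNIV" if "has_bochner_integral lborel f I" for f :: "real \<Rightarrow> real" and I
    using that has_integral_integral_lborel[of f] by (auto simp: has_bochner_integral_iff)
  have "((\<lambda>s. S * (normal_density 0 (sqrt (2 * a)) s * (s - 0) ^ (2 * 0))) has_integral
      S * (fact (2 * 0) / ((2 / (sqrt (2 * a))\<^sup>2) ^ 0 * fact 0))) UNIV"
    by (intro has_integral_mult_right lint normal_moment_even \<sigma>)
  then show "((\<lambda>s. exp (- s\<^sup>2 / (4 * a))) has_integral sqrt (4 * pi * a)) UNIV"
    using S by (simp add: nd S_def[symmetric])
  have "((\<lambda>s. S * (normal_density 0 (sqrt (2 * a)) s * (s - 0) ^ (2 * 0 + 1))) has_integral S * 0) UNIV"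
    by (intro has_integral_mult_right lint normal_moment_odd \<sigma>)
  moreover have "(\<lambda>s. S * (normal_density 0 (sqrt (2 * a)) s * (s - 0) ^ (2 * 0 + 1)))
      = (\<lambda>s. s * exp (- s\<^sup>2 / (4 * a)))"
    using S by (simp add: nd fun_eq_iff)
  ultimately show "((\<lambda>s. s * exp (- s\<^sup>2 / (4 * a))) has_integral 0) UNIV"
    by simp
  have "((\<lambda>s. S * (normal_density 0 (sqrt (2 * a)) s * (s - 0) ^ (2 * 1))) has_integral
      S * (fact (2 * 1) / ((2 / (sqrt (2 * a))\<^sup>2) ^ 1 * fact 1))) UNIV"
    by (intro has_integral_mult_right lint normal_moment_even \<sigma>)
  moreover have "(\<lambda>s. S * (normal_density 0 (sqrt (2 * a)) s * (s - 0) ^ (2 * 1)))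
      = (\<lambda>s. s\<^sup>2 * exp (- s\<^sup>2 / (4 * a)))"
    using S by (simp add: nd fun_eq_iff)
  moreover have "S * (fact (2 * 1) / ((2 / (sqrt (2 * a))\<^sup>2) ^ 1 * fact 1)) = 2 * a * sqrt (4 * pi * a)"
    unfolding \<sigma>(2) S_def[symmetric] by simp
  ultimately show "((\<lambda>s. s\<^sup>2 * exp (- s\<^sup>2 / (4 * a))) has_integral 2 * a * sqrt (4 * pi * a)) UNIV"
    by (simp only:)
qed

text \<open>
  The integral of \<open>leading_integrand\<close> over the line, arranged by the two powers of \<open>u\<close> that lead to
  \<open>erfc\<close> and \<open>E32\<close>.
\<close>
definition leading_integral :: "real \<Rightarrow> real \<Rightarrow> real \<Rightarrow> real \<Rightarrow> real \<Rightarrow> real" where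
  "leading_integral r \<kappa> v \<mu>0 u =
     - \<mu>0 / (4 * sqrt pi) *
       (r * (1 + r * (\<kappa> - v) / 2) * (u powr (- 3 / 2) * exp (- r\<^sup>2 / (4 * u)))
        + (\<kappa> + v) * (u powr (- 1 / 2) * exp (- r\<^sup>2 / (4 * u))))"

lemma has_integral_leading_integrand:
  fixes r \<kappa> v \<mu>0 \<mu>1 u :: real
  assumes u: "0 < u"
  shows "(leading_integrand r \<kappa> v \<mu>0 \<mu>1 u has_integral leading_integral r \<kappa> v \<mu>0 u) UNIV"
proof -
  define w where "w = sqrt u"
  have w: "0 < w" and u_w: "u = w\<^sup>2"
    using u by (auto simp: w_def)
  have pw: "u powr (- 1 / 2) = 1 / w" "u powr (- 3 / 2) = 1 / w ^ 3"
  proof -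
    have "u powr (1 / 2) = w" using u by (simp add: w_def powr_half_sqrt)
    then show "u powr (- 1 / 2) = 1 / w" by (simp add: powr_minus_divide)
    have "u powr (3 / 2) = (w powr 2) powr (3 / 2)"
      using w by (simp add: u_w powr_numeral)
    also have "\<dots> = w powr 3" by (simp only: powr_powr) simp
    also have "\<dots> = w ^ 3" using w by (simp add: powr_numeral)
    finally show "u powr (- 3 / 2) = 1 / w ^ 3" by (simp add: powr_minus_divide)
  qed
  have S: "sqrt (4 * pi * u) = 2 * sqrt pi * w"
    using w by (simp add: u_w real_sqrt_mult)
  define E where "E = exp (- r\<^sup>2 / (4 * u))"
  define p where "p = sqrt pi"
  have p: "p > 0" "pi = p\<^sup>2" by (auto simp: p_def)
  define k where "k = E / (8 * pi * u\<^sup>2)"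
  let ?c0 = "k * (- r * \<mu>0 - v * u * \<mu>0 + r\<^sup>2 * v * \<mu>0 / 2)"
  let ?c1 = "k * (- r * \<mu>1)"
  let ?c2 = "k * (- \<kappa> * \<mu>0 / 2 - r\<^sup>2 * \<kappa> * \<mu>0 / (4 * u))"
  let ?g = "\<lambda>s::real. exp (- s\<^sup>2 / (4 * u))"
  have "((\<lambda>s. ?c0 * ?g s + ?c1 * (s * ?g s) + ?c2 * (s\<^sup>2 * ?g s)) has_integral
      ?c0 * sqrt (4 * pi * u) + ?c1 * 0 + ?c2 * (2 * u * sqrt (4 * pi * u))) UNIV"
    by (intro has_integral_add has_integral_mult_right gaussian_moments u)
  moreover have "(\<lambda>s. ?c0 * ?g s + ?c1 * (s * ?g s) + ?c2 * (s\<^sup>2 * ?g s)) = leading_integrand r \<kappa> v \<mu>0 \<mu>1 u"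
  proof
    fix s
    have "exp (- (s\<^sup>2 + r\<^sup>2) / (4 * u)) = E * ?g s"
      by (simp add: E_def add_divide_distrib diff_divide_distrib flip: exp_add)
    then show "?c0 * ?g s + ?c1 * (s * ?g s) + ?c2 * (s\<^sup>2 * ?g s) = leading_integrand r \<kappa> v \<mu>0 \<mu>1 u s"
      using u unfolding leading_integrand_def k_def by (simp add: field_simps) 
  qed
  moreover have "?c0 * sqrt (4 * pi * u) + ?c1 * 0 + ?c2 * (2 * u * sqrt (4 * pi * u))
      = leading_integral r \<kappa> v \<mu>0 u"
    unfolding leading_integral_def pw S k_def E_def[symmetric] p_def[symmetric]
    unfolding p(2) u_w using w p(1) by (simp add: field_simps eval_nat_numeral)
  ultimately show ?thesis by simp
qed

text \<open>
  Outside \<open>\<bar>s\<bar> < \<delta>\<close> the leading integrand obeys the same bound as the expansion error. There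
  \<open>layer_integrand\<close> with \<open>Y = A = q = 0\<close> vanishes identically, and the hypotheses of
  \<open>layer_integrand_expansion\<close> hold for these values: as \<open>\<surd>u + \<bar>s\<bar> \<ge> \<delta>\<close>, a term that is too large by
  one or two powers of \<open>\<surd>u + \<bar>s\<bar>\<close> is admissible at the cost of a factor \<open>1 / \<delta>\<^sup>2\<close> in the constant.
\<close>
lemma leading_integrand_tail:
  fixes u s r \<kappa> v \<mu>0 \<mu>1 K \<delta> :: real
  assumes u: "0 < u" "u \<le> 1" and K: "1 \<le> K"
    and bounds: "\<bar>\<kappa>\<bar> \<le> K" "\<bar>v\<bar> \<le> K" "\<bar>\<mu>0\<bar> \<le> K" "\<bar>\<mu>1\<bar> \<le> K"
    and \<delta>: "0 < \<delta>" "\<delta> \<le> 1" "\<delta> \<le> \<bar>s\<bar>" and small: "\<bar>r\<bar> * (2 * K / \<delta>\<^sup>2) \<le> 1 / 16"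
  shows "\<bar>leading_integrand r \<kappa> v \<mu>0 \<mu>1 u s\<bar> \<le> expansion_const (2 * K / \<delta>\<^sup>2) / sqrt u * exp (- s\<^sup>2 / (8 * u))"
proof -
  define h where "h = sqrt u + \<bar>s\<bar>"
  have "0 < sqrt u" using u by simp
  then have h: "\<delta> \<le> h" "\<bar>s\<bar> \<le> h"
    using \<delta> unfolding h_def by linarith+
  have h2: "s\<^sup>2 + u \<le> h\<^sup>2"
    using u by (simp add: h_def power2_sum)
  have \<delta>1: "\<delta>\<^sup>2 \<le> \<delta>" "\<delta>\<^sup>2 \<le> 1" "\<delta>\<^sup>2 > 0"
    using \<delta> by (auto simp: power2_eq_square mult_le_one)
  have K2: "K \<le> 2 * K / \<delta>\<^sup>2"
    using K \<delta>1 mult_left_mono[of "\<delta>\<^sup>2" 1 K] by (simp add: field_simps)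
  have h23: "K * h\<^sup>2 \<le> 2 * K / \<delta>\<^sup>2 * h ^ 3"
  proof -
    have "\<delta>\<^sup>2 * h\<^sup>2 \<le> h * h\<^sup>2"
      using h \<delta>1 by (intro mult_right_mono) auto
    also have "\<dots> \<le> 2 * h ^ 3" using h \<delta> by (simp add: eval_nat_numeral)
    finally have "K * (\<delta>\<^sup>2 * h\<^sup>2) \<le> K * (2 * h ^ 3)" using K by (intro mult_left_mono) auto
    then show ?thesis using \<delta>1 by (simp add: field_simps)
  qed
  have half: "\<bar>\<kappa> * s\<^sup>2 / 2\<bar> \<le> K * s\<^sup>2" "\<bar>v * u\<bar> \<le> K * u"
  proof -
    have "\<bar>\<kappa> * s\<^sup>2 / 2\<bar> \<le> \<bar>\<kappa>\<bar> * s\<^sup>2" by (simp add: abs_mult)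
    also have "\<dots> \<le> K * s\<^sup>2" using bounds by (intro mult_right_mono) auto
    finally show "\<bar>\<kappa> * s\<^sup>2 / 2\<bar> \<le> K * s\<^sup>2" .
    show "\<bar>v * u\<bar> \<le> K * u" using bounds u by (simp add: abs_mult mult_right_mono)
  qed
  have quad: "K * s\<^sup>2 + K * u \<le> 2 * K / \<delta>\<^sup>2 * h ^ 3"
  proof -
    have "K * (s\<^sup>2 + u) \<le> K * h\<^sup>2" using h2 K by (intro mult_left_mono) auto
    with h23 show ?thesis by (simp add: algebra_simps)
  qed
  have lin: "\<bar>\<mu>0 + \<mu>1 * s\<bar> \<le> 2 * K / \<delta>\<^sup>2 * h\<^sup>2"
  proof -
    have "\<bar>\<mu>0 + \<mu>1 * s\<bar> \<le> K * 1 + K * \<bar>s\<bar>"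
      using bounds mult_right_mono[of "\<bar>\<mu>1\<bar>" K "\<bar>s\<bar>"] by (simp add: abs_mult[symmetric])
    also have "\<dots> \<le> K * (h\<^sup>2 / \<delta>\<^sup>2) + K * (h\<^sup>2 / \<delta>\<^sup>2)"
    proof (intro add_mono mult_left_mono)
      have "\<delta>\<^sup>2 \<le> h\<^sup>2" using h \<delta> by (intro power_mono) auto
      then show "1 \<le> h\<^sup>2 / \<delta>\<^sup>2" using \<delta>1 by simp
      have "\<bar>s\<bar> * \<delta>\<^sup>2 \<le> h * h" using h \<delta>1 \<delta> by (intro mult_mono) auto
      then show "\<bar>s\<bar> \<le> h\<^sup>2 / \<delta>\<^sup>2" using \<delta>1 by (simp add: field_simps power2_eq_square)
    qed (use K in auto)
    also have "\<dots> = 2 * K / \<delta>\<^sup>2 * h\<^sup>2" by (simp add: field_simps)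
    finally show ?thesis .
  qed
  have "\<bar>layer_integrand r 0 0 0 u s - leading_integrand r \<kappa> v \<mu>0 \<mu>1 u s\<bar>
      \<le> expansion_const (2 * K / \<delta>\<^sup>2) / sqrt u * exp (- s\<^sup>2 / (8 * u))"
  proof (rule layer_integrand_expansion[OF u _ _ _ _ _ _ _ _ _ small])
    show "\<bar>0 - (\<kappa> * s\<^sup>2 / 2 - v * u)\<bar> \<le> 2 * K / \<delta>\<^sup>2 * (sqrt u + \<bar>s\<bar>) ^ 3"
      "\<bar>0 + (\<kappa> * s\<^sup>2 / 2 + v * u)\<bar> \<le> 2 * K / \<delta>\<^sup>2 * (sqrt u + \<bar>s\<bar>) ^ 3"
      using half quad unfolding h_def by linarith+
    show "\<bar>0 - \<mu>0 - \<mu>1 * s\<bar> \<le> 2 * K / \<delta>\<^sup>2 * (sqrt u + \<bar>s\<bar>)\<^sup>2"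
      using lin unfolding h_def by linarith
    show "\<bar>0::real\<bar> \<le> 2 * K / \<delta>\<^sup>2 * (sqrt u + \<bar>s\<bar>)\<^sup>2" using K by simp
  qed (use K K2 bounds in auto)
  then show ?thesis by (simp add: layer_integrand_def)
qed

text \<open>
  The error bound \<open>C / \<surd>u exp (- s\<^sup>2 / (8 u))\<close> has an integral over the line that does not depend on
  \<open>u\<close>. Hence the error at a fixed time is bounded, uniformly up to \<open>u = 0\<close>.
\<close>
lemma layer_integral_estimate:
  fixes F Y A q :: "real \<Rightarrow> real" and u r \<kappa> v \<mu>0 \<mu>1 K \<delta> :: real
  assumes u: "0 < u" "u \<le> 1" and K: "1 \<le> K"
    and bounds: "\<bar>\<kappa>\<bar> \<le> K" "\<bar>v\<bar> \<le> K" "\<bar>\<mu>0\<bar> \<le> K" "\<bar>\<mu>1\<bar> \<le> K"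
    and \<delta>: "0 < \<delta>" "\<delta> \<le> 1" and small: "\<bar>r\<bar> * (2 * K / \<delta>\<^sup>2) \<le> 1 / 16"
    and Y: "\<And>s. \<bar>s\<bar> < \<delta> \<Longrightarrow> \<bar>Y s - (\<kappa> * s\<^sup>2 / 2 - v * u)\<bar> \<le> K * (sqrt u + \<bar>s\<bar>) ^ 3"
      "\<And>s. \<bar>s\<bar> < \<delta> \<Longrightarrow> \<bar>Y s\<bar> \<le> K * (sqrt u + \<bar>s\<bar>)\<^sup>2"
    and A: "\<And>s. \<bar>s\<bar> < \<delta> \<Longrightarrow> \<bar>A s + (\<kappa> * s\<^sup>2 / 2 + v * u)\<bar> \<le> K * (sqrt u + \<bar>s\<bar>) ^ 3"
    and q: "\<And>s. \<bar>s\<bar> < \<delta> \<Longrightarrow> \<bar>q s - \<mu>0 - \<mu>1 * s\<bar> \<le> K * (sqrt u + \<bar>s\<bar>)\<^sup>2"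
    and F: "(F has_integral I) {-\<delta><..<\<delta>}"
      "\<And>s. \<bar>s\<bar> < \<delta> \<Longrightarrow> F s = layer_integrand r (Y s) (A s) (q s) u s"
  shows "\<bar>I - leading_integral r \<kappa> v \<mu>0 u\<bar> \<le> 6 * expansion_const (2 * K / \<delta>\<^sup>2)"
proof -
  define C where "C = expansion_const (2 * K / \<delta>\<^sup>2)"
  have \<delta>1: "\<delta>\<^sup>2 \<le> 1" "\<delta>\<^sup>2 > 0"
    using \<delta> by (auto simp: power2_eq_square mult_le_one)
  have K2: "K \<le> 2 * K / \<delta>\<^sup>2"
    using K \<delta>1 mult_left_mono[of "\<delta>\<^sup>2" 1 K] by (simp add: field_simps)
  have C: "expansion_const K \<le> C" "0 \<le> C"
    unfolding C_def expansion_const_def using K K2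
    by (intro mult_left_mono mult_right_mono power_mono; simp)
      (use K \<delta>1 in simp)
  have smallK: "\<bar>r\<bar> * K \<le> 1 / 16"
    using mult_left_mono[OF K2, of "\<bar>r\<bar>"] small by linarith
  define D where "D s = (if s \<in> {-\<delta><..<\<delta>} then F s else 0) - leading_integrand r \<kappa> v \<mu>0 \<mu>1 u s" for s
  have D: "(D has_integral I - leading_integral r \<kappa> v \<mu>0 u) UNIV"
    unfolding D_def by (intro has_integral_diff has_integral_leading_integrand u)
      (use F(1) in \<open>simp only: has_integral_restrict_UNIV\<close>)
  have "((\<lambda>s. C / sqrt u * exp (- s\<^sup>2 / (4 * (2 * u)))) has_integral C / sqrt u * sqrt (4 * pi * (2 * u))) UNIV"
    by (intro has_integral_mult_right gaussian_moments) (use u in auto)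
  then have B: "((\<lambda>s. C / sqrt u * exp (- s\<^sup>2 / (8 * u))) has_integral C * sqrt (8 * pi)) UNIV"
    using u by (simp add: real_sqrt_mult mult_ac)
  have "\<bar>D s\<bar> \<le> C / sqrt u * exp (- s\<^sup>2 / (8 * u))" for s
  proof (cases "\<bar>s\<bar> < \<delta>")
    case True
    then have "\<bar>D s\<bar> = \<bar>layer_integrand r (Y s) (A s) (q s) u s - leading_integrand r \<kappa> v \<mu>0 \<mu>1 u s\<bar>"
      by (auto simp: D_def F(2))
    also have "\<dots> \<le> expansion_const K / sqrt u * exp (- s\<^sup>2 / (8 * u))"
      using True by (intro layer_integrand_expansion u K bounds Y A q smallK)
    also have "\<dots> \<le> C / sqrt u * exp (- s\<^sup>2 / (8 * u))"
      using C u by (intro mult_right_mono divide_right_mono) auto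
    finally show ?thesis .
  next
    case False
    then have "D s = - leading_integrand r \<kappa> v \<mu>0 \<mu>1 u s" by (auto simp: D_def)
    with leading_integrand_tail[OF u K bounds \<delta> _ small, of s] False show ?thesis
      by (simp add: C_def)
  qed
  then have "norm (I - leading_integral r \<kappa> v \<mu>0 u) \<le> (C * sqrt (8 * pi)) \<bullet> 1"
    by (intro has_integral_norm_bound_integral_component[OF D B]) simp
  then have "\<bar>I - leading_integral r \<kappa> v \<mu>0 u\<bar> \<le> C * sqrt (8 * pi)"
    by simp
  also have "\<dots> \<le> C * 6"
  proof (rule mult_left_mono[OF _ C(2)])
    have "sqrt (8 * pi) \<le> sqrt (6\<^sup>2)" using pi_less_4 by (intro real_sqrt_le_mono) auto
    then show "sqrt (8 * pi) \<le> 6" by simp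
  qed
  finally show ?thesis by (simp add: C_def mult_ac)
qed


text \<open>
  The substitution \<open>t - \<tau> = t / z\<close> maps \<open>z \<ge> 1\<close> onto the time interval and gives the integral
  defining \<open>E32\<close>.
\<close>
lemma has_integral_powr_half_exp:
  fixes r t :: real
  assumes t: "0 < t"
  shows "((\<lambda>\<tau>. (t - \<tau>) powr (- 1 / 2) * exp (- r\<^sup>2 / (4 * (t - \<tau>)))) has_integral
           sqrt t * E32 (r\<^sup>2 / (4 * t))) {0..<t}"
proof -
  define x where "x = r\<^sup>2 / (4 * t)"
  have x: "0 \<le> x" using t by (simp add: x_def)
  have ai: "(\<lambda>z. z powr (- 3 / 2) * exp (- x * z)) absolutely_integrable_on {1..}"
  proof (rule measurable_bounded_by_integrable_imp_absolutely_integrable)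
    show "(\<lambda>z. z powr (- 3 / 2) * exp (- x * z)) \<in> borel_measurable (lebesgue_on {1..})"
      by (intro continuous_imp_measurable_on_sets_lebesgue continuous_intros) auto
    show "(\<lambda>z::real. z powr (- 3 / 2)) integrable_on {1..}"
      using has_integral_powr_to_inf[of "- 3 / 2" 1] by (auto simp: has_integral_integrable)
    show "norm (z powr (- 3 / 2) * exp (- x * z)) \<le> z powr (- 3 / 2)" if "z \<in> {1..}" for z
      using that x mult_left_mono[of "exp (- x * z)" 1 "z powr (- 3 / 2)"] by (simp add: abs_mult)
  qed auto
  define g where "g z = t - t / z" for z :: real
  let ?f = "\<lambda>\<tau>. (t - \<tau>) powr (- 1 / 2) * exp (- r\<^sup>2 / (4 * (t - \<tau>)))"
  have img: "g ` {1..} = {0..<t}"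
  proof (intro equalityI subsetI)
    fix \<tau> assume "\<tau> \<in> g ` {1..}"
    then show "\<tau> \<in> {0..<t}" using t by (auto simp: g_def field_simps)
  next
    fix \<tau> assume "\<tau> \<in> {0..<t}"
    then have "\<tau> = g (t / (t - \<tau>))" "t / (t - \<tau>) \<in> {1..}"
      using t by (auto simp: g_def field_simps)
    then show "\<tau> \<in> g ` {1..}" by blast
  qed
  have eq: "\<bar>t / z\<^sup>2\<bar> * ?f (g z) = sqrt t * (z powr (- 3 / 2) * exp (- x * z))" if z: "z \<in> {1..}" for z
  proof -
    have "(t / z) powr (- 1 / 2) = z powr (1 / 2) / sqrt t"
      using t z by (simp add: powr_divide powr_minus_divide powr_half_sqrt real_sqrt_divide)
    moreover have "z powr (- 3 / 2) = z powr (1 / 2) / z\<^sup>2"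
      using z by (simp add: powr_diff[symmetric] flip: powr_numeral)
    moreover have "r\<^sup>2 / (4 * (t / z)) = x * z"
      using z t by (simp add: x_def field_simps)
    moreover have "t * a / (d * sqrt t) = sqrt t * a / d" for a d
    proof -
      have "t * a / (d * sqrt t) = t / sqrt t * a / d" by simp
      then show ?thesis using t by (simp only: real_div_sqrt less_imp_le)
    qed
    ultimately show ?thesis
      using t z by (simp add: g_def)
  qed
  have "(\<lambda>z. \<bar>t / z\<^sup>2\<bar> * ?f (g z)) absolutely_integrable_on {1..} \<and>
      integral {1..} (\<lambda>z. \<bar>t / z\<^sup>2\<bar> * ?f (g z)) = sqrt t * E32 x \<longleftrightarrow>
      ?f absolutely_integrable_on g ` {1..} \<and> integral (g ` {1..}) ?f = sqrt t * E32 x"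
  proof (rule has_absolute_integral_change_of_variables_1')
    show "(g has_field_derivative t / z\<^sup>2) (at z within {1..})" if "z \<in> {1..}" for z
      unfolding g_def using that
      by (auto intro!: derivative_eq_intros simp: power2_eq_square)
    show "inj_on g {1..}"
      using t by (auto simp: inj_on_def g_def field_simps)
  qed auto
  moreover have "(\<lambda>z. \<bar>t / z\<^sup>2\<bar> * ?f (g z)) absolutely_integrable_on {1..} \<longleftrightarrow>
      (\<lambda>z. sqrt t * (z powr (- 3 / 2) * exp (- x * z))) absolutely_integrable_on {1..}"
    by (intro absolutely_integrable_spike_eq[OF negligible_empty]) (use eq in auto)
  moreover have "integral {1..} (\<lambda>z. \<bar>t / z\<^sup>2\<bar> * ?f (g z))
      = integral {1..} (\<lambda>z. sqrt t * (z powr (- 3 / 2) * exp (- x * z)))"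
    by (intro integral_cong) (use eq in auto)
  moreover have "integral {1..} (\<lambda>z. sqrt t * (z powr (- 3 / 2) * exp (- x * z))) = sqrt t * E32 x"
    by (simp add: E32_def)
  ultimately have "?f absolutely_integrable_on {0..<t} \<and> integral {0..<t} ?f = sqrt t * E32 x"
    using ai unfolding img by simp
  then show ?thesis
    unfolding x_def[symmetric] by (simp add: has_integral_iff set_lebesgue_integral_eq_integral(1))
qed

text \<open>
  The substitution \<open>t - \<tau> = r\<^sup>2 / (4 z\<^sup>2)\<close> turns the exponent into \<open>- z\<^sup>2\<close>, the Jacobian cancels the power
  of \<open>t - \<tau>\<close> up to a constant factor, and \<open>\<tau> = 0\<close> corresponds to the lower limit of \<open>erfc\<close>.
\<close>
lemma has_integral_powr_three_halves_exp:
  fixes r t :: real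
  assumes t: "0 < t" and r: "r \<noteq> 0"
  shows "((\<lambda>\<tau>. (t - \<tau>) powr (- 3 / 2) * exp (- r\<^sup>2 / (4 * (t - \<tau>)))) has_integral
           2 * sqrt pi / \<bar>r\<bar> * erfc (\<bar>r\<bar> / (2 * sqrt t))) {0..<t}"
proof -
  define b where "b = \<bar>r\<bar> / (2 * sqrt t)"
  have b: "0 < b" using t r by (simp add: b_def)
  have b2: "b\<^sup>2 = r\<^sup>2 / (4 * t)"
    using t by (simp add: b_def power_divide power_mult_distrib)
  have "(\<lambda>z. exp (- z\<^sup>2)) integrable_on (UNIV :: real set)"
    using gaussian_moments(1)[of "1/4"] by (auto simp: has_integral_integrable)
  then have "(\<lambda>z. exp (- z\<^sup>2)) absolutely_integrable_on (UNIV :: real set)"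
    by (intro nonnegative_absolutely_integrable_1) auto
  then have ai: "(\<lambda>z::real. exp (- z\<^sup>2)) absolutely_integrable_on {b..}"
    by (rule set_integrable_subset) auto
  define g where "g z = t - r\<^sup>2 / (4 * z\<^sup>2)" for z :: real
  let ?f = "\<lambda>\<tau>. (t - \<tau>) powr (- 3 / 2) * exp (- r\<^sup>2 / (4 * (t - \<tau>)))"
  have img: "g ` {b..} = {0..<t}"
  proof (intro equalityI subsetI)
    fix \<tau> assume "\<tau> \<in> g ` {b..}"
    then obtain z where z: "z \<ge> b" "\<tau> = g z" by auto
    have "r\<^sup>2 / (4 * t) \<le> z\<^sup>2"
      using power_mono[OF z(1), of 2] b by (simp add: b2)
    moreover have "0 < z\<^sup>2" using z b by simp
    ultimately have "r\<^sup>2 / (4 * z\<^sup>2) \<le> t" "0 < r\<^sup>2 / (4 * z\<^sup>2)"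
      using t r by (auto simp: field_simps)
    then show "\<tau> \<in> {0..<t}" unfolding z(2) g_def by auto
  next
    fix \<tau> assume \<tau>: "\<tau> \<in> {0..<t}"
    define z where "z = \<bar>r\<bar> / (2 * sqrt (t - \<tau>))"
    have "z \<ge> b" unfolding z_def b_def using \<tau> by (intro divide_left_mono) auto
    moreover have "\<tau> = g z"
      using \<tau> r by (simp add: g_def z_def power_divide power_mult_distrib diff_divide_distrib)
    ultimately show "\<tau> \<in> g ` {b..}" by auto
  qed
  have eq: "\<bar>r\<^sup>2 / (2 * z ^ 3)\<bar> * ?f (g z) = 4 / \<bar>r\<bar> * exp (- z\<^sup>2)" if z: "z \<in> {b..}" for z
  proof -
    have z0: "z > 0" using z b by auto
    have "r\<^sup>2 / (4 * z\<^sup>2) = (\<bar>r\<bar> / (2 * z)) powr 2"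
      using z0 r by (simp add: powr_numeral power_divide power_mult_distrib)
    then have "(r\<^sup>2 / (4 * z\<^sup>2)) powr (- 3 / 2) = (\<bar>r\<bar> / (2 * z)) powr (- 3)"
      by (simp only: powr_powr) simp
    also have "\<dots> = 8 * z ^ 3 / \<bar>r\<bar> ^ 3"
      using z0 r by (simp add: powr_minus_divide powr_numeral power_divide power_mult_distrib)
    finally have "(r\<^sup>2 / (4 * z\<^sup>2)) powr (- 3 / 2) = 8 * z ^ 3 / \<bar>r\<bar> ^ 3" .
    moreover have "r\<^sup>2 / (4 * (r\<^sup>2 / (4 * z\<^sup>2))) = z\<^sup>2"
      using z0 r by (simp add: field_simps)
    moreover have "r\<^sup>2 = \<bar>r\<bar>\<^sup>2" by simp
    ultimately show ?thesis
      using r z0 by (simp add: g_def field_simps eval_nat_numeral abs_mult)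
  qed
  let ?V = "2 * sqrt pi / \<bar>r\<bar> * erfc b"
  have "(\<lambda>z. \<bar>r\<^sup>2 / (2 * z ^ 3)\<bar> * ?f (g z)) absolutely_integrable_on {b..} \<and>
      integral {b..} (\<lambda>z. \<bar>r\<^sup>2 / (2 * z ^ 3)\<bar> * ?f (g z)) = ?V \<longleftrightarrow>
      ?f absolutely_integrable_on g ` {b..} \<and> integral (g ` {b..}) ?f = ?V"
  proof (rule has_absolute_integral_change_of_variables_1')
    show "(g has_field_derivative r\<^sup>2 / (2 * z ^ 3)) (at z within {b..})" if "z \<in> {b..}" for z
      unfolding g_def using that b
      by (auto intro!: derivative_eq_intros simp: field_simps eval_nat_numeral)
    show "inj_on g {b..}"
    proof (rule inj_onI)
      fix z z' assume "z \<in> {b..}" "z' \<in> {b..}" "g z = g z'"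
      then have "z\<^sup>2 = z'\<^sup>2" "z > 0" "z' > 0" using r b by (auto simp: g_def)
      then show "z = z'" by (simp add: power2_eq_iff_nonneg)
    qed
  qed auto
  moreover have "(\<lambda>z. \<bar>r\<^sup>2 / (2 * z ^ 3)\<bar> * ?f (g z)) absolutely_integrable_on {b..} \<longleftrightarrow>
      (\<lambda>z. 4 / \<bar>r\<bar> * exp (- z\<^sup>2)) absolutely_integrable_on {b..}"
    by (intro absolutely_integrable_spike_eq[OF negligible_empty]) (use eq in auto)
  moreover have "integral {b..} (\<lambda>z. \<bar>r\<^sup>2 / (2 * z ^ 3)\<bar> * ?f (g z))
      = integral {b..} (\<lambda>z. 4 / \<bar>r\<bar> * exp (- z\<^sup>2))"
    by (intro integral_cong) (use eq in auto)
  moreover have "integral {b..} (\<lambda>z. 4 / \<bar>r\<bar> * exp (- z\<^sup>2)) = ?V"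
    by (simp add: erfc_def)
  ultimately have "?f absolutely_integrable_on {0..<t} \<and> integral {0..<t} ?f = ?V"
    using ai unfolding img by simp
  then show ?thesis
    unfolding b_def[symmetric] by (simp add: has_integral_iff set_lebesgue_integral_eq_integral(1))
qed

lemma has_integral_leading_integral:
  fixes c t \<kappa> v \<mu>0 :: real
  assumes t: "0 < t"
  shows "((\<lambda>\<tau>. leading_integral (c * sqrt t) \<kappa> v \<mu>0 (t - \<tau>)) has_integral
            (- sqrt (t / pi) * E32 (c\<^sup>2 / 4) * ((\<kappa> + v) / 4) * \<mu>0
             - sgn c / 2 * erfc (\<bar>c\<bar> / 2) * (1 + c * sqrt t * ((\<kappa> - v) / 2)) * \<mu>0)) {0..<t}"
proof -
  define r where "r = c * sqrt t"
  have r2: "r\<^sup>2 / (4 * t) = c\<^sup>2 / 4" and ra: "\<bar>r\<bar> / (2 * sqrt t) = \<bar>c\<bar> / 2"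
    using t by (auto simp: r_def power_mult_distrib abs_mult)
  have first: "((\<lambda>\<tau>. r * ((t - \<tau>) powr (- 3 / 2) * exp (- r\<^sup>2 / (4 * (t - \<tau>))))) has_integral
      2 * sqrt pi * sgn c * erfc (\<bar>c\<bar> / 2)) {0..<t}"
  proof (cases "c = 0")
    case True
    then show ?thesis by (simp add: r_def)
  next
    case False
    then have "r \<noteq> 0" using t by (simp add: r_def)
    have "r * (2 * sqrt pi / \<bar>r\<bar> * erfc (\<bar>r\<bar> / (2 * sqrt t))) = 2 * sqrt pi * sgn c * erfc (\<bar>c\<bar> / 2)"
      unfolding ra using False t by (simp add: r_def abs_mult sgn_real_def)
    then show ?thesis
      using has_integral_mult_right[OF has_integral_powr_three_halves_exp[OF t \<open>r \<noteq> 0\<close>], of r]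
      by (simp only:)
  qed
  have "((\<lambda>\<tau>. - \<mu>0 / (4 * sqrt pi) *
         ((1 + r * (\<kappa> - v) / 2) * (r * ((t - \<tau>) powr (- 3 / 2) * exp (- r\<^sup>2 / (4 * (t - \<tau>)))))
        + (\<kappa> + v) * ((t - \<tau>) powr (- 1 / 2) * exp (- r\<^sup>2 / (4 * (t - \<tau>)))))) has_integral
      - \<mu>0 / (4 * sqrt pi) * ((1 + r * (\<kappa> - v) / 2) * (2 * sqrt pi * sgn c * erfc (\<bar>c\<bar> / 2))
        + (\<kappa> + v) * (sqrt t * E32 (c\<^sup>2 / 4)))) {0..<t}"
    unfolding r2[symmetric]
    by (intro has_integral_mult_right has_integral_add first[unfolded r2[symmetric]]
        has_integral_powr_half_exp t)
  moreover have "(\<lambda>\<tau>. - \<mu>0 / (4 * sqrt pi) *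
         ((1 + r * (\<kappa> - v) / 2) * (r * ((t - \<tau>) powr (- 3 / 2) * exp (- r\<^sup>2 / (4 * (t - \<tau>)))))
        + (\<kappa> + v) * ((t - \<tau>) powr (- 1 / 2) * exp (- r\<^sup>2 / (4 * (t - \<tau>))))))
      = (\<lambda>\<tau>. leading_integral r \<kappa> v \<mu>0 (t - \<tau>))"
    unfolding leading_integral_def by (simp add: mult_ac)
  moreover have "- \<mu>0 / (4 * sqrt pi) * ((1 + r * (\<kappa> - v) / 2) * (2 * sqrt pi * sgn c * erfc (\<bar>c\<bar> / 2))
        + (\<kappa> + v) * (sqrt t * E32 (c\<^sup>2 / 4)))
      = - sqrt (t / pi) * E32 (c\<^sup>2 / 4) * ((\<kappa> + v) / 4) * \<mu>0
             - sgn c / 2 * erfc (\<bar>c\<bar> / 2) * (1 + c * sqrt t * ((\<kappa> - v) / 2)) * \<mu>0"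
    by (simp add: r_def real_sqrt_divide field_simps)
  ultimately show ?thesis
    unfolding r_def by simp
qed

section \<open>Taylor bounds for the boundary graph and the density\<close>

lemma differentiable_bounded_norm_le:
  "differentiable_bounded k M S f \<Longrightarrow> z \<in> S \<Longrightarrow> norm (f z) \<le> M"
  by (cases k) auto

lemma differentiable_bounded_SucE:
  assumes "differentiable_bounded (Suc k) M (I \<times> J) (\<lambda>(s, \<tau>). f s \<tau>)"
  obtains f1 f2 :: "real \<Rightarrow> real \<Rightarrow> 'a::real_normed_vector" where
    "differentiable_bounded k M (I \<times> J) (\<lambda>(s, \<tau>). f1 s \<tau>)"
    "differentiable_bounded k M (I \<times> J) (\<lambda>(s, \<tau>). f2 s \<tau>)"
    "\<And>s \<tau>. s \<in> I \<Longrightarrow> \<tau> \<in> J \<Longrightarrow> ((\<lambda>s. f s \<tau>) has_vector_derivative f1 s \<tau>) (at s within I)"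
    "\<And>s \<tau>. s \<in> I \<Longrightarrow> \<tau> \<in> J \<Longrightarrow> (f s has_vector_derivative f2 s \<tau>) (at \<tau> within J)"
proof -
  from assms obtain g1 g2 where
    g: "\<And>z. z \<in> I \<times> J \<Longrightarrow> ((\<lambda>(s, \<tau>). f s \<tau>) has_derivative (\<lambda>h. fst h *\<^sub>R g1 z + snd h *\<^sub>R g2 z)) (at z within I \<times> J)"
    and b: "differentiable_bounded k M (I \<times> J) g1" "differentiable_bounded k M (I \<times> J) g2"
    by (simp only: differentiable_bounded.simps) blast
  show thesis
  proof (rule that[of "\<lambda>s \<tau>. g1 (s, \<tau>)" "\<lambda>s \<tau>. g2 (s, \<tau>)"])
    fix s \<tau> assume st: "s \<in> I" "\<tau> \<in> J"
    have d: "((\<lambda>(s, \<tau>). f s \<tau>) has_derivative (\<lambda>h. fst h *\<^sub>R g1 (s, \<tau>) + snd h *\<^sub>R g2 (s, \<tau>))) (at (s, \<tau>) within I \<times> J)"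
      using g st by auto
    have "((\<lambda>(s, \<tau>). f s \<tau>) \<circ> (\<lambda>s. (s, \<tau>)) has_derivative
        (\<lambda>h. fst h *\<^sub>R g1 (s, \<tau>) + snd h *\<^sub>R g2 (s, \<tau>)) \<circ> (\<lambda>x. (x, 0))) (at s within I)"
    proof (rule diff_chain_within)
      show "((\<lambda>s. (s, \<tau>)) has_derivative (\<lambda>x. (x, 0))) (at s within I)"
        by (auto intro!: derivative_eq_intros)
      show "((\<lambda>(s, \<tau>). f s \<tau>) has_derivative (\<lambda>h. fst h *\<^sub>R g1 (s, \<tau>) + snd h *\<^sub>R g2 (s, \<tau>)))
          (at (s, \<tau>) within (\<lambda>s. (s, \<tau>)) ` I)"
        by (rule has_derivative_subset[OF d]) (use st in auto)
    qed
    then show "((\<lambda>s. f s \<tau>) has_vector_derivative g1 (s, \<tau>)) (at s within I)"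
      by (simp add: has_vector_derivative_def o_def)
    have "((\<lambda>(s, \<tau>). f s \<tau>) \<circ> (\<lambda>\<tau>. (s, \<tau>)) has_derivative
        (\<lambda>h. fst h *\<^sub>R g1 (s, \<tau>) + snd h *\<^sub>R g2 (s, \<tau>)) \<circ> (\<lambda>x. (0, x))) (at \<tau> within J)"
    proof (rule diff_chain_within)
      show "((\<lambda>\<tau>. (s, \<tau>)) has_derivative (\<lambda>x. (0, x))) (at \<tau> within J)"
        by (auto intro!: derivative_eq_intros)
      show "((\<lambda>(s, \<tau>). f s \<tau>) has_derivative (\<lambda>h. fst h *\<^sub>R g1 (s, \<tau>) + snd h *\<^sub>R g2 (s, \<tau>)))
          (at (s, \<tau>) within (\<lambda>\<tau>. (s, \<tau>)) ` J)"
        by (rule has_derivative_subset[OF d]) (use st in auto)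
    qed
    then show "(f s has_vector_derivative g2 (s, \<tau>)) (at \<tau> within J)"
      by (simp add: has_vector_derivative_def o_def)
  qed (use b in \<open>simp_all add: case_prod_unfold\<close>)
qed

lemma differentiable_bounded_continuous_on:
  assumes "differentiable_bounded (Suc k) M S f"
  shows "continuous_on S f"
proof (rule differentiable_imp_continuous_on)
  show "f differentiable_on S"
    using assms unfolding differentiable_bounded.simps differentiable_on_def differentiable_def by metis
qed

lemma numerals_as_Suc: "(4::nat) = Suc 3" "(3::nat) = Suc 2" "(2::nat) = Suc 1"
  by simp_all

text \<open>
  The predicate is only unfolded one order at a time, through \<open>differentiable_bounded_SucE\<close>.
\<close>
declare differentiable_bounded.simps [simp del]

lemma increment_bound:
  fixes f :: "real \<Rightarrow> real"
  assumes I: "convex I" "a \<in> I" "b \<in> I"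
    and f: "\<And>x. x \<in> I \<Longrightarrow> (f has_vector_derivative f' x) (at x within I)"
    and B: "\<And>x. x \<in> I \<Longrightarrow> x \<in> closed_segment a b \<Longrightarrow> \<bar>f' x\<bar> \<le> B"
  shows "\<bar>f b - f a\<bar> \<le> B * \<bar>b - a\<bar>"
proof -
  have sub: "closed_segment a b \<subseteq> I"
    using I by (simp add: closed_segment_subset)
  have "norm (f b - f a) \<le> B * norm (b - a)"
  proof (rule field_differentiable_bound[OF convex_closed_segment])
    show "(f has_field_derivative f' x) (at x within closed_segment a b)" if "x \<in> closed_segment a b" for x
      using f[of x] that sub
      by (auto simp: has_real_derivative_iff_has_vector_derivative intro: has_vector_derivative_within_subset)
    show "norm (f' x) \<le> B" if "x \<in> closed_segment a b" for x
      using B[of x] that sub by auto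
  qed auto
  then show ?thesis by simp
qed

lemma differentiable_bounded_lipschitz:
  fixes f :: "real \<Rightarrow> real \<Rightarrow> real"
  assumes f: "differentiable_bounded (Suc k) M (I \<times> J) (\<lambda>(s, \<tau>). f s \<tau>)"
    and conv: "convex I" "convex J" and mem: "s \<in> I" "s' \<in> I" "\<tau> \<in> J" "\<tau>' \<in> J"
  shows "\<bar>f s \<tau> - f s' \<tau>'\<bar> \<le> M * \<bar>s - s'\<bar> + M * \<bar>\<tau> - \<tau>'\<bar>"
proof -
  obtain f1 f2 where
    b: "differentiable_bounded k M (I \<times> J) (\<lambda>(s, \<tau>). f1 s \<tau>)"
       "differentiable_bounded k M (I \<times> J) (\<lambda>(s, \<tau>). f2 s \<tau>)"
    and d: "\<And>s \<tau>. s \<in> I \<Longrightarrow> \<tau> \<in> J \<Longrightarrow> ((\<lambda>s. f s \<tau>) has_vector_derivative f1 s \<tau>) (at s within I)"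
      "\<And>s \<tau>. s \<in> I \<Longrightarrow> \<tau> \<in> J \<Longrightarrow> (f s has_vector_derivative f2 s \<tau>) (at \<tau> within J)"
    by (rule differentiable_bounded_SucE[OF f]) blast
  have bound: "\<bar>f1 s \<tau>\<bar> \<le> M" "\<bar>f2 s \<tau>\<bar> \<le> M" if "s \<in> I" "\<tau> \<in> J" for s \<tau>
    using differentiable_bounded_norm_le[OF b(1), of "(s, \<tau>)"]
      differentiable_bounded_norm_le[OF b(2), of "(s, \<tau>)"] that by auto
  have "\<bar>f s \<tau> - f s' \<tau>\<bar> \<le> M * \<bar>s - s'\<bar>"
    by (rule increment_bound[OF conv(1) mem(2,1), where f' = "\<lambda>s. f1 s \<tau>"])
      (use d(1) bound(1) mem in auto)
  moreover have "\<bar>f s' \<tau> - f s' \<tau>'\<bar> \<le> M * \<bar>\<tau> - \<tau>'\<bar>"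
    by (rule increment_bound[OF conv(2) mem(4,3), where f' = "f2 s'"])
      (use d(2) bound(2) mem in auto)
  ultimately show ?thesis by linarith
qed

text \<open>
  The remainder is measured with the Lipschitz constant of the partial derivative, so that a bound
  on the second partial derivatives suffices.
\<close>
lemma first_order_expansion:
  fixes f f1 :: "real \<Rightarrow> real \<Rightarrow> real"
  assumes f1: "\<And>s. s \<in> I \<Longrightarrow> ((\<lambda>s. f s t) has_vector_derivative f1 s t) (at s within I)"
    and b: "differentiable_bounded (Suc k) M (I \<times> J) (\<lambda>(s, \<tau>). f1 s \<tau>)"
    and conv: "convex I" "convex J" and mem: "0 \<in> I" "s \<in> I" "t \<in> J"
    and M: "0 \<le> M"
  shows "\<bar>f s t - f 0 t - f1 0 t * s\<bar> \<le> M * s\<^sup>2"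
proof -
  have "\<bar>(f s t - f1 0 t * s) - (f 0 t - f1 0 t * 0)\<bar> \<le> (M * \<bar>s\<bar>) * \<bar>s - 0\<bar>"
  proof (rule increment_bound[OF conv(1) mem(1,2), where f' = "\<lambda>s. f1 s t - f1 0 t"])
    show "((\<lambda>s. f s t - f1 0 t * s) has_vector_derivative f1 x t - f1 0 t) (at x within I)" if "x \<in> I" for x
      using f1[OF that] by (auto intro!: derivative_eq_intros)
    show "\<bar>f1 x t - f1 0 t\<bar> \<le> M * \<bar>s\<bar>" if "x \<in> I" "x \<in> closed_segment 0 s" for x
    proof -
      have "\<bar>f1 x t - f1 0 t\<bar> \<le> M * \<bar>x\<bar>"
        using differentiable_bounded_lipschitz[OF b conv that(1) mem(1,3,3)] by simp
      also have "\<dots> \<le> M * \<bar>s\<bar>"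
        using that(2) M by (intro mult_left_mono) (auto simp: closed_segment_eq_real_ivl split: if_splits)
      finally show ?thesis .
    qed
  qed
  then show ?thesis by (simp add: power2_eq_square algebra_simps abs_mult_self_eq)
qed

text \<open>
  The graph is expanded first in space at the final time and then backwards in time at fixed
  \<open>s\<close>, integrating bounds for the derivatives. Third derivatives control all remainders. The powers
  of \<open>\<surd>u + \<bar>s\<bar>\<close> reflect the parabolic weights, and \<open>t \<le> 1\<close> lets \<open>u\<^sup>2\<close> count as a term of
  weight 3.
\<close>
lemma graph_expansion:
  fixes y :: "real \<Rightarrow> real \<Rightarrow> real" and L t M :: real
  assumes L: "0 < L" and t: "0 < t" "t \<le> 1"
    and db: "differentiable_bounded 4 M ({-L<..<L} \<times> {0..t}) (\<lambda>(s, \<tau>). y s \<tau>)"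
    and y0: "y 0 t = 0" "deriv (\<lambda>s. y s t) 0 = 0"
  obtains y1 :: "real \<Rightarrow> real \<Rightarrow> real" where
    "\<And>s \<tau>. \<bar>s\<bar> < L \<Longrightarrow> \<tau> \<in> {0..t} \<Longrightarrow> ((\<lambda>s. y s \<tau>) has_real_derivative y1 s \<tau>) (at s)"
    "\<bar>graph_curvature y t\<bar> \<le> M" "\<bar>graph_velocity y t\<bar> \<le> M"
    "\<And>s \<tau>. \<bar>s\<bar> < L \<Longrightarrow> \<tau> \<in> {0..t} \<Longrightarrow> \<bar>y s \<tau>\<bar> \<le> M * (\<bar>s\<bar> + (t - \<tau>))"
    "\<And>s \<tau>. \<bar>s\<bar> < L \<Longrightarrow> \<tau> \<in> {0..t} \<Longrightarrow> \<bar>y s \<tau>\<bar> \<le> M * (sqrt (t - \<tau>) + \<bar>s\<bar>)\<^sup>2"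
    "\<And>s \<tau>. \<bar>s\<bar> < L \<Longrightarrow> \<tau> \<in> {0..t} \<Longrightarrow>
       \<bar>y s \<tau> - (graph_curvature y t * s\<^sup>2 / 2 - graph_velocity y t * (t - \<tau>))\<bar>
         \<le> 2 * M * (sqrt (t - \<tau>) + \<bar>s\<bar>) ^ 3"
    "\<And>s \<tau>. \<bar>s\<bar> < L \<Longrightarrow> \<tau> \<in> {0..t} \<Longrightarrow>
       \<bar>(y s \<tau> - s * y1 s \<tau>) + (graph_curvature y t * s\<^sup>2 / 2 + graph_velocity y t * (t - \<tau>))\<bar>
         \<le> 3 * M * (sqrt (t - \<tau>) + \<bar>s\<bar>) ^ 3"
proof -
  let ?I = "{-L<..<L}" and ?J = "{0..t}"
  have conv: "convex ?I" "convex ?J" by auto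
  have mem: "0 \<in> ?I" "t \<in> ?J" using L t by auto
  obtain y1 y2 where b1: "differentiable_bounded 3 M (?I \<times> ?J) (\<lambda>(s, \<tau>). y1 s \<tau>)"
    and b2: "differentiable_bounded 3 M (?I \<times> ?J) (\<lambda>(s, \<tau>). y2 s \<tau>)"
    and d1: "\<And>s \<tau>. s \<in> ?I \<Longrightarrow> \<tau> \<in> ?J \<Longrightarrow> ((\<lambda>s. y s \<tau>) has_vector_derivative y1 s \<tau>) (at s within ?I)"
    and d2: "\<And>s \<tau>. s \<in> ?I \<Longrightarrow> \<tau> \<in> ?J \<Longrightarrow> (y s has_vector_derivative y2 s \<tau>) (at \<tau> within ?J)"
    by (rule differentiable_bounded_SucE[OF db[unfolded numerals_as_Suc(1)]]) blast
  obtain y11 where b11: "differentiable_bounded 2 M (?I \<times> ?J) (\<lambda>(s, \<tau>). y11 s \<tau>)"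
    and d11: "\<And>s \<tau>. s \<in> ?I \<Longrightarrow> \<tau> \<in> ?J \<Longrightarrow> ((\<lambda>s. y1 s \<tau>) has_vector_derivative y11 s \<tau>) (at s within ?I)"
    by (rule differentiable_bounded_SucE[OF b1[unfolded numerals_as_Suc(2)]]) blast
  have D1: "((\<lambda>s. y s \<tau>) has_real_derivative y1 s \<tau>) (at s)" if "\<bar>s\<bar> < L" "\<tau> \<in> ?J" for s \<tau>
  proof -
    have "s \<in> ?I" using that by auto
    then show ?thesis
      using d1[of s \<tau>] that at_within_open[of s ?I]
      by (simp add: has_real_derivative_iff_has_vector_derivative del: greaterThanLessThan_iff)
  qed
  have D11: "((\<lambda>s. y1 s \<tau>) has_real_derivative y11 s \<tau>) (at s)" if "\<bar>s\<bar> < L" "\<tau> \<in> ?J" for s \<tau>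
  proof -
    have "s \<in> ?I" using that by auto
    then show ?thesis
      using d11[of s \<tau>] that at_within_open[of s ?I]
      by (simp add: has_real_derivative_iff_has_vector_derivative del: greaterThanLessThan_iff)
  qed
  have y10: "y1 0 t = 0"
    using D1[of 0 t] y0(2) L t by (auto dest!: DERIV_imp_deriv)
  have \<kappa>: "graph_curvature y t = y11 0 t"
  proof -
    have "((\<lambda>s. y1 s t) has_real_derivative y11 0 t) (at 0)" using D11 L t by simp
    then have "(deriv (\<lambda>s. y s t) has_real_derivative y11 0 t) (at 0)"
      by (rule has_field_derivative_transform_within_open[where S = ?I])
        (use L t in \<open>auto simp: DERIV_imp_deriv[OF D1]\<close>)
    then show ?thesis unfolding graph_curvature_def by (rule DERIV_imp_deriv)
  qed
  have v: "graph_velocity y t = y2 0 t"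
    unfolding graph_velocity_def
    by (rule vector_derivative_within_cbox[where a = 0 and b = t, unfolded cbox_interval])
      (use d2[of 0 t] mem t in auto)
  have M0: "\<bar>y11 0 t\<bar> \<le> M" "\<bar>y2 0 t\<bar> \<le> M"
    using differentiable_bounded_norm_le[OF b11, of "(0, t)"] differentiable_bounded_norm_le[OF b2, of "(0, t)"]
      mem by auto
  then have M: "0 \<le> M" by linarith
  have lip: "\<bar>y s \<tau> - y s' \<tau>'\<bar> \<le> M * \<bar>s - s'\<bar> + M * \<bar>\<tau> - \<tau>'\<bar>"
    if "s \<in> ?I" "s' \<in> ?I" "\<tau> \<in> ?J" "\<tau>' \<in> ?J" for s s' \<tau> \<tau>'
    by (rule differentiable_bounded_lipschitz[OF db[unfolded numerals_as_Suc(1)] conv that])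
  have lip1: "\<bar>y1 s \<tau> - y1 s' \<tau>'\<bar> \<le> M * \<bar>s - s'\<bar> + M * \<bar>\<tau> - \<tau>'\<bar>"
    if "s \<in> ?I" "s' \<in> ?I" "\<tau> \<in> ?J" "\<tau>' \<in> ?J" for s s' \<tau> \<tau>'
    by (rule differentiable_bounded_lipschitz[OF b1[unfolded numerals_as_Suc(2)] conv that])
  have lip2: "\<bar>y2 s \<tau> - y2 s' \<tau>'\<bar> \<le> M * \<bar>s - s'\<bar> + M * \<bar>\<tau> - \<tau>'\<bar>"
    if "s \<in> ?I" "s' \<in> ?I" "\<tau> \<in> ?J" "\<tau>' \<in> ?J" for s s' \<tau> \<tau>'
    by (rule differentiable_bounded_lipschitz[OF b2[unfolded numerals_as_Suc(2)] conv that])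
  have seg: "\<bar>x\<bar> \<le> \<bar>s\<bar>" if "x \<in> closed_segment 0 s" for x s :: real
    using that by (auto simp: closed_segment_eq_real_ivl split: if_splits)
  have E1: "\<bar>y1 s t - y11 0 t * s\<bar> \<le> M * s\<^sup>2" if s: "s \<in> ?I" for s
    using first_order_expansion[where f = y1 and ?f1.0 = y11, OF d11[OF _ mem(2)] b11[unfolded numerals_as_Suc(3)] conv mem(1) s mem(2) M] y10
    by simp
  have E0: "\<bar>y s t - y11 0 t * s\<^sup>2 / 2\<bar> \<le> M * \<bar>s\<bar> ^ 3" if s: "s \<in> ?I" for s
  proof -
    have "\<bar>(y s t - y11 0 t * s\<^sup>2 / 2) - (y 0 t - y11 0 t * 0\<^sup>2 / 2)\<bar> \<le> (M * s\<^sup>2) * \<bar>s - 0\<bar>"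
    proof (rule increment_bound[OF conv(1) mem(1) s, where f' = "\<lambda>s. y1 s t - y11 0 t * s"])
      show "((\<lambda>s. y s t - y11 0 t * s\<^sup>2 / 2) has_vector_derivative y1 x t - y11 0 t * x) (at x within ?I)"
        if "x \<in> ?I" for x
        using d1[OF that mem(2)]
        unfolding has_real_derivative_iff_has_vector_derivative[symmetric]
        by (auto intro!: derivative_eq_intros)
      show "\<bar>y1 x t - y11 0 t * x\<bar> \<le> M * s\<^sup>2" if "x \<in> ?I" "x \<in> closed_segment 0 s" for x
      proof -
        have "x\<^sup>2 \<le> s\<^sup>2" using seg[OF that(2)] by (simp add: abs_le_square_iff)
        then have "M * x\<^sup>2 \<le> M * s\<^sup>2" using M by (intro mult_left_mono)
        with E1[OF that(1)] show ?thesis by linarith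
      qed
    qed
    moreover have "s\<^sup>2 * \<bar>s\<bar> = \<bar>s\<bar> ^ 3"
      by (simp add: eval_nat_numeral abs_mult_self_eq)
    ultimately show ?thesis using y0(1) by (simp add: mult.assoc)
  qed
  have ET: "\<bar>y s \<tau> - y s t + y2 0 t * (t - \<tau>)\<bar> \<le> M * (\<bar>s\<bar> + (t - \<tau>)) * (t - \<tau>)"
    if s: "s \<in> ?I" and \<tau>: "\<tau> \<in> ?J" for s \<tau>
  proof -
    have "\<bar>(y s \<tau> - y2 0 t * \<tau>) - (y s t - y2 0 t * t)\<bar> \<le> (M * (\<bar>s\<bar> + (t - \<tau>))) * \<bar>\<tau> - t\<bar>"
    proof (rule increment_bound[OF conv(2) mem(2) \<tau>, where f' = "\<lambda>\<tau>. y2 s \<tau> - y2 0 t"])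
      show "((\<lambda>\<tau>. y s \<tau> - y2 0 t * \<tau>) has_vector_derivative y2 s x - y2 0 t) (at x within ?J)"
        if "x \<in> ?J" for x
        using d2[OF s that] unfolding has_real_derivative_iff_has_vector_derivative[symmetric]
        by (auto intro!: derivative_eq_intros)
      show "\<bar>y2 s x - y2 0 t\<bar> \<le> M * (\<bar>s\<bar> + (t - \<tau>))" if x: "x \<in> ?J" "x \<in> closed_segment t \<tau>" for x
      proof -
        have "\<bar>x - t\<bar> \<le> t - \<tau>" using x(2) \<tau> by (auto simp: closed_segment_eq_real_ivl split: if_splits)
        then have "M * \<bar>x - t\<bar> \<le> M * (t - \<tau>)" using M by (intro mult_left_mono)
        with lip2[OF s mem(1) x(1) mem(2)] show ?thesis by (simp add: algebra_simps)
      qed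
    qed
    then show ?thesis using \<tau> by (simp add: algebra_simps abs_minus_commute)
  qed
  have scale: "\<bar>s\<bar> ^ 3 + (\<bar>s\<bar> + (t - \<tau>)) * (t - \<tau>) \<le> 2 * (sqrt (t - \<tau>) + \<bar>s\<bar>) ^ 3"
      "s\<^sup>2 + (t - \<tau>) \<le> (sqrt (t - \<tau>) + \<bar>s\<bar>)\<^sup>2" "\<bar>s\<bar> \<le> sqrt (t - \<tau>) + \<bar>s\<bar>" if \<tau>: "\<tau> \<in> ?J" for s \<tau>
  proof -
    define a where "a = sqrt (t - \<tau>)"
    have a: "0 \<le> a" "a \<le> 1" "t - \<tau> = a\<^sup>2" using \<tau> t by (auto simp: a_def)
    have aa: "a\<^sup>2 \<le> a" using a by (simp add: power2_eq_square mult_left_le)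
    show "s\<^sup>2 + (t - \<tau>) \<le> (sqrt (t - \<tau>) + \<bar>s\<bar>)\<^sup>2" "\<bar>s\<bar> \<le> sqrt (t - \<tau>) + \<bar>s\<bar>"
      using a unfolding a_def[symmetric] by (auto simp: power2_sum)
    have "(\<bar>s\<bar> + a\<^sup>2) * a\<^sup>2 \<le> (a + \<bar>s\<bar>) * (a + \<bar>s\<bar>)\<^sup>2"
      using a aa by (intro mult_mono power_mono) auto
    moreover have "\<bar>s\<bar> ^ 3 \<le> (a + \<bar>s\<bar>) ^ 3" using a by (intro power_mono) auto
    ultimately have "\<bar>s\<bar> ^ 3 + (\<bar>s\<bar> + a\<^sup>2) * a\<^sup>2 \<le> 2 * (a + \<bar>s\<bar>) ^ 3"
      by (simp add: eval_nat_numeral)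
    then show "\<bar>s\<bar> ^ 3 + (\<bar>s\<bar> + (t - \<tau>)) * (t - \<tau>) \<le> 2 * (sqrt (t - \<tau>) + \<bar>s\<bar>) ^ 3"
      unfolding a(3)[symmetric] unfolding a_def .
  qed
  have R0: "\<bar>y s \<tau> - (y11 0 t * s\<^sup>2 / 2 - y2 0 t * (t - \<tau>))\<bar> \<le> 2 * M * (sqrt (t - \<tau>) + \<bar>s\<bar>) ^ 3"
    if s: "s \<in> ?I" and \<tau>: "\<tau> \<in> ?J" for s \<tau>
  proof -
    have "M * (\<bar>s\<bar> ^ 3 + (\<bar>s\<bar> + (t - \<tau>)) * (t - \<tau>)) \<le> M * (2 * (sqrt (t - \<tau>) + \<bar>s\<bar>) ^ 3)"
      using scale(1)[OF \<tau>] M by (rule mult_left_mono)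
    then have "M * \<bar>s\<bar> ^ 3 + M * (\<bar>s\<bar> + (t - \<tau>)) * (t - \<tau>) \<le> 2 * M * (sqrt (t - \<tau>) + \<bar>s\<bar>) ^ 3"
      by (simp add: algebra_simps)
    with E0[OF s] ET[OF s \<tau>] show ?thesis by linarith
  qed
  have R1: "\<bar>s\<bar> * \<bar>y1 s \<tau> - y11 0 t * s\<bar> \<le> M * (sqrt (t - \<tau>) + \<bar>s\<bar>) ^ 3"
    if s: "s \<in> ?I" and \<tau>: "\<tau> \<in> ?J" for s \<tau>
  proof -
    have "\<bar>y1 s \<tau> - y1 s t\<bar> \<le> M * (t - \<tau>)" using lip1[OF s s \<tau> mem(2)] \<tau> by simp
    with E1[OF s] have "\<bar>y1 s \<tau> - y11 0 t * s\<bar> \<le> M * (s\<^sup>2 + (t - \<tau>))"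
      by (simp add: algebra_simps)
    also have "\<dots> \<le> M * (sqrt (t - \<tau>) + \<bar>s\<bar>)\<^sup>2" using scale(2)[OF \<tau>] M by (intro mult_left_mono) auto
    finally have "\<bar>s\<bar> * \<bar>y1 s \<tau> - y11 0 t * s\<bar> \<le> (sqrt (t - \<tau>) + \<bar>s\<bar>) * (M * (sqrt (t - \<tau>) + \<bar>s\<bar>)\<^sup>2)"
      using scale(3)[OF \<tau>, of s] by (intro mult_mono) auto
    then show ?thesis by (simp add: eval_nat_numeral mult_ac)
  qed
  show thesis
  proof (rule that[of y1], unfold \<kappa> v)
    fix s \<tau> assume "\<bar>s\<bar> < L" and \<tau>: "\<tau> \<in> ?J"
    then have s: "s \<in> ?I" by auto
    show "((\<lambda>s. y s \<tau>) has_real_derivative y1 s \<tau>) (at s)" using D1 \<open>\<bar>s\<bar> < L\<close> \<tau> .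
    show "\<bar>y s \<tau>\<bar> \<le> M * (\<bar>s\<bar> + (t - \<tau>))"
      using lip[OF s mem(1) \<tau> mem(2)] y0(1) \<tau> by (simp add: algebra_simps)
    show "\<bar>y s \<tau>\<bar> \<le> M * (sqrt (t - \<tau>) + \<bar>s\<bar>)\<^sup>2"
    proof -
      have "\<bar>y s t\<bar> \<le> M * s\<^sup>2"
        using first_order_expansion[where f = y and ?f1.0 = y1, OF d1[OF _ mem(2)] b1[unfolded numerals_as_Suc(2)] conv mem(1) s mem(2) M] y10 y0
        by simp
      moreover have "\<bar>y s \<tau> - y s t\<bar> \<le> M * (t - \<tau>)" using lip[OF s s \<tau> mem(2)] \<tau> by simp
      ultimately have "\<bar>y s \<tau>\<bar> \<le> M * (s\<^sup>2 + (t - \<tau>))" by (simp add: algebra_simps)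
      also have "\<dots> \<le> M * (sqrt (t - \<tau>) + \<bar>s\<bar>)\<^sup>2" using scale(2)[OF \<tau>] M by (intro mult_left_mono) auto
      finally show ?thesis .
    qed
    show "\<bar>y s \<tau> - (y11 0 t * s\<^sup>2 / 2 - y2 0 t * (t - \<tau>))\<bar> \<le> 2 * M * (sqrt (t - \<tau>) + \<bar>s\<bar>) ^ 3"
      using R0[OF s \<tau>] .
    have "(y s \<tau> - s * y1 s \<tau>) + (y11 0 t * s\<^sup>2 / 2 + y2 0 t * (t - \<tau>))
        = (y s \<tau> - (y11 0 t * s\<^sup>2 / 2 - y2 0 t * (t - \<tau>))) - s * (y1 s \<tau> - y11 0 t * s)"
      by (simp add: power2_eq_square field_simps)
    then show "\<bar>(y s \<tau> - s * y1 s \<tau>) + (y11 0 t * s\<^sup>2 / 2 + y2 0 t * (t - \<tau>))\<bar>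
        \<le> 3 * M * (sqrt (t - \<tau>) + \<bar>s\<bar>) ^ 3"
      using R0[OF s \<tau>] R1[OF s \<tau>] by (simp only: abs_mult[symmetric])
  qed (use M0 in auto)
qed

lemma density_expansion:
  fixes q :: "real \<Rightarrow> real \<Rightarrow> real" and L t M :: real
  assumes L: "0 < L" and t: "0 < t"
    and db: "differentiable_bounded 4 M ({-L<..<L} \<times> {0..t}) (\<lambda>(s, \<tau>). q s \<tau>)"
  obtains q1 where "\<bar>q 0 t\<bar> \<le> M" "\<bar>q1\<bar> \<le> M"
    "\<And>s \<tau>. \<bar>s\<bar> < L \<Longrightarrow> \<tau> \<in> {0..t} \<Longrightarrow> \<bar>q s \<tau> - q 0 t - q1 * s\<bar> \<le> M * (sqrt (t - \<tau>) + \<bar>s\<bar>)\<^sup>2"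
proof -
  let ?I = "{-L<..<L}" and ?J = "{0..t}"
  have conv: "convex ?I" "convex ?J" by auto
  have mem: "0 \<in> ?I" "t \<in> ?J" using L t by auto
  obtain q1 where b1: "differentiable_bounded 3 M (?I \<times> ?J) (\<lambda>(s, \<tau>). q1 s \<tau>)"
    and d1: "\<And>s \<tau>. s \<in> ?I \<Longrightarrow> \<tau> \<in> ?J \<Longrightarrow> ((\<lambda>s. q s \<tau>) has_vector_derivative q1 s \<tau>) (at s within ?I)"
    by (rule differentiable_bounded_SucE[OF db[unfolded numerals_as_Suc(1)]]) blast
  have M0: "\<bar>q 0 t\<bar> \<le> M" "\<bar>q1 0 t\<bar> \<le> M"
    using differentiable_bounded_norm_le[OF db, of "(0, t)"] differentiable_bounded_norm_le[OF b1, of "(0, t)"]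
      mem by auto
  then have M: "0 \<le> M" by linarith
  show thesis
  proof (rule that[OF M0])
    fix s \<tau> assume "\<bar>s\<bar> < L" and \<tau>: "\<tau> \<in> ?J"
    then have s: "s \<in> ?I" by auto
    have "\<bar>q s t - q 0 t - q1 0 t * s\<bar> \<le> M * s\<^sup>2"
      using first_order_expansion[where f = q and ?f1.0 = q1, OF d1[OF _ mem(2)] b1[unfolded numerals_as_Suc(2)] conv mem(1) s mem(2) M] .
    moreover have "\<bar>q s \<tau> - q s t\<bar> \<le> M * \<bar>s - s\<bar> + M * \<bar>\<tau> - t\<bar>"
      by (rule differentiable_bounded_lipschitz[OF db[unfolded numerals_as_Suc(1)] conv s s \<tau> mem(2)])
    ultimately have "\<bar>q s \<tau> - q 0 t - q1 0 t * s\<bar> \<le> M * (s\<^sup>2 + (t - \<tau>))"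
      using \<tau> by (simp add: algebra_simps)
    also have "\<dots> \<le> M * (sqrt (t - \<tau>) + \<bar>s\<bar>)\<^sup>2"
      using M \<tau> by (intro mult_left_mono) (auto simp: power2_sum)
    finally show "\<bar>q s \<tau> - q 0 t - q1 0 t * s\<bar> \<le> M * (sqrt (t - \<tau>) + \<bar>s\<bar>)\<^sup>2" .
  qed
qed

section \<open>From closed curves to the graph\<close>

lemma directional_deriv_heat_kernel:
  fixes x p \<nu> :: "real ^ 2"
  assumes "0 < u"
  shows "directional_deriv (\<lambda>q. heat_kernel (x - q) u) p \<nu>
    = (x - p) \<bullet> \<nu> / (8 * pi * u\<^sup>2) * exp (- (norm (x - p))\<^sup>2 / (4 * u))"
proof -
  define d where "d = x - p"
  have sq: "(norm (x - (p + h *\<^sub>R \<nu>)))\<^sup>2 = (norm d)\<^sup>2 - 2 * h * (d \<bullet> \<nu>) + h\<^sup>2 * (\<nu> \<bullet> \<nu>)" for h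
  proof -
    have "x - (p + h *\<^sub>R \<nu>) = d - h *\<^sub>R \<nu>" by (simp add: d_def)
    then show ?thesis
      unfolding power2_norm_eq_inner
      by (simp add: inner_diff power2_eq_square algebra_simps inner_commute)
  qed
  have "((\<lambda>h. heat_kernel (x - (p + h *\<^sub>R \<nu>)) u) has_real_derivative
      d \<bullet> \<nu> / (8 * pi * u\<^sup>2) * exp (- (norm d)\<^sup>2 / (4 * u))) (at 0)"
    unfolding heat_kernel_def sq
    using assms by (auto intro!: derivative_eq_intros simp: field_simps power2_eq_square)
  then show ?thesis
    unfolding directional_deriv_def d_def by (rule DERIV_imp_deriv)
qed

lemma orthonormal_expansion:
  fixes e n p :: "real ^ 2"
  assumes "norm e = 1" "norm n = 1" "e \<bullet> n = 0"
  shows "p = (p \<bullet> e) *\<^sub>R e + (p \<bullet> n) *\<^sub>R n"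
proof -
  have e: "e$1 * e$1 + e$2 * e$2 = 1" and n: "n$1 * n$1 + n$2 * n$2 = 1" and en: "e$1 * n$1 + e$2 * n$2 = 0"
    using assms by (auto simp: norm_eq_1 inner_vec_def sum_2)
  define k where "k = e$1 * n$2 - e$2 * n$1"
  have "n$1 = - k * e$2" "n$2 = k * e$1"
    using e en unfolding k_def by algebra+
  then have k: "n$1 = - k * e$2" "n$2 = k * e$1" "k * k = 1"
    using e n by auto algebra
  have "p$1 = (p$1 * e$1 + p$2 * e$2) * e$1 + (p$1 * n$1 + p$2 * n$2) * n$1"
    "p$2 = (p$1 * e$1 + p$2 * e$2) * e$2 + (p$1 * n$1 + p$2 * n$2) * n$2"
    using e k by algebra+
  then show ?thesis
    by (simp add: vec_eq_iff forall_2 inner_vec_def sum_2)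
qed

lemma
  fixes x0 e n :: "real ^ 2"
  assumes "norm e = 1" "norm n = 1" "e \<bullet> n = 0"
  shows local_point_inner: "(local_point x0 e n s w - x0) \<bullet> e = s" "(local_point x0 e n s w - x0) \<bullet> n = w"
    and local_point_of_inner: "local_point x0 e n ((p - x0) \<bullet> e) ((p - x0) \<bullet> n) = p"
    and norm_orthonormal: "(norm p)\<^sup>2 = (p \<bullet> e)\<^sup>2 + (p \<bullet> n)\<^sup>2"
    and dist_local_point: "dist x0 (local_point x0 e n s w) = sqrt (s\<^sup>2 + w\<^sup>2)"
proof -
  have 1: "e \<bullet> e = 1" "n \<bullet> n = 1" "n \<bullet> e = 0"
    using assms by (auto simp: norm_eq_1 inner_commute)
  show 2: "(local_point x0 e n s w - x0) \<bullet> e = s" "(local_point x0 e n s w - x0) \<bullet> n = w" for s w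
    using 1 assms by (auto simp: local_point_def inner_add_left)
  show "local_point x0 e n ((p - x0) \<bullet> e) ((p - x0) \<bullet> n) = p"
    using orthonormal_expansion[OF assms, of "p - x0"] by (simp add: local_point_def algebra_simps)
  show 3: "(norm p)\<^sup>2 = (p \<bullet> e)\<^sup>2 + (p \<bullet> n)\<^sup>2" for p
  proof -
    have "(norm p)\<^sup>2 = p \<bullet> ((p \<bullet> e) *\<^sub>R e + (p \<bullet> n) *\<^sub>R n)"
      using orthonormal_expansion[OF assms, of p] by (simp add: power2_norm_eq_inner)
    then show ?thesis by (simp add: inner_add_right power2_eq_square)
  qed
  have "(dist x0 (local_point x0 e n s w))\<^sup>2 = s\<^sup>2 + w\<^sup>2"
    using 3[of "local_point x0 e n s w - x0"] 2 by (simp add: dist_norm norm_minus_commute)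
  then show "dist x0 (local_point x0 e n s w) = sqrt (s\<^sup>2 + w\<^sup>2)"
    by (simp add: real_sqrt_unique)
qed

text \<open>
  Orthogonality to the tangent determines the unit normal up to sign. If it pointed to the side
  above the graph, then small steps against it would stay in \<open>W\<close>, hence above the graph, and the
  difference quotients of \<open>Y\<close> along these steps would contradict its derivative.
\<close>
lemma outward_normal_of_graph:
  fixes x0 e n \<nu> V :: "real ^ 2" and Y :: "real \<Rightarrow> real"
  assumes fr: "norm e = 1" "norm n = 1" "e \<bullet> n = 0"
    and Y: "(Y has_real_derivative Y') (at s)"
    and above: "\<forall>\<^sub>F z in nhds (s, Y s). local_point x0 e n (fst z) (snd z) \<in> W \<longrightarrow> Y (fst z) < snd z"
    and V: "V = a *\<^sub>R (e + Y' *\<^sub>R n)" "a \<noteq> 0"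
    and out: "outward_unit_normal W (local_point x0 e n s (Y s)) V \<nu>"
  shows "sqrt (1 + Y'\<^sup>2) *\<^sub>R \<nu> = Y' *\<^sub>R e - n"
proof -
  define \<alpha> where "\<alpha> = \<nu> \<bullet> e"
  define \<beta> where "\<beta> = \<nu> \<bullet> n"
  define k where "k = sqrt (1 + Y'\<^sup>2)"
  have k: "k > 0" "k\<^sup>2 = 1 + Y'\<^sup>2" by (auto simp: k_def add_pos_nonneg)
  have \<nu>: "\<nu> = \<alpha> *\<^sub>R e + \<beta> *\<^sub>R n"
    using orthonormal_expansion[OF fr, of \<nu>] by (simp add: \<alpha>_def \<beta>_def)
  from out obtain \<epsilon> where unit: "norm \<nu> = 1" and orth: "\<nu> \<bullet> V = 0" and \<epsilon>: "\<epsilon> > 0"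
    and inside: "\<And>h. 0 < h \<Longrightarrow> h < \<epsilon> \<Longrightarrow> local_point x0 e n s (Y s) - h *\<^sub>R \<nu> \<in> W"
    unfolding outward_unit_normal_def by blast
  have \<alpha>: "\<alpha> = - Y' * \<beta>"
    using orth V by (simp add: inner_add_right \<alpha>_def \<beta>_def add_eq_0_iff2)
  have "\<alpha>\<^sup>2 + \<beta>\<^sup>2 = 1"
    using norm_orthonormal[OF fr, of \<nu>] unit by (simp add: \<alpha>_def \<beta>_def)
  then have "(k * \<beta>)\<^sup>2 = 1"
    by (simp add: \<alpha> power_mult_distrib k(2) algebra_simps)
  then have k\<beta>: "k * \<beta> = 1 \<or> k * \<beta> = -1" by (simp add: power2_eq_1_iff)
  (* If \<beta> were positive, p - h \<nu> would lie below the graph, that is, outside the domain. *)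
  have "\<not> \<beta> > 0"
  proof
    assume \<beta>: "\<beta> > 0"
    have "((\<lambda>h. (s - h * \<alpha>, Y s - h * \<beta>)) \<longlongrightarrow> (s - 0 * \<alpha>, Y s - 0 * \<beta>)) (at_right 0)"
      by (intro tendsto_intros)
    then have "filterlim (\<lambda>h. (s - h * \<alpha>, Y s - h * \<beta>)) (nhds (s, Y s)) (at_right 0)" by simp
    from eventually_compose_filterlim[OF above this]
    have "\<forall>\<^sub>F h in at_right 0. local_point x0 e n (s - h * \<alpha>) (Y s - h * \<beta>) \<in> W \<longrightarrow> Y (s - h * \<alpha>) < Y s - h * \<beta>"
      by simp
    moreover have "\<forall>\<^sub>F h in at_right 0. 0 < h \<and> h < \<epsilon>"
      using \<epsilon> by (auto simp: eventually_at_right_field)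
    ultimately have ev: "\<forall>\<^sub>F h in at_right 0. (Y (s - h * \<alpha>) - Y s) / h \<le> - \<beta>"
    proof eventually_elim
      case (elim h)
      have "local_point x0 e n s (Y s) - h *\<^sub>R \<nu> = local_point x0 e n (s - h * \<alpha>) (Y s - h * \<beta>)"
        by (simp add: local_point_def \<nu> algebra_simps)
      with inside[of h] elim have "Y (s - h * \<alpha>) - Y s \<le> - \<beta> * h" by (simp add: mult.commute)
      then show ?case using elim by (simp add: divide_le_eq)
    qed
    have "((\<lambda>h. Y (s - h * \<alpha>)) has_real_derivative Y' * (- \<alpha>)) (at 0)"
      by (rule DERIV_chain2[of Y]) (use Y in \<open>auto intro!: derivative_eq_intros\<close>)
    then have "((\<lambda>h. (Y (s - h * \<alpha>) - Y s) / h) \<longlongrightarrow> Y' * (- \<alpha>)) (at 0)"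
      by (simp add: has_field_derivative_iff)
    then have "((\<lambda>h. (Y (s - h * \<alpha>) - Y s) / h) \<longlongrightarrow> Y' * (- \<alpha>)) (at_right 0)"
      by (simp add: filterlim_at_split)
    then have "Y' * (- \<alpha>) \<le> - \<beta>"
      by (rule tendsto_upperbound[OF _ ev]) simp
    then have "k\<^sup>2 * \<beta> \<le> 0"
      unfolding k(2) by (simp add: \<alpha> power2_eq_square algebra_simps)
    then show False using \<beta> k(1) by (simp add: mult_le_0_iff)
  qed
  moreover have "\<beta> > 0" if "k * \<beta> = 1"
    using that k(1) by (metis zero_less_mult_pos zero_less_one)
  ultimately have "k * \<beta> = -1" using k\<beta> by blast
  moreover have "k *\<^sub>R \<nu> = (k * \<beta>) *\<^sub>R (n - Y' *\<^sub>R e)"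
    unfolding \<nu> \<alpha> by (simp add: algebra_simps)
  ultimately have "k *\<^sub>R \<nu> = Y' *\<^sub>R e - n"
    by simp
  then show ?thesis by (simp add: k_def)
qed

lemma has_derivative_coordinate:
  fixes g :: "real \<Rightarrow> real ^ 2"
  assumes "(g has_vector_derivative V) (at \<theta>)"
  shows "((\<lambda>\<theta>. (g \<theta> - x0) \<bullet> w) has_real_derivative V \<bullet> w) (at \<theta>)"
proof -
  have "((\<lambda>\<theta>. g \<theta> - x0) has_vector_derivative V) (at \<theta>)"
    using assms by (auto intro!: derivative_eq_intros)
  from bounded_linear.has_vector_derivative[OF bounded_linear_inner_left this]
  show ?thesis by (simp add: has_real_derivative_iff_has_vector_derivative)
qed

text \<open>
  The \<open>n\<close>-coordinate along the curve has two derivatives at \<open>\<theta>\<close>, one read off from the curve and one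
  from the chain rule for the graph; they must agree.
\<close>
lemma tangent_of_graph:
  fixes g :: "real \<Rightarrow> real ^ 2"
  assumes g: "(g has_vector_derivative V) (at \<theta>)"
    and Y: "(Y has_real_derivative Y') (at ((g \<theta> - x0) \<bullet> e))"
    and on_graph: "\<forall>\<^sub>F \<phi> in nhds \<theta>. (g \<phi> - x0) \<bullet> n = Y ((g \<phi> - x0) \<bullet> e)"
  shows "V \<bullet> n = Y' * (V \<bullet> e)"
proof -
  from on_graph obtain U where U: "open U" "\<theta> \<in> U" "\<And>\<phi>. \<phi> \<in> U \<Longrightarrow> (g \<phi> - x0) \<bullet> n = Y ((g \<phi> - x0) \<bullet> e)"
    unfolding eventually_nhds by blast
  have "((\<lambda>\<theta>. Y ((g \<theta> - x0) \<bullet> e)) has_real_derivative Y' * (V \<bullet> e)) (at \<theta>)"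
    by (rule DERIV_chain2[OF Y has_derivative_coordinate[OF g]])
  then have "((\<lambda>\<theta>. (g \<theta> - x0) \<bullet> n) has_real_derivative Y' * (V \<bullet> e)) (at \<theta>)"
    by (rule has_field_derivative_transform_within_open[OF _ U(1,2)]) (use U(3) in auto)
  then show ?thesis
    by (rule DERIV_unique[OF has_derivative_coordinate[OF g]])
qed

text \<open>
  On the near parameters of the \<open>j\<close>-th curve, \<open>S j \<theta>\<close> is the graph coordinate of the point, and the
  speed is \<open>\<bar>S' j \<theta>\<bar> sqrt (1 + Y'\<^sup>2)\<close>. Points of the graph determine \<open>j\<close> and \<open>\<theta> \<in> {0..<1}\<close>, so \<open>S j\<close>
  is injective there and the images for different \<open>j\<close> are disjoint; periodicity makes them cover
  the interval. The change of variables theorem only needs the near parameters to form a measurable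
  set, so that no decomposition into arcs is required.
\<close>
lemma boundary_integral_near_far:
  fixes \<gamma> :: "nat \<Rightarrow> real \<Rightarrow> real \<Rightarrow> real ^ 2" and f :: "real ^ 2 \<Rightarrow> real"
    and x0 e n :: "real ^ 2" and Y Y' :: "real \<Rightarrow> real"
  assumes vel: "\<And>j \<theta>. j < m \<Longrightarrow> ((\<lambda>\<theta>. \<gamma> j \<theta> \<tau>) has_vector_derivative V j \<theta>) (at \<theta>)"
    and periodic: "\<And>j \<theta>. j < m \<Longrightarrow> \<gamma> j (\<theta> + 1) \<tau> = \<gamma> j \<theta> \<tau>"
    and simple: "\<And>j k \<theta> \<phi>. j < m \<Longrightarrow> k < m \<Longrightarrow> \<theta> \<in> {0..<1} \<Longrightarrow> \<phi> \<in> {0..<1} \<Longrightarrow>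
        \<gamma> j \<theta> \<tau> = \<gamma> k \<phi> \<tau> \<Longrightarrow> j = k \<and> \<theta> = \<phi>"
    and cont: "\<And>j. j < m \<Longrightarrow> continuous_on {0..1} (\<lambda>\<theta>. f (\<gamma> j \<theta> \<tau>) * norm (V j \<theta>))"
    and fr: "norm e = 1" "norm n = 1" "e \<bullet> n = 0"
    and Y: "\<And>s. \<bar>s\<bar> < \<delta> \<Longrightarrow> (Y has_real_derivative Y' s) (at s)"
    and near: "\<And>j \<theta>. j < m \<Longrightarrow> \<bar>(\<gamma> j \<theta> \<tau> - x0) \<bullet> e\<bar> < \<delta> \<Longrightarrow> dist x0 (\<gamma> j \<theta> \<tau>) < \<rho> \<Longrightarrow>
        (\<gamma> j \<theta> \<tau> - x0) \<bullet> n = Y ((\<gamma> j \<theta> \<tau> - x0) \<bullet> e)"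
    and graph: "\<And>s. \<bar>s\<bar> < \<delta> \<Longrightarrow> dist x0 (local_point x0 e n s (Y s)) < \<rho> \<and>
        (\<exists>j<m. \<exists>\<theta>. \<gamma> j \<theta> \<tau> = local_point x0 e n s (Y s))"
    and far: "\<And>j \<theta>. j < m \<Longrightarrow> \<not> (\<bar>(\<gamma> j \<theta> \<tau> - x0) \<bullet> e\<bar> < \<delta> \<and> dist x0 (\<gamma> j \<theta> \<tau>) < \<rho>) \<Longrightarrow>
        \<bar>f (\<gamma> j \<theta> \<tau>) * norm (V j \<theta>)\<bar> \<le> B"
    and B: "0 \<le> B"
  obtains I where "((\<lambda>s. f (local_point x0 e n s (Y s)) * sqrt (1 + (Y' s)\<^sup>2)) has_integral I) {-\<delta><..<\<delta>}"
    "\<bar>boundary_integral m \<gamma> \<tau> f - I\<bar> \<le> real m * B"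
proof -
  define S where "S j \<theta> = (\<gamma> j \<theta> \<tau> - x0) \<bullet> e" for j \<theta>
  define Nr where "Nr j = {\<theta>. \<bar>S j \<theta>\<bar> < \<delta> \<and> dist x0 (\<gamma> j \<theta> \<tau>) < \<rho>}" for j
  define N where "N j = {0..<1} \<inter> Nr j" for j
  define h where "h j \<theta> = f (\<gamma> j \<theta> \<tau>) * norm (V j \<theta>)" for j \<theta>
  define F where "F s = f (local_point x0 e n s (Y s)) * sqrt (1 + (Y' s)\<^sup>2)" for s
  have point: "\<gamma> j \<theta> \<tau> = local_point x0 e n (S j \<theta>) (Y (S j \<theta>))" if "j < m" "\<theta> \<in> Nr j" for j \<theta>
    using near[of j \<theta>] that local_point_of_inner[OF fr, of x0 "\<gamma> j \<theta> \<tau>"]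
    by (simp add: Nr_def S_def)
  have contS: "continuous_on UNIV (\<lambda>\<theta>. \<gamma> j \<theta> \<tau>)" if "j < m" for j
    using has_vector_derivative_continuous[OF vel[OF that]]
    unfolding continuous_on_eq_continuous_at[OF open_UNIV] by blast
  have openNr: "open (Nr j)" if "j < m" for j
    unfolding Nr_def S_def
    by (intro open_Collect_conj open_Collect_less continuous_intros contS[OF that])
  have measN: "N j \<in> sets lebesgue" if "j < m" for j
    unfolding N_def using openNr[OF that] by auto
  have dS: "(S j has_real_derivative V j \<theta> \<bullet> e) (at \<theta>)" if "j < m" for j \<theta>
    unfolding S_def by (rule has_derivative_coordinate[OF vel[OF that]])
  have speed: "h j \<theta> = \<bar>V j \<theta> \<bullet> e\<bar> * F (S j \<theta>)" if j: "j < m" and \<theta>: "\<theta> \<in> Nr j" for j \<theta>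
  proof -
    have "\<forall>\<^sub>F \<phi> in nhds \<theta>. (\<gamma> j \<phi> \<tau> - x0) \<bullet> n = Y ((\<gamma> j \<phi> \<tau> - x0) \<bullet> e)"
      using eventually_nhds_in_open[OF openNr[OF j] \<theta>] near[OF j]
      by (auto simp: Nr_def S_def elim: eventually_mono)
    then have Vn: "V j \<theta> \<bullet> n = Y' (S j \<theta>) * (V j \<theta> \<bullet> e)"
      using \<theta> unfolding S_def by (intro tangent_of_graph[OF vel[OF j] Y]) (auto simp: Nr_def S_def)
    have "(norm (V j \<theta>))\<^sup>2 = (V j \<theta> \<bullet> e)\<^sup>2 * (1 + (Y' (S j \<theta>))\<^sup>2)"
      unfolding norm_orthonormal[OF fr] Vn by (simp add: algebra_simps power_mult_distrib)
    then have "norm (V j \<theta>) = \<bar>V j \<theta> \<bullet> e\<bar> * sqrt (1 + (Y' (S j \<theta>))\<^sup>2)"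
      by (metis norm_ge_zero real_sqrt_abs real_sqrt_mult real_sqrt_unique)
    then show ?thesis
      unfolding h_def F_def point[OF j \<theta>] by simp
  qed
  have inj: "inj_on (S j) (N j)" if j: "j < m" for j
  proof (rule inj_onI)
    fix \<theta> \<phi> assume "\<theta> \<in> N j" "\<phi> \<in> N j" "S j \<theta> = S j \<phi>"
    then show "\<theta> = \<phi>"
      using point[OF j, of \<theta>] point[OF j, of \<phi>] simple[OF j j, of \<theta> \<phi>] by (auto simp: N_def)
  qed
  have disj: "S j ` N j \<inter> S k ` N k = {}" if j: "j < m" and k: "k < m" and "j \<noteq> k" for j k
  proof -
    have False if "\<theta> \<in> N j" "\<phi> \<in> N k" "S j \<theta> = S k \<phi>" for \<theta> \<phi>
      using point[OF j, of \<theta>] point[OF k, of \<phi>] simple[OF j k, of \<theta> \<phi>] that \<open>j \<noteq> k\<close> by (auto simp: N_def)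
    then show ?thesis by blast
  qed
  have cover: "(\<Union>j\<in>{..<m}. S j ` N j) = {-\<delta><..<\<delta>}"
  proof (intro equalityI subsetI)
    fix s assume "s \<in> (\<Union>j\<in>{..<m}. S j ` N j)"
    then show "s \<in> {-\<delta><..<\<delta>}" by (auto simp: N_def Nr_def)
  next
    fix s assume "s \<in> {-\<delta><..<\<delta>}"
    then have s: "\<bar>s\<bar> < \<delta>" by auto
    from graph[OF s] obtain j \<theta> where j: "j < m" and p: "\<gamma> j \<theta> \<tau> = local_point x0 e n s (Y s)"
      and d: "dist x0 (local_point x0 e n s (Y s)) < \<rho>" by blast
    interpret periodic_fun_simple "\<lambda>\<theta>. \<gamma> j \<theta> \<tau>" 1
      by unfold_locales (use periodic[OF j] in auto)
    have fr': "\<gamma> j (frac \<theta>) \<tau> = \<gamma> j \<theta> \<tau>"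
      using minus_of_int[of \<theta> "\<lfloor>\<theta>\<rfloor>"] by (simp add: frac_def)
    then have "S j (frac \<theta>) = s"
      by (simp add: S_def p local_point_inner[OF fr])
    moreover have "frac \<theta> \<in> N j"
      using s d fr' p \<open>S j (frac \<theta>) = s\<close> by (simp add: N_def Nr_def frac_lt_1)
    ultimately show "s \<in> (\<Union>j\<in>{..<m}. S j ` N j)" using j by blast
  qed
  have piece: "(F has_integral integral (N j) (h j)) (S j ` N j)"
    and split: "\<bar>integral {0..1} (h j) - integral (N j) (h j)\<bar> \<le> B" if j: "j < m" for j
  proof -
    have ai1: "h j absolutely_integrable_on {0..1}"
      using cont[OF j] unfolding h_def by (intro absolutely_integrable_continuous_real)
    have sub: "N j \<subseteq> {0..1}" by (auto simp: N_def)
    have ai: "h j absolutely_integrable_on N j"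
      by (rule set_integrable_subset[OF ai1 measN[OF j] sub])
    have eq: "h j \<theta> = \<bar>V j \<theta> \<bullet> e\<bar> * F (S j \<theta>)" if "\<theta> \<in> N j" for \<theta>
      using speed[OF j] that by (simp add: N_def)
    have "(\<lambda>\<theta>. \<bar>V j \<theta> \<bullet> e\<bar> * F (S j \<theta>)) absolutely_integrable_on N j"
      using ai by (rule absolutely_integrable_spike[OF _ negligible_empty]) (use eq in auto)
    moreover have "integral (N j) (\<lambda>\<theta>. \<bar>V j \<theta> \<bullet> e\<bar> * F (S j \<theta>)) = integral (N j) (h j)"
      by (rule integral_cong) (use eq in auto)
    ultimately have "F absolutely_integrable_on S j ` N j \<and> integral (S j ` N j) F = integral (N j) (h j)"
      using has_absolute_integral_change_of_variables_1'[OF measN[OF j] _ inj[OF j],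
          of "\<lambda>\<theta>. V j \<theta> \<bullet> e" F "integral (N j) (h j)"] dS[OF j]
      by (auto intro: has_field_derivative_at_within)
    then show "(F has_integral integral (N j) (h j)) (S j ` N j)"
      by (simp add: has_integral_iff set_lebesgue_integral_eq_integral(1))
    have "(h j has_integral integral {0..1} (h j)) {0..1}"
      using ai1 by (simp add: has_integral_iff set_lebesgue_integral_eq_integral(1))
    moreover have "((\<lambda>\<theta>. if \<theta> \<in> N j then h j \<theta> else 0) has_integral integral (N j) (h j)) {0..1}"
      unfolding has_integral_restrict[OF sub]
      using ai by (simp add: has_integral_iff set_lebesgue_integral_eq_integral(1))
    ultimately have "((\<lambda>\<theta>. h j \<theta> - (if \<theta> \<in> N j then h j \<theta> else 0)) has_integral
        (integral {0..1} (h j) - integral (N j) (h j))) (cbox 0 1)"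
      by (simp add: has_integral_diff)
    then have "norm (integral {0..1} (h j) - integral (N j) (h j)) \<le> B * measure lborel (cbox 0 (1::real))"
    (* The parameter 1 repeats the point with parameter 0 and lies outside N j, even if that point
       is near; the bound may fail there. *)
    proof (rule has_integral_bound_spike_finite[OF B, of "{1}", rotated])
      fix \<theta> :: real assume "\<theta> \<in> cbox 0 1 - {1}"
      then have "\<theta> \<in> N j \<or> \<theta> \<notin> Nr j" by (auto simp: N_def)
      then show "norm (h j \<theta> - (if \<theta> \<in> N j then h j \<theta> else 0)) \<le> B"
        using far[OF j, of \<theta>] B by (auto simp: Nr_def N_def S_def h_def)
    qed simp
    then show "\<bar>integral {0..1} (h j) - integral (N j) (h j)\<bar> \<le> B" by simp
  qed
  have "(F has_integral (\<Sum>j<m. integral (N j) (h j))) (\<Union>j\<in>{..<m}. S j ` N j)"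
    by (rule has_integral_UN) (use piece disj in \<open>auto simp: pairwise_def\<close>)
  then have "(F has_integral (\<Sum>j<m. integral (N j) (h j))) {-\<delta><..<\<delta>}"
    unfolding cover .
  moreover have "boundary_integral m \<gamma> \<tau> f = (\<Sum>j<m. integral {0..1} (h j))"
    unfolding boundary_integral_def h_def curve_velocity_def
    by (intro sum.cong refl) (simp add: vector_derivative_at[OF vel])
  then have "\<bar>boundary_integral m \<gamma> \<tau> f - (\<Sum>j<m. integral (N j) (h j))\<bar>
      = \<bar>\<Sum>j<m. integral {0..1} (h j) - integral (N j) (h j)\<bar>"
    by (simp add: sum_subtractf)
  then have "\<bar>boundary_integral m \<gamma> \<tau> f - (\<Sum>j<m. integral (N j) (h j))\<bar> \<le> real m * B"
    using sum_norm_bound[of "{..<m}" "\<lambda>j. integral {0..1} (h j) - integral (N j) (h j)" B] split by simp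
  ultimately show thesis using that unfolding F_def by blast
qed

section \<open>The potential at a fixed time and its integral over time\<close>

lemma boundary_curve_regularity:
  assumes db: "differentiable_bounded 4 M (UNIV \<times> {0..T}) (\<lambda>(\<theta>, \<tau>). \<gamma> j \<theta> \<tau>)"
  shows "\<tau> \<in> {0..T} \<Longrightarrow> ((\<lambda>\<theta>. \<gamma> j \<theta> \<tau>) has_vector_derivative curve_velocity \<gamma> j \<theta> \<tau>) (at \<theta>)"
    and "\<tau> \<in> {0..T} \<Longrightarrow> norm (curve_velocity \<gamma> j \<theta> \<tau>) \<le> M"
    and "continuous_on (UNIV \<times> {0..T}) (\<lambda>(\<theta>, \<tau>). \<gamma> j \<theta> \<tau>)"
    and "continuous_on (UNIV \<times> {0..T}) (\<lambda>(\<theta>, \<tau>). curve_velocity \<gamma> j \<theta> \<tau>)"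
proof -
  obtain V where b: "differentiable_bounded 3 M (UNIV \<times> {0..T}) (\<lambda>(\<theta>, \<tau>). V \<theta> \<tau>)"
    and d: "\<And>\<theta> \<tau>. \<theta> \<in> UNIV \<Longrightarrow> \<tau> \<in> {0..T} \<Longrightarrow> ((\<lambda>\<theta>. \<gamma> j \<theta> \<tau>) has_vector_derivative V \<theta> \<tau>) (at \<theta>)"
    by (rule differentiable_bounded_SucE[OF db[unfolded numerals_as_Suc(1)]]) blast
  have V: "curve_velocity \<gamma> j \<theta> \<tau> = V \<theta> \<tau>" if "\<tau> \<in> {0..T}" for \<theta> \<tau>
    unfolding curve_velocity_def using d[OF _ that] by (intro vector_derivative_at) auto
  show "((\<lambda>\<theta>. \<gamma> j \<theta> \<tau>) has_vector_derivative curve_velocity \<gamma> j \<theta> \<tau>) (at \<theta>)" if "\<tau> \<in> {0..T}"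
    using d that by (simp add: V)
  show "norm (curve_velocity \<gamma> j \<theta> \<tau>) \<le> M" if "\<tau> \<in> {0..T}"
    using differentiable_bounded_norm_le[OF b, of "(\<theta>, \<tau>)"] that by (simp add: V)
  show "continuous_on (UNIV \<times> {0..T}) (\<lambda>(\<theta>, \<tau>). \<gamma> j \<theta> \<tau>)"
    by (rule differentiable_bounded_continuous_on[OF db[unfolded numerals_as_Suc(1)]])
  have "continuous_on (UNIV \<times> {0..T}) (\<lambda>(\<theta>, \<tau>). V \<theta> \<tau>)"
    by (rule differentiable_bounded_continuous_on[OF b[unfolded numerals_as_Suc(2)]])
  then show "continuous_on (UNIV \<times> {0..T}) (\<lambda>(\<theta>, \<tau>). curve_velocity \<gamma> j \<theta> \<tau>)"
    by (rule continuous_on_cong[THEN iffD1, rotated -1]) (auto simp: V)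
qed

lemma exp_neg_le_inverse_square:
  fixes z :: real
  assumes "0 < z"
  shows "exp (- z) \<le> 2 / z\<^sup>2"
  using power_le_fact_mult_exp[of z 2] assms by (simp add: exp_minus field_simps)

text \<open>
  The factor \<open>1 / u\<^sup>2\<close> is compensated by the exponential, with the distance \<open>d\<close> bounded away from 0.
\<close>
lemma far_kernel_bound:
  fixes d u \<delta> :: real
  assumes u: "0 < u" and \<delta>: "0 < \<delta>" and d: "\<delta> / 2 \<le> d"
  shows "d / (8 * pi * u\<^sup>2) * exp (- d\<^sup>2 / (4 * u)) \<le> 32 / \<delta> ^ 3"
proof -
  have d0: "0 < d" using \<delta> d by linarith
  have "exp (- d\<^sup>2 / (4 * u)) \<le> 2 / (d\<^sup>2 / (4 * u))\<^sup>2"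
    using exp_neg_le_inverse_square[of "d\<^sup>2 / (4 * u)"] d0 u by simp
  then have "d / (8 * pi * u\<^sup>2) * exp (- d\<^sup>2 / (4 * u)) \<le> d / (8 * pi * u\<^sup>2) * (2 / (d\<^sup>2 / (4 * u))\<^sup>2)"
    using d0 u by (intro mult_left_mono) auto
  also have "\<dots> = 4 / (pi * d ^ 3)"
    using d0 u by (simp add: field_simps eval_nat_numeral)
  also have "\<dots> \<le> 4 / (1 * (\<delta> / 2) ^ 3)"
    using d \<delta> pi_gt3 by (intro divide_left_mono mult_mono power_mono) auto
  also have "\<dots> = 32 / \<delta> ^ 3" by (simp add: power_divide)
  finally show ?thesis .
qed

abbreviation (input) layer_density where
  "layer_density \<nu> \<mu> x t \<tau> p \<equiv> directional_deriv (\<lambda>q. heat_kernel (x - q) (t - \<tau>)) p (\<nu> \<tau> p) * \<mu> p \<tau>"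

lemma continuous_on_layer_density:
  assumes dom: "moving_domain T M \<Omega> m \<gamma> \<nu>" and j: "j < m"
    and \<mu>: "differentiable_bounded 4 M (UNIV \<times> {0..T}) (\<lambda>(\<theta>, \<tau>). \<mu> (\<gamma> j \<theta> \<tau>) \<tau>)"
    and t: "t \<le> T"
  shows "continuous_on ({0..<t} \<times> UNIV) (\<lambda>(\<tau>, \<theta>). layer_density \<nu> \<mu> x t \<tau> (\<gamma> j \<theta> \<tau>) * norm (curve_velocity \<gamma> j \<theta> \<tau>))"
proof -
  have db: "differentiable_bounded 4 M (UNIV \<times> {0..T}) (\<lambda>(\<theta>, \<tau>). \<gamma> j \<theta> \<tau>)"
    and \<nu>: "continuous_on (UNIV \<times> {0..T}) (\<lambda>(\<theta>, \<tau>). \<nu> \<tau> (\<gamma> j \<theta> \<tau>))"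
    using conjunct2[OF dom[unfolded moving_domain_def]] j by blast+
  have swap: "continuous_on ({0..<t} \<times> UNIV) (\<lambda>z. g (snd z) (fst z))"
    if "continuous_on (UNIV \<times> {0..T}) (\<lambda>(\<theta>, \<tau>). g \<theta> \<tau>)" for g :: "real \<Rightarrow> real \<Rightarrow> 'z::topological_space"
  proof -
    have "continuous_on ({0..<t} \<times> UNIV) (\<lambda>z. (\<lambda>(\<theta>, \<tau>). g \<theta> \<tau>) (snd z, fst z))"
      by (rule continuous_on_compose2[OF that]) (use t in \<open>auto intro!: continuous_intros\<close>)
    then show ?thesis by simp
  qed
  have cm: "continuous_on (UNIV \<times> {0..T}) (\<lambda>(\<theta>, \<tau>). \<mu> (\<gamma> j \<theta> \<tau>) \<tau>)"
    by (rule differentiable_bounded_continuous_on[OF \<mu>[unfolded numerals_as_Suc(1)]])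
  note [continuous_intros] = swap[OF boundary_curve_regularity(3)[where \<gamma> = \<gamma> and j = j, OF db]]
    swap[OF boundary_curve_regularity(4)[where \<gamma> = \<gamma> and j = j, OF db]]
    swap[OF \<nu>] swap[OF cm]
  have "continuous_on ({0..<t} \<times> UNIV) (\<lambda>z.
      ((x - \<gamma> j (snd z) (fst z)) \<bullet> \<nu> (fst z) (\<gamma> j (snd z) (fst z)) / (8 * pi * (t - fst z)\<^sup>2)
        * exp (- (norm (x - \<gamma> j (snd z) (fst z)))\<^sup>2 / (4 * (t - fst z)))
        * \<mu> (\<gamma> j (snd z) (fst z)) (fst z)) * norm (curve_velocity \<gamma> j (snd z) (fst z)))"
    by (intro continuous_intros) auto
  then show ?thesis
    by (rule continuous_on_cong[THEN iffD1, rotated -1])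
      (auto simp: directional_deriv_heat_kernel)
qed

text \<open>
  The choice of \<open>\<delta>\<close> keeps the graph over \<open>\<bar>s\<bar> < \<delta>\<close> inside the ball of radius \<open>\<rho>\<close>, where the domain is
  known to lie above it, which fixes the direction of the normal. Boundary points outside this
  piece are at distance at least \<open>\<delta>\<close> from \<open>x0\<close>, hence at least \<open>\<delta> / 2\<close> from the target.
\<close>
lemma boundary_integral_estimate:
  fixes M T L \<rho> \<delta> r t \<tau> :: real and \<Omega> :: "real \<Rightarrow> (real ^ 2) set" and \<gamma> :: "nat \<Rightarrow> real \<Rightarrow> real \<Rightarrow> real ^ 2"
    and \<nu> :: "real \<Rightarrow> real ^ 2 \<Rightarrow> real ^ 2" and \<mu> :: "real ^ 2 \<Rightarrow> real \<Rightarrow> real"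
    and x0 e n :: "real ^ 2" and y :: "real \<Rightarrow> real \<Rightarrow> real"
  defines "K \<equiv> 3 * M + 1"
  assumes dom: "moving_domain T M \<Omega> m \<gamma> \<nu>"
    and \<mu>_curve: "\<And>j. j < m \<Longrightarrow> differentiable_bounded 4 M (UNIV \<times> {0..T}) (\<lambda>(\<theta>, \<tau>). \<mu> (\<gamma> j \<theta> \<tau>) \<tau>)"
    and graph: "local_graph L \<rho> M \<Omega> x0 e n y t"
    and \<mu>_graph: "differentiable_bounded 4 M ({-L<..<L} \<times> {0..t}) (\<lambda>(s, \<tau>). \<mu> (local_point x0 e n s (y s \<tau>)) \<tau>)"
    and t: "0 < t" "t \<le> 1" "t \<le> T" and L: "0 < L"
    and \<delta>: "0 < \<delta>" "\<delta> \<le> 1" "\<delta> \<le> L" "4 * (M + 1) * \<delta> \<le> \<rho>" "t \<le> \<delta>"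
    and r: "\<bar>r\<bar> * (2 * K / \<delta>\<^sup>2) \<le> 1 / 16"
    and \<tau>: "\<tau> \<in> {0..<t}"
  shows "\<bar>boundary_integral m \<gamma> \<tau> (layer_density \<nu> \<mu> (x0 + r *\<^sub>R n) t \<tau>)
      - leading_integral r (graph_curvature y t) (graph_velocity y t) (\<mu> x0 t) (t - \<tau>)\<bar>
    \<le> 6 * expansion_const (2 * K / \<delta>\<^sup>2) + real m * (32 / \<delta> ^ 3 * M\<^sup>2)"
proof -
  define u where "u = t - \<tau>"
  have u: "0 < u" "u \<le> 1" "u \<le> \<delta>" using \<tau> t \<delta> by (auto simp: u_def)
  have \<tau>': "\<tau> \<in> {0..t}" "\<tau> \<in> {0..T}" "t - \<tau> = u" using \<tau> t by (auto simp: u_def)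
  define x where "x = x0 + r *\<^sub>R n"
  define f where "f = layer_density \<nu> \<mu> x t \<tau>"
  define Y where "Y s = y s \<tau>" for s
  define q where "q s = \<mu> (local_point x0 e n s (Y s)) \<tau>" for s
  from graph have fr: "norm e = 1" "norm n = 1" "e \<bullet> n = 0"
    and db: "differentiable_bounded 4 M ({-L<..<L} \<times> {0..t}) (\<lambda>(s, \<tau>). y s \<tau>)"
    and y0: "y 0 t = 0" "deriv (\<lambda>s. y s t) 0 = 0"
    and on: "\<And>s. \<bar>s\<bar> < L \<Longrightarrow> local_point x0 e n s (Y s) \<in> frontier (\<Omega> \<tau>)"
    and all: "\<And>p. p \<in> frontier (\<Omega> \<tau>) \<Longrightarrow> (\<exists>s. \<bar>s\<bar> < L \<and> p = local_point x0 e n s (Y s)) \<or> \<rho> \<le> dist x0 p"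
    and above: "\<And>s w. \<bar>s\<bar> < L \<Longrightarrow> s\<^sup>2 + w\<^sup>2 < \<rho>\<^sup>2 \<Longrightarrow> local_point x0 e n s w \<in> \<Omega> \<tau> \<longleftrightarrow> Y s < w"
    unfolding local_graph_def Y_def using \<tau>'(1) by auto
  have curve: "\<And>j. j < m \<Longrightarrow> differentiable_bounded 4 M (UNIV \<times> {0..T}) (\<lambda>(\<theta>, \<tau>). \<gamma> j \<theta> \<tau>)"
    using conjunct2[OF dom[unfolded moving_domain_def]] by blast
  note at_\<tau> = bspec[OF conjunct1[OF dom[unfolded moving_domain_def]] \<tau>'(2)]
  from at_\<tau> have front: "frontier (\<Omega> \<tau>) = (\<Union>j<m. range (\<lambda>\<theta>. \<gamma> j \<theta> \<tau>))"
    and periodic: "\<And>j \<theta>. j < m \<Longrightarrow> \<gamma> j (\<theta> + 1) \<tau> = \<gamma> j \<theta> \<tau>"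
    and simple: "\<And>j k \<theta> \<phi>. j < m \<Longrightarrow> k < m \<Longrightarrow> \<theta> \<in> {0..<1} \<Longrightarrow> \<phi> \<in> {0..<1} \<Longrightarrow>
        \<gamma> j \<theta> \<tau> = \<gamma> k \<phi> \<tau> \<Longrightarrow> j = k \<and> \<theta> = \<phi>"
    and regular: "\<And>j \<theta>. j < m \<Longrightarrow> curve_velocity \<gamma> j \<theta> \<tau> \<noteq> 0"
    and normal: "\<And>j \<theta>. j < m \<Longrightarrow>
        outward_unit_normal (\<Omega> \<tau>) (\<gamma> j \<theta> \<tau>) (curve_velocity \<gamma> j \<theta> \<tau>) (\<nu> \<tau> (\<gamma> j \<theta> \<tau>))"
    by blast+
  have vel: "((\<lambda>\<theta>. \<gamma> j \<theta> \<tau>) has_vector_derivative curve_velocity \<gamma> j \<theta> \<tau>) (at \<theta>)" if "j < m" for j \<theta>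
    using boundary_curve_regularity(1)[where \<gamma> = \<gamma> and j = j, OF curve[OF that] \<tau>'(2)] .
  obtain y1 where y1: "\<And>s \<tau>. \<bar>s\<bar> < L \<Longrightarrow> \<tau> \<in> {0..t} \<Longrightarrow> ((\<lambda>s. y s \<tau>) has_real_derivative y1 s \<tau>) (at s)"
    and \<kappa>v: "\<bar>graph_curvature y t\<bar> \<le> M" "\<bar>graph_velocity y t\<bar> \<le> M"
    and yb: "\<And>s \<tau>. \<bar>s\<bar> < L \<Longrightarrow> \<tau> \<in> {0..t} \<Longrightarrow> \<bar>y s \<tau>\<bar> \<le> M * (\<bar>s\<bar> + (t - \<tau>))"
    "\<And>s \<tau>. \<bar>s\<bar> < L \<Longrightarrow> \<tau> \<in> {0..t} \<Longrightarrow> \<bar>y s \<tau>\<bar> \<le> M * (sqrt (t - \<tau>) + \<bar>s\<bar>)\<^sup>2"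
    "\<And>s \<tau>. \<bar>s\<bar> < L \<Longrightarrow> \<tau> \<in> {0..t} \<Longrightarrow>
       \<bar>y s \<tau> - (graph_curvature y t * s\<^sup>2 / 2 - graph_velocity y t * (t - \<tau>))\<bar>
         \<le> 2 * M * (sqrt (t - \<tau>) + \<bar>s\<bar>) ^ 3"
    "\<And>s \<tau>. \<bar>s\<bar> < L \<Longrightarrow> \<tau> \<in> {0..t} \<Longrightarrow>
       \<bar>(y s \<tau> - s * y1 s \<tau>) + (graph_curvature y t * s\<^sup>2 / 2 + graph_velocity y t * (t - \<tau>))\<bar>
         \<le> 3 * M * (sqrt (t - \<tau>) + \<bar>s\<bar>) ^ 3"
    by (rule graph_expansion[OF L t(1,2) db y0]) blast
  define Y' where "Y' s = y1 s \<tau>" for s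
  have dY: "(Y has_real_derivative Y' s) (at s)" if "\<bar>s\<bar> < L" for s
    using y1[OF that \<tau>'(1)] by (simp add: Y_def[abs_def] Y'_def)
  have origin: "local_point x0 e n 0 (y 0 t) = x0" by (simp add: local_point_def y0(1))
  obtain q1 where \<mu>0: "\<bar>\<mu> x0 t\<bar> \<le> M" "\<bar>q1\<bar> \<le> M"
    and qb: "\<And>s. \<bar>s\<bar> < L \<Longrightarrow> \<bar>q s - \<mu> x0 t - q1 * s\<bar> \<le> M * (sqrt u + \<bar>s\<bar>)\<^sup>2"
    using density_expansion[OF L t(1) \<mu>_graph, of thesis] \<tau>' unfolding q_def Y_def origin by auto
  have M: "0 \<le> M" using \<mu>0 by linarith
  have K: "1 \<le> K" "M \<le> K" "2 * M \<le> K" "3 * M \<le> K" using M by (auto simp: K_def)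
  have \<delta>\<rho>: "4 * \<delta> \<le> \<rho>" "M * (2 * \<delta>) \<le> \<rho> / 2"
    using \<delta>(1,4) M by (auto simp: algebra_simps intro: order_trans[rotated])
  have r\<delta>: "\<bar>r\<bar> \<le> \<delta> / 2"
  proof -
    have "\<bar>r\<bar> * 2 \<le> \<bar>r\<bar> * (2 * K)" using K(1) by (intro mult_left_mono) auto
    also have "\<dots> \<le> \<delta>\<^sup>2 / 16" using r \<delta> by (simp add: field_simps)
    also have "\<dots> \<le> \<delta>" using mult_right_mono[of \<delta> 16 \<delta>] \<delta>(1,2) by (simp add: power2_eq_square)
    finally show ?thesis by simp
  qed
  have near_origin: "s\<^sup>2 + (Y s)\<^sup>2 < \<rho>\<^sup>2" if s: "\<bar>s\<bar> < \<delta>" for s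
  proof -
    have "\<bar>Y s\<bar> \<le> M * (\<bar>s\<bar> + u)" using yb(1)[of s \<tau>] s \<delta> \<tau>' by (simp add: Y_def)
    also have "\<dots> \<le> M * (2 * \<delta>)" using s u M by (intro mult_left_mono) auto
    finally have "\<bar>Y s\<bar> \<le> \<rho> / 2" using \<delta>\<rho> by linarith
    then have "(\<bar>s\<bar> + \<bar>Y s\<bar>)\<^sup>2 < \<rho>\<^sup>2"
      using s \<delta>\<rho> \<delta> by (intro power_strict_mono) auto
    moreover have "s\<^sup>2 + (Y s)\<^sup>2 \<le> (\<bar>s\<bar> + \<bar>Y s\<bar>)\<^sup>2" by (simp add: power2_sum)
    ultimately show ?thesis by linarith
  qed
  have \<rho>: "0 < \<rho>" using \<delta>\<rho> \<delta> by linarith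
  have dist_graph: "dist x0 (local_point x0 e n s (Y s)) < \<rho>" if s: "\<bar>s\<bar> < \<delta>" for s
    using near_origin[OF s] \<rho> unfolding dist_local_point[OF fr]
    by (metis abs_of_pos real_sqrt_abs real_sqrt_less_iff)
  have near: "(p - x0) \<bullet> n = Y ((p - x0) \<bullet> e)"
    if "p \<in> frontier (\<Omega> \<tau>)" "\<bar>(p - x0) \<bullet> e\<bar> < \<delta>" "dist x0 p < \<rho>" for p
    using all[OF that(1)] that(3) by (auto simp: local_point_inner[OF fr])
  have in_front: "\<gamma> j \<theta> \<tau> \<in> frontier (\<Omega> \<tau>)" if "j < m" for j \<theta>
    using that front by blast
  have nearj: "(\<gamma> j \<theta> \<tau> - x0) \<bullet> n = Y ((\<gamma> j \<theta> \<tau> - x0) \<bullet> e)"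
    if "j < m" "\<bar>(\<gamma> j \<theta> \<tau> - x0) \<bullet> e\<bar> < \<delta>" "dist x0 (\<gamma> j \<theta> \<tau>) < \<rho>" for j \<theta>
    using near[OF in_front] that by blast
  have curve_cont: "continuous_on UNIV (\<lambda>\<theta>. \<gamma> j \<theta> \<tau>)" if "j < m" for j
    using has_vector_derivative_continuous[OF vel[OF that]]
    unfolding continuous_on_eq_continuous_at[OF open_UNIV] by blast
  have normal_graph: "sqrt (1 + (Y' s)\<^sup>2) *\<^sub>R \<nu> \<tau> (local_point x0 e n s (Y s)) = Y' s *\<^sub>R e - n"
    if s: "\<bar>s\<bar> < \<delta>" for s
  proof -
    have sL: "\<bar>s\<bar> < L" using s \<delta> by simp
    obtain j \<theta> where j: "j < m" and p: "\<gamma> j \<theta> \<tau> = local_point x0 e n s (Y s)"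
      using on[OF sL] front by auto
    define V where "V = curve_velocity \<gamma> j \<theta> \<tau>"
    have se: "(\<gamma> j \<theta> \<tau> - x0) \<bullet> e = s" unfolding p by (rule local_point_inner[OF fr])
    have "\<forall>\<^sub>F \<phi> in nhds \<theta>. \<phi> \<in> {\<phi>. \<bar>(\<gamma> j \<phi> \<tau> - x0) \<bullet> e\<bar> < \<delta> \<and> dist x0 (\<gamma> j \<phi> \<tau>) < \<rho>}"
      by (intro eventually_nhds_in_open open_Collect_conj open_Collect_less continuous_intros curve_cont j)
        (use s dist_graph[OF s] se p in auto)
    then have "\<forall>\<^sub>F \<phi> in nhds \<theta>. (\<gamma> j \<phi> \<tau> - x0) \<bullet> n = Y ((\<gamma> j \<phi> \<tau> - x0) \<bullet> e)"
      by eventually_elim (use nearj[OF j] in auto)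
    then have Vn: "V \<bullet> n = Y' s * (V \<bullet> e)"
      unfolding V_def using dY[OF sL] se by (intro tangent_of_graph[OF vel[OF j]]) auto
    have Ve: "V = (V \<bullet> e) *\<^sub>R (e + Y' s *\<^sub>R n)"
      using orthonormal_expansion[OF fr, of V] unfolding Vn by (simp add: algebra_simps)
    then have a0: "V \<bullet> e \<noteq> 0"
      using regular[OF j, of \<theta>] unfolding V_def by (metis scaleR_zero_left)
    have ab: "\<forall>\<^sub>F z in nhds (s, Y s). local_point x0 e n (fst z) (snd z) \<in> \<Omega> \<tau> \<longrightarrow> Y (fst z) < snd z"
    proof -
      have "\<forall>\<^sub>F z in nhds (s, Y s). z \<in> {z. \<bar>fst z\<bar> < L \<and> (fst z)\<^sup>2 + (snd z)\<^sup>2 < \<rho>\<^sup>2}"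
        by (intro eventually_nhds_in_open open_Collect_conj open_Collect_less continuous_intros)
          (use sL near_origin[OF s] in auto)
      then show ?thesis by eventually_elim (use above in auto)
    qed
    have "outward_unit_normal (\<Omega> \<tau>) (local_point x0 e n s (Y s)) V (\<nu> \<tau> (local_point x0 e n s (Y s)))"
      using normal[OF j, of \<theta>] by (simp add: V_def p)
    from outward_normal_of_graph[OF fr dY[OF sL] ab Ve a0 this] show ?thesis .
  qed
  have fF: "f (local_point x0 e n s (Y s)) * sqrt (1 + (Y' s)\<^sup>2)
      = layer_integrand r (Y s) (Y s - s * Y' s) (q s) u s" if s: "\<bar>s\<bar> < \<delta>" for s
  proof -
    define p where "p = local_point x0 e n s (Y s)"
    have xp: "x - p = (- s) *\<^sub>R e + (r - Y s) *\<^sub>R n"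
      by (simp add: x_def p_def local_point_def algebra_simps)
    have inn: "e \<bullet> e = 1" "n \<bullet> n = 1" "n \<bullet> e = 0" "e \<bullet> n = 0"
      using fr by (auto simp: norm_eq_1 inner_commute)
    have "(x - p) \<bullet> e = - s" "(x - p) \<bullet> n = r - Y s"
      unfolding xp by (simp_all add: inner_add_left inner_diff_left inn)
    then have sq: "(norm (x - p))\<^sup>2 = s\<^sup>2 + (r - Y s)\<^sup>2"
      using norm_orthonormal[OF fr, of "x - p"] by simp
    have "(x - p) \<bullet> \<nu> \<tau> p * sqrt (1 + (Y' s)\<^sup>2) = (x - p) \<bullet> (sqrt (1 + (Y' s)\<^sup>2) *\<^sub>R \<nu> \<tau> p)"
      by simp
    also have "\<dots> = (x - p) \<bullet> (Y' s *\<^sub>R e - n)"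
      using normal_graph[OF s] by (simp add: p_def)
    also have "\<dots> = Y s - s * Y' s - r"
      using \<open>(x - p) \<bullet> e = - s\<close> \<open>(x - p) \<bullet> n = r - Y s\<close> by (simp add: inner_diff_right)
    finally have flux: "(x - p) \<bullet> \<nu> \<tau> p * sqrt (1 + (Y' s)\<^sup>2) = Y s - s * Y' s - r" .
    have "f p * sqrt (1 + (Y' s)\<^sup>2)
        = 1 / (8 * pi * u\<^sup>2) * ((x - p) \<bullet> \<nu> \<tau> p * sqrt (1 + (Y' s)\<^sup>2))
          * exp (- (norm (x - p))\<^sup>2 / (4 * u)) * q s"
      unfolding f_def \<tau>'(3) directional_deriv_heat_kernel[OF u(1)]
      by (simp add: q_def p_def)
    then show ?thesis
      unfolding flux sq layer_integrand_def by (simp add: p_def)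
  qed
  have far: "\<bar>f (\<gamma> j \<theta> \<tau>) * norm (curve_velocity \<gamma> j \<theta> \<tau>)\<bar> \<le> 32 / \<delta> ^ 3 * M\<^sup>2"
    if j: "j < m" and away: "\<not> (\<bar>(\<gamma> j \<theta> \<tau> - x0) \<bullet> e\<bar> < \<delta> \<and> dist x0 (\<gamma> j \<theta> \<tau>) < \<rho>)" for j \<theta>
  proof -
    define p where "p = \<gamma> j \<theta> \<tau>"
    define d where "d = norm (x - p)"
    have "\<bar>(p - x0) \<bullet> e\<bar> \<le> dist x0 p"
      using Cauchy_Schwarz_ineq2[of "p - x0" e] fr by (simp add: dist_norm norm_minus_commute)
    then have "\<delta> \<le> dist x0 p" using away \<delta>\<rho> \<delta> unfolding p_def by linarith
    moreover have "dist x0 p \<le> d + \<bar>r\<bar>"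
      using dist_triangle[of x0 p x] fr by (simp add: d_def x_def dist_norm norm_minus_commute)
    ultimately have d: "\<delta> / 2 \<le> d" using r\<delta> by linarith
    have "norm (\<nu> \<tau> p) = 1"
      using normal[OF j, of \<theta>] by (simp add: outward_unit_normal_def p_def)
    then have "\<bar>(x - p) \<bullet> \<nu> \<tau> p\<bar> \<le> d"
      using Cauchy_Schwarz_ineq2[of "x - p" "\<nu> \<tau> p"] by (simp add: d_def)
    then have "\<bar>(x - p) \<bullet> \<nu> \<tau> p / (8 * pi * u\<^sup>2) * exp (- d\<^sup>2 / (4 * u))\<bar>
        \<le> d / (8 * pi * u\<^sup>2) * exp (- d\<^sup>2 / (4 * u))"
      using u by (simp add: abs_mult divide_right_mono)
    also have "\<dots> \<le> 32 / \<delta> ^ 3" by (rule far_kernel_bound[OF u(1) \<delta>(1) d])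
    finally have k: "\<bar>(x - p) \<bullet> \<nu> \<tau> p / (8 * pi * u\<^sup>2) * exp (- d\<^sup>2 / (4 * u))\<bar> \<le> 32 / \<delta> ^ 3" .
    have m: "\<bar>\<mu> p \<tau>\<bar> \<le> M"
      using differentiable_bounded_norm_le[OF \<mu>_curve[OF j], of "(\<theta>, \<tau>)"] \<tau>' by (simp add: p_def)
    have V: "norm (curve_velocity \<gamma> j \<theta> \<tau>) \<le> M"
      by (rule boundary_curve_regularity(2)[where \<gamma> = \<gamma> and j = j, OF curve[OF j] \<tau>'(2)])
    have "\<bar>f p * norm (curve_velocity \<gamma> j \<theta> \<tau>)\<bar>
        = \<bar>(x - p) \<bullet> \<nu> \<tau> p / (8 * pi * u\<^sup>2) * exp (- d\<^sup>2 / (4 * u))\<bar> * \<bar>\<mu> p \<tau>\<bar> * norm (curve_velocity \<gamma> j \<theta> \<tau>)"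
      unfolding f_def \<tau>'(3) directional_deriv_heat_kernel[OF u(1)] d_def by (simp add: abs_mult)
    also have "\<dots> \<le> 32 / \<delta> ^ 3 * M * M"
      using k m V M \<delta> by (intro mult_mono) auto
    finally show ?thesis by (simp add: p_def power2_eq_square)
  qed
  have cont: "continuous_on {0..1} (\<lambda>\<theta>. f (\<gamma> j \<theta> \<tau>) * norm (curve_velocity \<gamma> j \<theta> \<tau>))" if j: "j < m" for j
  proof -
    have "continuous_on {0..1} (\<lambda>\<theta>. (\<lambda>(\<tau>, \<theta>). layer_density \<nu> \<mu> x t \<tau> (\<gamma> j \<theta> \<tau>) * norm (curve_velocity \<gamma> j \<theta> \<tau>)) (\<tau>, \<theta>))"
      by (rule continuous_on_compose2[OF continuous_on_layer_density[OF dom j \<mu>_curve[OF j] t(3), of x]])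
        (use \<tau> in \<open>auto intro!: continuous_intros\<close>)
    then show ?thesis by (simp add: f_def)
  qed
  obtain I where I: "((\<lambda>s. f (local_point x0 e n s (Y s)) * sqrt (1 + (Y' s)\<^sup>2)) has_integral I) {-\<delta><..<\<delta>}"
    and split: "\<bar>boundary_integral m \<gamma> \<tau> f - I\<bar> \<le> real m * (32 / \<delta> ^ 3 * M\<^sup>2)"
  proof (rule boundary_integral_near_far[where \<gamma> = \<gamma> and V = "\<lambda>j \<theta>. curve_velocity \<gamma> j \<theta> \<tau>",
        OF vel periodic simple cont fr dY nearj _ far])
    show "dist x0 (local_point x0 e n s (Y s)) < \<rho> \<and> (\<exists>j<m. \<exists>\<theta>. \<gamma> j \<theta> \<tau> = local_point x0 e n s (Y s))"
      if s: "\<bar>s\<bar> < \<delta>" for s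
    proof -
      obtain j \<theta> where "j < m" "\<gamma> j \<theta> \<tau> = local_point x0 e n s (Y s)"
        using on[of s] s \<delta> front by auto
      then show ?thesis using dist_graph[OF s] by blast
    qed
    show "0 \<le> 32 / \<delta> ^ 3 * M\<^sup>2" using \<delta> by simp
  qed (use \<delta> in auto)
  have "\<bar>I - leading_integral r (graph_curvature y t) (graph_velocity y t) (\<mu> x0 t) u\<bar>
      \<le> 6 * expansion_const (2 * K / \<delta>\<^sup>2)"
  proof (rule layer_integral_estimate[OF u(1,2) K(1) _ _ _ _ \<delta>(1,2) r _ _ _ _ I fF])
    show "\<bar>graph_curvature y t\<bar> \<le> K" "\<bar>graph_velocity y t\<bar> \<le> K" "\<bar>\<mu> x0 t\<bar> \<le> K" "\<bar>q1\<bar> \<le> K"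
      using \<kappa>v \<mu>0 K by linarith+
    fix s assume s: "\<bar>s\<bar> < \<delta>"
    then have sL: "\<bar>s\<bar> < L" using \<delta> by simp
    define h where "h = sqrt u + \<bar>s\<bar>"
    have h: "0 \<le> h" using u by (simp add: h_def)
    note b = yb(2-4)[OF sL \<tau>'(1), folded Y_def Y'_def, unfolded \<tau>'(3), folded h_def]
    have up: "c * h ^ k \<le> K * h ^ k" if "c \<le> K" for c k
      using that h by (intro mult_right_mono) auto
    show "\<bar>Y s - (graph_curvature y t * s\<^sup>2 / 2 - graph_velocity y t * u)\<bar> \<le> K * (sqrt u + \<bar>s\<bar>) ^ 3"
      using b(2) up[OF K(3), of 3] unfolding h_def[symmetric] by linarith
    show "\<bar>Y s\<bar> \<le> K * (sqrt u + \<bar>s\<bar>)\<^sup>2"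
      using b(1) up[OF K(2), of 2] unfolding h_def[symmetric] by linarith
    show "\<bar>Y s - s * Y' s + (graph_curvature y t * s\<^sup>2 / 2 + graph_velocity y t * u)\<bar> \<le> K * (sqrt u + \<bar>s\<bar>) ^ 3"
      using b(3) up[OF K(4), of 3] unfolding h_def[symmetric] by linarith
    show "\<bar>q s - \<mu> x0 t - q1 * s\<bar> \<le> K * (sqrt u + \<bar>s\<bar>)\<^sup>2"
      using qb[OF sL] up[OF K(2), of 2] unfolding h_def[symmetric] by linarith
  qed
  with split show ?thesis
    unfolding f_def x_def \<tau>'(3) by linarith
qed


lemma continuous_on_boundary_integral:
  assumes dom: "moving_domain T M \<Omega> m \<gamma> \<nu>"
    and \<mu>: "\<And>j. j < m \<Longrightarrow> differentiable_bounded 4 M (UNIV \<times> {0..T}) (\<lambda>(\<theta>, \<tau>). \<mu> (\<gamma> j \<theta> \<tau>) \<tau>)"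
    and t: "t \<le> T"
  shows "continuous_on {0..<t} (\<lambda>\<tau>. boundary_integral m \<gamma> \<tau> (layer_density \<nu> \<mu> x t \<tau>))"
  unfolding boundary_integral_def
proof (rule continuous_on_sum)
  fix j assume "j \<in> {..<m}"
  then have j: "j < m" by simp
  have "continuous_on ({0..<t} \<times> cbox 0 1)
      (\<lambda>(\<tau>, \<theta>). layer_density \<nu> \<mu> x t \<tau> (\<gamma> j \<theta> \<tau>) * norm (curve_velocity \<gamma> j \<theta> \<tau>))"
    by (rule continuous_on_subset[OF continuous_on_layer_density[OF dom j \<mu>[OF j] t]]) auto
  from integral_continuous_on_param[OF this]
  show "continuous_on {0..<t} (\<lambda>\<tau>. integral {0..1}
      (\<lambda>\<theta>. layer_density \<nu> \<mu> x t \<tau> (\<gamma> j \<theta> \<tau>) * norm (curve_velocity \<gamma> j \<theta> \<tau>)))"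
    by simp
qed

text \<open>
  Integrability of \<open>f\<close> over \<open>{0..t}\<close> is part of what has to be shown: \<open>f\<close> may be singular at \<open>t\<close>, like
  \<open>g\<close>, but \<open>f - g\<close> is continuous and bounded on the half-open interval.
\<close>
lemma time_integral_close:
  fixes f g :: "real \<Rightarrow> real"
  assumes t: "0 < t"
    and cont: "continuous_on {0..<t} f" "continuous_on {0..<t} g"
    and g: "(g has_integral I) {0..<t}"
    and close: "\<And>\<tau>. \<tau> \<in> {0..<t} \<Longrightarrow> \<bar>f \<tau> - g \<tau>\<bar> \<le> C"
  shows "\<bar>integral {0..t} f - I\<bar> \<le> C * t"
proof -
  have endpoint: "(h has_integral J) {0..t} \<longleftrightarrow> (h has_integral J) {0..<t}" for h :: "real \<Rightarrow> real" and J
    by (rule has_integral_spike_set_eq) (auto intro: negligible_subset[of "{t}"])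
  have C: "((\<lambda>_. C) has_integral C * t) {0..<t}"
  proof -
    have "((\<lambda>_. C) has_integral C * t) {0..t}"
      using has_integral_const_real[of C 0 t] t by (simp add: mult.commute)
    then show ?thesis by (simp only: endpoint)
  qed
  have "(\<lambda>\<tau>. f \<tau> - g \<tau>) absolutely_integrable_on {0..<t}"
  proof (rule measurable_bounded_by_integrable_imp_absolutely_integrable)
    show "(\<lambda>\<tau>. f \<tau> - g \<tau>) \<in> borel_measurable (lebesgue_on {0..<t})"
      by (intro continuous_imp_measurable_on_sets_lebesgue continuous_intros cont) auto
  qed (use C close in \<open>auto simp: has_integral_integrable\<close>)
  then have int: "((\<lambda>\<tau>. f \<tau> - g \<tau>) has_integral integral {0..<t} (\<lambda>\<tau>. f \<tau> - g \<tau>)) {0..<t}"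
    by (simp add: has_integral_iff set_lebesgue_integral_eq_integral(1))
  have "((\<lambda>\<tau>. (f \<tau> - g \<tau>) + g \<tau>) has_integral integral {0..<t} (\<lambda>\<tau>. f \<tau> - g \<tau>) + I) {0..<t}"
    by (rule has_integral_add[OF int g])
  then have "(f has_integral integral {0..<t} (\<lambda>\<tau>. f \<tau> - g \<tau>) + I) {0..<t}" by simp
  then have "(f has_integral integral {0..<t} (\<lambda>\<tau>. f \<tau> - g \<tau>) + I) {0..t}"
    by (simp only: endpoint)
  then have "integral {0..t} f - I = integral {0..<t} (\<lambda>\<tau>. f \<tau> - g \<tau>)"
    by (simp add: integral_unique)
  moreover have "norm (integral {0..<t} (\<lambda>\<tau>. f \<tau> - g \<tau>)) \<le> (C * t) \<bullet> 1"
    by (rule has_integral_norm_bound_integral_component[OF int C]) (use close in auto)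
  ultimately show ?thesis by simp
qed

lemma continuous_on_leading_integral:
  "continuous_on {0..<t} (\<lambda>\<tau>. leading_integral r \<kappa> v \<mu>0 (t - \<tau>))"
  unfolding leading_integral_def by (intro continuous_intros) auto

text \<open>
  By \<open>boundary_integral_estimate\<close> the boundary integral is within a constant of the leading term at
  all times \<open>\<tau> < \<Delta>t\<close>, for all sufficiently small \<open>\<Delta>t\<close>. The constant depends on \<open>M\<close>, \<open>L\<close>, \<open>\<rho>\<close> and \<open>m\<close>
  only; \<open>c\<close> only enters in how small \<open>\<Delta>t\<close> has to be.
\<close>
theorem lemma2:
  fixes c T L \<rho> M :: real
    and \<Omega> :: "real \<Rightarrow> (real ^ 2) set"
    and m :: nat
    and \<gamma> :: "nat \<Rightarrow> real \<Rightarrow> real \<Rightarrow> real ^ 2"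
    and \<nu> :: "real \<Rightarrow> real ^ 2 \<Rightarrow> real ^ 2"
    and \<mu> :: "real ^ 2 \<Rightarrow> real \<Rightarrow> real"
    and x0 e n :: "real \<Rightarrow> real ^ 2"
    and y :: "real \<Rightarrow> real \<Rightarrow> real \<Rightarrow> real"
  assumes "0 < T" and "0 < L" and "0 < \<rho>"
    and "moving_domain T M \<Omega> m \<gamma> \<nu>"
    and "\<And>j. j < m \<Longrightarrow> differentiable_bounded 4 M (UNIV \<times> {0..T}) (\<lambda>(\<theta>, \<tau>). \<mu> (\<gamma> j \<theta> \<tau>) \<tau>)"
    and "\<And>\<Delta>t. 0 < \<Delta>t \<Longrightarrow> \<Delta>t \<le> T \<Longrightarrow> x0 \<Delta>t \<in> frontier (\<Omega> \<Delta>t)"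
    and "\<And>\<Delta>t. 0 < \<Delta>t \<Longrightarrow> \<Delta>t \<le> T \<Longrightarrow> n \<Delta>t = - \<nu> \<Delta>t (x0 \<Delta>t)"
    and "\<And>\<Delta>t. 0 < \<Delta>t \<Longrightarrow> \<Delta>t \<le> T \<Longrightarrow>
           local_graph L \<rho> M \<Omega> (x0 \<Delta>t) (e \<Delta>t) (n \<Delta>t) (y \<Delta>t) \<Delta>t"
    and "\<And>\<Delta>t. 0 < \<Delta>t \<Longrightarrow> \<Delta>t \<le> T \<Longrightarrow>
           differentiable_bounded 4 M ({-L<..<L} \<times> {0..\<Delta>t})
             (\<lambda>(s, \<tau>). \<mu> (local_point (x0 \<Delta>t) (e \<Delta>t) (n \<Delta>t) s (y \<Delta>t s \<tau>)) \<tau>)"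
  shows "(\<lambda>\<Delta>t. double_layer m \<gamma> \<nu> \<mu> (x0 \<Delta>t + (c * sqrt \<Delta>t) *\<^sub>R n \<Delta>t) \<Delta>t
            - (- sqrt (\<Delta>t / pi) * E32 (c\<^sup>2 / 4)
                 * ((graph_curvature (y \<Delta>t) \<Delta>t + graph_velocity (y \<Delta>t) \<Delta>t) / 4) * \<mu> (x0 \<Delta>t) \<Delta>t
               - sgn c / 2 * erfc (\<bar>c\<bar> / 2)
                 * (1 + c * sqrt \<Delta>t
                      * ((graph_curvature (y \<Delta>t) \<Delta>t - graph_velocity (y \<Delta>t) \<Delta>t) / 2)) * \<mu> (x0 \<Delta>t) \<Delta>t))
         \<in> O[at_right 0](\<lambda>\<Delta>t. \<Delta>t)"
proof -
  note graph = assms(8) and \<mu>_graph = assms(9)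
  have M: "0 \<le> M"
  proof -
    have "differentiable_bounded 4 M ({-L<..<L} \<times> {0..T}) (\<lambda>(s, \<tau>). y T s \<tau>)"
      using graph[of T] \<open>0 < T\<close> by (simp add: local_graph_def)
    from differentiable_bounded_norm_le[OF this, of "(0, T)"] show ?thesis
      using \<open>0 < T\<close> \<open>0 < L\<close> by auto
  qed
  define K where "K = 3 * M + 1"
  define \<delta> where "\<delta> = min 1 (min L (\<rho> / (4 * (M + 1))))"
  have \<delta>: "0 < \<delta>" "\<delta> \<le> 1" "\<delta> \<le> L" "4 * (M + 1) * \<delta> \<le> \<rho>"
  proof -
    show "0 < \<delta>" using M \<open>0 < L\<close> \<open>0 < \<rho>\<close> by (simp add: \<delta>_def)
    have "\<delta> \<le> \<rho> / (4 * (M + 1))" by (simp add: \<delta>_def)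
    then show "4 * (M + 1) * \<delta> \<le> \<rho>" using M by (simp add: pos_le_divide_eq mult.commute)
  qed (auto simp: \<delta>_def)
  have K: "1 \<le> K" using M by (simp add: K_def)
  (* a bounds sqrt t so that the distance |c| sqrt t of the target to the boundary meets the
     smallness condition of the expansion with constant 2 K / \<delta>^2. *)
  define a where "a = \<delta>\<^sup>2 / (32 * K * (\<bar>c\<bar> + 1))"
  have a: "0 < a" using \<delta> K by (simp add: a_def)
  define t0 where "t0 = min (min 1 T) (min \<delta> (a\<^sup>2))"
  have t0: "0 < t0" using a \<delta> \<open>0 < T\<close> by (simp add: t0_def)
  define C where "C = 6 * expansion_const (2 * K / \<delta>\<^sup>2) + real m * (32 / \<delta> ^ 3 * M\<^sup>2)"
  have bound: "\<bar>double_layer m \<gamma> \<nu> \<mu> (x0 t + (c * sqrt t) *\<^sub>R n t) t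
            - (- sqrt (t / pi) * E32 (c\<^sup>2 / 4)
                 * ((graph_curvature (y t) t + graph_velocity (y t) t) / 4) * \<mu> (x0 t) t
               - sgn c / 2 * erfc (\<bar>c\<bar> / 2)
                 * (1 + c * sqrt t
                      * ((graph_curvature (y t) t - graph_velocity (y t) t) / 2)) * \<mu> (x0 t) t)\<bar> \<le> C * t"
    if "t \<in> {0<..<t0}" for t
  proof -
    have t: "0 < t" "t \<le> 1" "t \<le> T" "t \<le> \<delta>" "t \<le> a\<^sup>2" using that by (auto simp: t0_def)
    have "sqrt t \<le> a" using real_sqrt_le_mono[OF t(5)] a by simp
    then have "\<bar>c\<bar> * sqrt t \<le> (\<bar>c\<bar> + 1) * a" using t by (intro mult_mono) auto
    also have "\<dots> = \<delta>\<^sup>2 / (32 * K)"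
    proof -
      have "b * (\<delta>\<^sup>2 / (32 * K * b)) = \<delta>\<^sup>2 / (32 * K)" if "b \<noteq> 0" for b
        using that by simp
      from this[of "\<bar>c\<bar> + 1"] show ?thesis by (simp add: a_def)
    qed
    finally have "\<bar>c * sqrt t\<bar> * (2 * K / \<delta>\<^sup>2) \<le> \<delta>\<^sup>2 / (32 * K) * (2 * K / \<delta>\<^sup>2)"
      using K t by (intro mult_right_mono) (auto simp: abs_mult)
    also have "\<dots> = 1 / 16" using K \<delta> by (simp add: field_simps)
    finally have r: "\<bar>c * sqrt t\<bar> * (2 * K / \<delta>\<^sup>2) \<le> 1 / 16" .
    show ?thesis
      unfolding double_layer_def
    proof (rule time_integral_close[OF t(1) _ continuous_on_leading_integral has_integral_leading_integral[OF t(1)]])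
      show "continuous_on {0..<t} (\<lambda>\<tau>. boundary_integral m \<gamma> \<tau>
          (layer_density \<nu> \<mu> (x0 t + (c * sqrt t) *\<^sub>R n t) t \<tau>))"
        by (rule continuous_on_boundary_integral[OF assms(4,5) t(3)])
      show "\<bar>boundary_integral m \<gamma> \<tau> (layer_density \<nu> \<mu> (x0 t + (c * sqrt t) *\<^sub>R n t) t \<tau>)
          - leading_integral (c * sqrt t) (graph_curvature (y t) t) (graph_velocity (y t) t) (\<mu> (x0 t) t) (t - \<tau>)\<bar> \<le> C"
        if "\<tau> \<in> {0..<t}" for \<tau>
        unfolding C_def K_def
        by (rule boundary_integral_estimate[OF assms(4,5) graph \<mu>_graph t(1,2,3) \<open>0 < L\<close> \<delta> t(4)
              r[unfolded K_def] that]) (use t in auto)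
    qed
  qed
  show ?thesis
  proof (rule bigoI)
    show "\<forall>\<^sub>F t in at_right 0. norm (double_layer m \<gamma> \<nu> \<mu> (x0 t + (c * sqrt t) *\<^sub>R n t) t
            - (- sqrt (t / pi) * E32 (c\<^sup>2 / 4)
                 * ((graph_curvature (y t) t + graph_velocity (y t) t) / 4) * \<mu> (x0 t) t
               - sgn c / 2 * erfc (\<bar>c\<bar> / 2)
                 * (1 + c * sqrt t
                      * ((graph_curvature (y t) t - graph_velocity (y t) t) / 2)) * \<mu> (x0 t) t)) \<le> C * norm t"
      using t0 by (intro eventually_at_rightI[of 0 t0]) (use bound in auto)
  qed
qed

end
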